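(* Let $n$ and $m$ be positive integers with $n<m$, and let $K$ be an algebraic number field with ring of algebraic integers $\mathcal{O}_K$. Let $U\subseteq \mathrm{Mat}_{n\times m}(\mathcal{O}_K)$ be the set of $n\times m$ rectangular unimodular matrices over $\mathcal{O}_K$. Then the density $\rho(U)$ exists (with respect to every integral basis of $\mathcal{O}_K$, and is independent of the basis), and $$\rho(U)=\prod_{i=0}^{n-1}\frac{1}{\zeta_K(m-i)},$$ where $\zeta_K$ denotes the Dedekind zeta function of $K$.
   Context: Rectangular unimodular: for an integral domain $\mathcal{R}$ and positive integers $n<m$, a matrix $M\in\mathrm{Mat}_{n\times m}(\mathcal{R})$ is rectangular unimodular if there exist $m-n$ rows in $\mathcal{R}^m$ such that adjoining these rows to $M$ gives an $m\times m$ matrix whose determinant is a unit of $\mathcal{R}$. Density: let $k=[K:\mathbb{Q}]$ and let $\mathbb{E}=\{e_1,\dots,e_k\}$ be an integral basis of $\mathcal{O}_K$ (a $\mathbb{Z}$-basis of $\mathcal{O}_K$). For a positive integer $B$ put $$\mathcal{O}[B,\mathbb{E}]=\Big\{\sum_{i=1}^k a_ie_i \;\Big|\; a_i\in[-B,B)\cap\mathbb{Z}\Big\}.$$ For a positive integer $r$ and $S\subseteq\mathcal{O}_K^r$, the upper density $\bar\rho_{\mathbb{E}}(S)$ and lower density $\underline\rho_{\mathbb{E}}(S)$ are the $\limsup$ and $\liminf$, as $B\to\infty$, of $$\frac{|\mathcal{O}[B,\mathbb{E}]^r\cap S|}{(2B)^{rk}}.$$ $S$ has density $d$ with respect to $\mathbb{E}$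 if $\bar\rho_{\mathbb{E}}(S)=\underline\rho_{\mathbb{E}}(S)=d$; if this holds for every integral basis $\mathbb{E}$ with the same $d$, one writes $\rho(S)=d$ and says $S$ has density $d$. For sets of $n\times m$ matrices, $\mathrm{Mat}_{n\times m}(\mathcal{O}_K)$ is identified entrywise with $\mathcal{O}_K^{nm}$. *)

theory Defs
  imports
    "HOL-Analysis.Analysis"
    "HOL-Algebra.QuotRing"
    "Jordan_Normal_Form.Determinant"
begin

definition number_field :: "'a::field_char_0 itself \<Rightarrow> bool" where
  "number_field _ \<longleftrightarrow>
     (\<exists>B :: 'a set. finite B \<and> module.span (\<lambda>(q::rat) x. of_rat q * x) B = UNIV)"

definition nf_degree :: "'a::field_char_0 itself \<Rightarrow> nat" where
  "nf_degree _ = vector_space.dim (\<lambda>(q::rat) x. of_rat q * x) (UNIV :: 'a set)"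


subsection \<open>The ring of integers and the Dedekind zeta function\<close>

definition ring_of_integers :: "'a::field_char_0 ring" where
  "ring_of_integers =
     \<lparr>carrier = {x. algebraic_int x}, monoid.mult = (*), one = 1, zero = 0, add = (+)\<rparr>"

definition ideal_norm :: "'a::field_char_0 set \<Rightarrow> nat" where
  "ideal_norm I = card (carrier (ring_of_integers Quot I))"

text \<open>The Dirichlet series represents the Dedekind zeta function on the half-plane
  \<open>Re s > 1\<close>; no analytic continuation is intended outside of it.\<close>

definition dedekind_zeta :: "'a::field_char_0 itself \<Rightarrow> complex \<Rightarrow> complex" where
  "dedekind_zeta _ s =
     infsum (\<lambda>I. 1 / of_nat (ideal_norm I) powr s)
       {I :: 'a set. ideal I ring_of_integers \<and> I \<noteq> {0}}"


subsection \<open>Density\<close>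

text \<open>In a number field a \<open>\<int>\<close>-basis is also linearly independent over the rationals, so it is automatically finite,
  with \<^const>\<open>nf_degree\<close> many elements.\<close>

definition integral_basis :: "'a::field_char_0 set \<Rightarrow> bool" where
  "integral_basis E \<longleftrightarrow>
     \<not> module.dependent (\<lambda>(c::int) x. of_int c * x) E \<and>
     module.span (\<lambda>(c::int) x. of_int c * x) E = carrier ring_of_integers"

definition integer_box :: "'a::field_char_0 set \<Rightarrow> nat \<Rightarrow> 'a set" where
  "integer_box E B = {(\<Sum>e\<in>E. of_int (a e) * e) | a. a \<in> E \<rightarrow> {- int B..<int B}}"

definition box_ratio ::
    "nat \<Rightarrow> 'a::field_char_0 set \<Rightarrow> 'a Matrix.vec set \<Rightarrow> nat \<Rightarrow> real" where
  "box_ratio r E S B =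
     real (card ({v \<in> carrier_vec r. set\<^sub>v v \<subseteq> integer_box E B} \<inter> S))
       / real (2 * B) ^ (r * nf_degree TYPE('a))"

definition upper_density ::
    "nat \<Rightarrow> 'a::field_char_0 set \<Rightarrow> 'a Matrix.vec set \<Rightarrow> ereal" where
  "upper_density r E S = limsup (\<lambda>B. ereal (box_ratio r E S B))"

definition lower_density ::
    "nat \<Rightarrow> 'a::field_char_0 set \<Rightarrow> 'a Matrix.vec set \<Rightarrow> ereal" where
  "lower_density r E S = liminf (\<lambda>B. ereal (box_ratio r E S B))"

definition has_density :: "nat \<Rightarrow> 'a::field_char_0 Matrix.vec set \<Rightarrow> real \<Rightarrow> bool" where
  "has_density r S d \<longleftrightarrow>
     (\<forall>E. integral_basis E \<longrightarrow> upper_density r E S = ereal d \<and> lower_density r E S = ereal d)"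

text \<open>Row-major identification of \<open>n \<times> m\<close> matrices with vectors of length \<open>n m\<close>.\<close>

definition flatten_mat :: "'a Matrix.mat \<Rightarrow> 'a Matrix.vec" where
  "flatten_mat M = Matrix.vec (dim_row M * dim_col M)
     (\<lambda>k. M $$ (k div dim_col M, k mod dim_col M))"


subsection \<open>Rectangular unimodular matrices\<close>

text \<open>The set \<open>R\<close> is a subring of the ambient ring, in which the determinant is computed;
  the determinant has to be a unit of \<open>R\<close> itself.\<close>

definition rectangular_unimodular ::
    "'a::comm_ring_1 set \<Rightarrow> nat \<Rightarrow> nat \<Rightarrow> 'a Matrix.mat \<Rightarrow> bool" where
  "rectangular_unimodular R n m M \<longleftrightarrow>
     M \<in> carrier_mat n m \<and> elements_mat M \<subseteq> R \<and>
     (\<exists>N \<in> carrier_mat (m - n) m. elements_mat N \<subseteq> R \<and>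
        (\<exists>u\<in>R. Determinant.det (M @\<^sub>r N) * u = 1))"

end

theory Submission
  imports Defs "Jordan_Normal_Form.Char_Poly"
begin

text \<open>A matrix is rectangular unimodular iff its rows are independent modulo every nonzero prime \<open>p\<close>: the rows
  can be completed one by one, because \<open>\<O>\<^sub>K\<close> has stable range two and so every unimodular row of length at
  least two is the first row of an invertible matrix. For a finite set \<open>S\<close> of primes the matrices that are
  independent modulo all \<open>p \<in> S\<close> form a union of residue classes, with density
  \<open>\<Prod>\<^bsub>p\<in>S\<^esub> \<Prod>\<^bsub>i<n\<^esub> (1 - N p\<^bsup>-(m-i)\<^esup>)\<close> by the Chinese remainder theorem, and this tends to the claimed value
  by the Euler product. For the primes outside \<open>S\<close>, choose columns greedily until a minor outside \<open>p\<close> cannot be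
  enlarged: two further entries of the next row are then determined modulo \<open>p\<close> by the other entries. If the
  residue characteristic is at most \<open>2B\<close>, this bounds the exceptional matrices by \<open>N p\<^sup>-\<^sup>2\<close>, the general term of a
  convergent series. If it is larger, one of the two enlarged minors is either zero or has boundedly many
  such prime divisors, and for each of them an entry takes at most \<open>(2B)\<^bsup>k-1\<^esup>\<close> of its \<open>(2B)\<^bsup>k\<^esup>\<close> values.\<close>

subsection \<open>Algebraic integers\<close>

text \<open>The condition at all primes at once is not a union of residue classes, so the
  approximation by a finite \<open>S\<close> needs an error bound that is uniform in
  \<open>B\<close>; this obstacle shapes the counting. One determined entry would only give the
  divergent sum of 1 / N p. Two are available because a minor that is stuck at size
  \<open>j < n < m\<close> leaves at least two columns free. The union over the places where the
  enlargement can stop costs only a constant, since there are finitely many pairs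
  \<open>(j, \<sigma>)\<close>, independent of \<open>p\<close> and \<open>B\<close>. For residue
  characteristic above \<open>2 * B\<close> a residue class in the box need not have its expected
  size, and infinitely many primes remain; hence the divisor argument, for which rational integers
  of controlled size must be extracted from algebraic ones. That is the purpose of
  \<open>size\<close> and \<open>divides_int\<close>. The arithmetic of ideals rests on the
  finiteness of the index, which replaces chain conditions, and multiplication by a prime
  \<open>p\<close> is expressed by a single element \<open>xi p\<close> of the inverse of
  \<open>p\<close>; this yields unique factorisation without general products of ideals.\<close>

interpretation zmod: Modules.module "\<lambda>(c::int) (x::'a::field_char_0). of_int c * x"
  by unfold_locales (auto simp: algebra_simps)

interpretation qvs: Vector_Spaces.vector_space "\<lambda>(c::rat) (x::'a::field_char_0). of_rat c * x"
  by unfold_locales (auto simp: algebra_simps of_rat_add of_rat_mult)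

text \<open>These rules loop together with \<open>of_int_mult\<close> and \<open>mult.assoc\<close>.\<close>

declare zmod.scale_scale [simp del] qvs.scale_scale [simp del]

text \<open>\<open>w\<close> is a nonzero eigenvector of the integer matrix \<open>A\<close> for the
  eigenvalue \<open>x\<close>, and the characteristic polynomial of \<open>A\<close> is monic with
  integer coefficients.\<close>

lemma algebraic_int_eigenvalue:
  fixes x :: "'a::field_char_0" and w :: "nat \<Rightarrow> 'a" and A :: "nat \<Rightarrow> nat \<Rightarrow> int"
  assumes eq: "\<And>i. i < d \<Longrightarrow> x * w i = (\<Sum>j<d. of_int (A i j) * w j)"
    and i0: "i0 < d" "w i0 \<noteq> 0"
  shows "algebraic_int x"
proof -
  define M where "M = Matrix.mat d d (\<lambda>(i,j). A i j)"
  define M' :: "'a Matrix.mat" where "M' = map_mat of_int M"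
  have M: "M \<in> carrier_mat d d" and M': "M' \<in> carrier_mat d d"
    by (auto simp: M_def M'_def)
  have "M' *\<^sub>v Matrix.vec d w = x \<cdot>\<^sub>v Matrix.vec d w"
    by (rule eq_vecI)
       (auto simp: M'_def M_def scalar_prod_def eq atLeast0LessThan)
  moreover have "Matrix.vec d w \<noteq> 0\<^sub>v d"
    using i0 by (metis index_vec index_zero_vec(1))
  ultimately have "eigenvalue M' x"
    unfolding eigenvalue_def eigenvector_def using M' by (intro exI[of _ "Matrix.vec d w"]) auto
  then have "poly (char_poly M') x = 0"
    using eigenvalue_root_char_poly[OF M'] by simp
  moreover have "char_poly M' = map_poly of_int (char_poly M)"
    unfolding M'_def using of_int_hom.char_poly_hom[OF M] by metis
  moreover have "monic (char_poly M)" using degree_monic_char_poly[OF M] by simp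
  ultimately show ?thesis unfolding algebraic_int_altdef_ipoly by metis
qed

text \<open>The determinant trick. \<open>W\<close> may be linearly dependent: any choice of integer
  coefficients for the products \<open>x * w\<close> gives a matrix to which the eigenvalue argument
  applies.\<close>

lemma algebraic_int_if_stable:
  fixes x :: "'a::field_char_0"
  assumes fin: "finite W" and w0: "w0 \<in> W" "w0 \<noteq> 0"
    and st: "\<And>w. w \<in> W \<Longrightarrow> x * w \<in> zmod.span W"
  shows "algebraic_int x"
proof -
  obtain h where h: "bij_betw h {0..<card W} W" using ex_bij_betw_nat_finite[OF fin] by auto
  have "\<exists>c. x * w = (\<Sum>v\<in>W. of_int (c v) * v)" if "w \<in> W" for w
    using st[OF that] unfolding zmod.span_finite[OF fin] by auto
  then obtain c where c: "\<And>w. w \<in> W \<Longrightarrow> x * w = (\<Sum>v\<in>W. of_int (c w v) * v)" by metis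
  obtain i0 where "i0 < card W" "h i0 = w0"
    using h w0 by (metis atLeastLessThan_iff bij_betw_imp_surj_on imageE)
  moreover have "x * h i = (\<Sum>j<card W. of_int (c (h i) (h j)) * h j)" if "i < card W" for i
  proof -
    have "h i \<in> W" using h that by (auto simp: bij_betw_def)
    from c[OF this] show ?thesis
      using sum.reindex_bij_betw[OF h, of "\<lambda>v. of_int (c (h i) v) * v"]
      by (simp add: atLeast0LessThan)
  qed
  ultimately show ?thesis using w0 algebraic_int_eigenvalue[of "card W" x h "\<lambda>i j. c (h i) (h j)" i0]
    by auto
qed

lemma mult_span_subset:
  fixes x :: "'a::field_char_0"
  assumes "\<And>w. w \<in> W \<Longrightarrow> x * w \<in> zmod.span W" and "v \<in> zmod.span W"
  shows "x * v \<in> zmod.span W"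
  using assms(2)
proof (induction rule: zmod.span_induct_alt)
  case base
  then show ?case by (simp add: zmod.span_zero)
next
  case (step c y z)
  have "x * (of_int c * y + z) = of_int c * (x * y) + x * z" by (simp add: algebra_simps)
  then show ?case using step assms(1) by (auto intro!: zmod.span_add zmod.span_scale)
qed

lemma monic_root_power:
  fixes x :: "'a::field_char_0"
  assumes "monic p" "\<And>i. coeff p i \<in> \<int>" "poly p x = 0"
  obtains a :: "nat \<Rightarrow> int" where "x ^ degree p = (\<Sum>i<degree p. of_int (a i) * x ^ i)"
proof -
  have "\<forall>i. \<exists>a::int. coeff p i = of_int a" using assms(2) by (auto simp: Ints_def)
  then obtain a :: "nat \<Rightarrow> int" where a: "\<And>i. coeff p i = of_int (a i)" by metis
  have "0 = (\<Sum>i\<le>degree p. coeff p i * x ^ i)" using assms(3) by (simp add: poly_altdef)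
  also have "\<dots> = (\<Sum>i<degree p. coeff p i * x ^ i) + x ^ degree p"
    using assms(1) unfolding lessThan_Suc_atMost[symmetric] by simp
  finally have "x ^ degree p = - (\<Sum>i<degree p. coeff p i * x ^ i)"
    by (simp add: eq_neg_iff_add_eq_0 add.commute)
  then have "x ^ degree p = (\<Sum>i<degree p. of_int (- a i) * x ^ i)"
    by (simp add: a sum_negf)
  then show ?thesis by (rule that)
qed

text \<open>The monomials below the two degrees span a group that is stable under both factors,
  hence under their product; the leading powers are rewritten by the monic equations.\<close>

lemma algebraic_int_mult:
  fixes x y :: "'a::field_char_0"
  assumes "algebraic_int x" "algebraic_int y"
  shows "algebraic_int (x * y)"
proof -
  from assms(1) obtain p where p: "monic p" "\<And>i. coeff p i \<in> \<int>" "poly p x = 0"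
    by (auto elim: algebraic_int.cases)
  from assms(2) obtain q where q: "monic q" "\<And>i. coeff q i \<in> \<int>" "poly q y = 0"
    by (auto elim: algebraic_int.cases)
  obtain a where a: "x ^ degree p = (\<Sum>i<degree p. of_int (a i) * x ^ i)"
    using monic_root_power[OF p] by auto
  obtain b where b: "y ^ degree q = (\<Sum>i<degree q. of_int (b i) * y ^ i)"
    using monic_root_power[OF q] by auto
  \<comment> \<open>Degree zero would make \<open>p\<close> the constant 1, which has no root.
    Positivity of both degrees puts the monomial 1 into \<open>W\<close>.\<close>
  have dp: "degree p > 0" using p(1,3) by (metis coeff_eq_0 degree_eq_zeroE gr0I lead_coeff_pCons(2) one_neq_zero pCons_0_0 poly_const_conv)
  have dq: "degree q > 0" using q(1,3) by (metis coeff_eq_0 degree_eq_zeroE gr0I lead_coeff_pCons(2) one_neq_zero pCons_0_0 poly_const_conv)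
  define W where "W = (\<lambda>(i,j). x ^ i * y ^ j) ` ({..<degree p} \<times> {..<degree q})"
  have W: "x ^ i * y ^ j \<in> zmod.span W" if "i < degree p" "j < degree q" for i j
    using that by (auto simp: W_def intro!: zmod.span_base)
  have fin: "finite W" by (simp add: W_def)
  have sx: "x * w \<in> zmod.span W" if "w \<in> W" for w
  proof -
    from that obtain i j where ij: "i < degree p" "j < degree q" "w = x ^ i * y ^ j"
      by (auto simp: W_def)
    show ?thesis
    proof (cases "Suc i = degree p")
      case True
      have "x * w = x ^ degree p * y ^ j" using ij True by (metis mult.assoc power_Suc)
      also have "\<dots> = (\<Sum>i<degree p. of_int (a i) * (x ^ i * y ^ j))"
        by (simp add: a sum_distrib_right mult.assoc)
      finally show ?thesis using W ij by (auto intro!: zmod.span_sum zmod.span_scale)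
    next
      case False
      have "x * w = x ^ Suc i * y ^ j" using ij by simp
      then show ?thesis using W[of "Suc i" j] ij False by (auto simp: mult.assoc)
    qed
  qed
  have sy: "y * w \<in> zmod.span W" if "w \<in> W" for w
  proof -
    from that obtain i j where ij: "i < degree p" "j < degree q" "w = x ^ i * y ^ j"
      by (auto simp: W_def)
    show ?thesis
    proof (cases "Suc j = degree q")
      case True
      have "y * w = x ^ i * y ^ degree q" using ij True by (metis mult.left_commute power_Suc)
      also have "\<dots> = (\<Sum>j<degree q. of_int (b j) * (x ^ i * y ^ j))"
        by (simp add: b sum_distrib_left mult.left_commute)
      finally show ?thesis using W ij by (auto intro!: zmod.span_sum zmod.span_scale)
    next
      case False
      have "y * w = x ^ i * y ^ Suc j" using ij by simp
      then show ?thesis using W[of i "Suc j"] ij False by (auto simp: mult_ac)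
    qed
  qed
  have "x * y * w \<in> zmod.span W" if "w \<in> W" for w
    using mult_span_subset[OF sx sy[OF that]] by (simp add: mult.assoc)
  moreover have "1 \<in> W" unfolding W_def using dp dq by (intro image_eqI[of _ _ "(0,0)"]) auto
  ultimately show ?thesis using algebraic_int_if_stable[OF fin, of 1] by auto
qed

text \<open>Multiplying the equation of \<open>x\<close> by the power \<open>c ^ (d - 1)\<close> of
  the leading coefficient turns it into a monic integral equation for \<open>c * x\<close>, which
  makes the span of the powers of \<open>c * x\<close> stable.\<close>

lemma algebraic_imp_multiple_algebraic_int:
  fixes x :: "'a::field_char_0"
  assumes "p \<noteq> 0" "poly (map_poly of_int p) x = 0"
  shows "algebraic_int (of_int (lead_coeff p) * x)"
proof -
  define d where "d = degree p"
  define c where "c = lead_coeff p"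
  define W where "W = (\<lambda>i. (of_int c * x) ^ i) ` {..<d}"
  let ?y = "of_int c * x"
  have c0: "c \<noteq> 0" using assms(1) by (simp add: c_def)
  have d0: "d > 0"
  proof (rule ccontr)
    assume "\<not> d > 0"
    then obtain a where "p = [:a:]" unfolding d_def by (metis degree_eq_zeroE gr0I)
    with assms show False by (auto simp: map_poly_pCons)
  qed
  have W: "?y ^ i \<in> zmod.span W" if "i < d" for i
    using that by (auto simp: W_def intro!: zmod.span_base)
  have "0 = (\<Sum>i\<le>d. of_int (coeff p i) * x ^ i)"
    using assms(2) by (simp add: poly_altdef d_def)
  also have "\<dots> = (\<Sum>i<d. of_int (coeff p i) * x ^ i) + of_int c * x ^ d"
    unfolding lessThan_Suc_atMost[symmetric] c_def d_def by simp
  finally have "of_int c * x ^ d = - (\<Sum>i<d. of_int (coeff p i) * x ^ i)"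
    by (simp add: eq_neg_iff_add_eq_0 add.commute)
  then have "of_int c ^ (d - 1) * (of_int c * x ^ d) = - (\<Sum>i<d. of_int c ^ (d - 1) * (of_int (coeff p i) * x ^ i))"
    by (simp add: sum_distrib_left)
  also have "(\<Sum>i<d. of_int c ^ (d - 1) * (of_int (coeff p i) * x ^ i)) =
      (\<Sum>i<d. of_int (c ^ (d - 1 - i) * coeff p i) * ?y ^ i)"
  proof (rule sum.cong[OF refl])
    fix i assume "i \<in> {..<d}"
    then have "d - 1 = (d - 1 - i) + i" by auto
    then have "(of_int c :: 'a) ^ (d - 1) = of_int c ^ (d - 1 - i) * of_int c ^ i"
      by (metis power_add)
    then show "of_int c ^ (d - 1) * (of_int (coeff p i) * x ^ i) =
        of_int (c ^ (d - 1 - i) * coeff p i) * ?y ^ i"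
      by (simp add: power_mult_distrib algebra_simps)
  qed
  also have "of_int c ^ (d - 1) * (of_int c * x ^ d) = ?y ^ d"
    using d0 by (metis Suc_diff_1 mult.assoc power_Suc2 power_mult_distrib)
  finally have top: "?y ^ d = - (\<Sum>i<d. of_int (c ^ (d - 1 - i) * coeff p i) * ?y ^ i)" .
  have "?y * w \<in> zmod.span W" if "w \<in> W" for w
  proof -
    from that obtain i where i: "i < d" "w = ?y ^ i" by (auto simp: W_def)
    show ?thesis
    proof (cases "Suc i = d")
      case True
      then have "?y * w = ?y ^ d" using i by (metis power_Suc)
      then show ?thesis unfolding top using W
        by (auto intro!: zmod.span_neg zmod.span_sum zmod.span_scale simp del: of_int_mult of_int_power)
    next
      case False
      then show ?thesis using W[of "Suc i"] i by (auto simp del: power_Suc simp: power_Suc[symmetric])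
    qed
  qed
  moreover have "1 \<in> W" unfolding W_def using d0 by (intro image_eqI[of _ _ 0]) auto
  ultimately show ?thesis using algebraic_int_if_stable[of W 1 ?y] by (auto simp: W_def c_def)
qed

subsection \<open>Coordinates with respect to an integral basis\<close>

definition alg_ints :: "'a::field_char_0 set" where
  "alg_ints = {x. algebraic_int x}"

lemma common_denominator:
  fixes u :: "'b \<Rightarrow> rat"
  assumes "finite S"
  obtains d :: int where "d > 0" "\<And>v. v \<in> S \<Longrightarrow> of_int d * u v \<in> \<int>"
proof -
  have "\<exists>d::int. d > 0 \<and> (\<forall>v\<in>S. of_int d * u v \<in> \<int>)"
    using assms
  proof (induction S)
    case empty
    then show ?case by (auto intro: exI[of _ 1])
  next
    case (insert w S)
    then obtain d where d: "d > 0" "\<forall>v\<in>S. of_int d * u v \<in> \<int>" by auto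
    obtain a b where q: "quotient_of (u w) = (a, b)" by (cases "quotient_of (u w)")
    have ab: "u w = of_int a / of_int b" "b > 0"
      using quotient_of_div[OF q] quotient_of_denom_pos[OF q] by auto
    have "of_int (d * b) * u v \<in> \<int>" if "v \<in> insert w S" for v
    proof (cases "v = w")
      case True
      have "of_int (d * b) * u w = of_int (d * a)" using ab by simp
      then show ?thesis using True by (metis Ints_of_int)
    next
      case False
      then have "of_int d * u v \<in> \<int>" using d that by blast
      then have "of_int b * (of_int d * u v) \<in> \<int>" by (rule Ints_mult[OF Ints_of_int])
      then show ?thesis by (simp add: mult_ac)
    qed
    then show ?case using d ab by (intro exI[of _ "d * b"]) auto
  qed
  then show ?thesis using that by blast
qed

text \<open>Density is tested on each basis separately, so one basis is fixed for the whole
  argument. The limit is later identified with values of \<open>dedekind_zeta\<close>, in which the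
  basis does not occur.\<close>

locale integer_ring =
  fixes E :: "'a::field_char_0 set"
  assumes number_field: "number_field TYPE('a)"
    and integral_basis: "integral_basis E"
begin

abbreviation R :: "'a set" where "R \<equiv> alg_ints"

lemma R_span: "R = zmod.span E"
  using integral_basis by (simp add: integral_basis_def ring_of_integers_def alg_ints_def)

lemma E_indep: "\<not> zmod.dependent E"
  using integral_basis by (simp add: integral_basis_def)

text \<open>A rational relation becomes an integral one after multiplication by a common
  denominator.\<close>

lemma E_q_indep: "\<not> qvs.dependent E"
proof
  assume "qvs.dependent E"
  then obtain S u v where S: "finite S" "S \<subseteq> E" "v \<in> S" "u v \<noteq> 0"
      "(\<Sum>v\<in>S. of_rat (u v) * v) = 0"
    unfolding qvs.dependent_explicit by blast
  obtain d where d: "d > 0" "\<And>v. v \<in> S \<Longrightarrow> of_int d * u v \<in> \<int>"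
    using common_denominator[OF S(1)] by blast
  have "\<forall>v\<in>S. \<exists>z::int. of_int d * u v = of_int z"
    using d(2) unfolding Ints_def by blast
  then obtain z where z: "\<And>v. v \<in> S \<Longrightarrow> of_int d * u v = of_int (z v)" by metis
  have "of_int (z v) * v = of_int d * (of_rat (u v) * v)" if "v \<in> S" for v
    using arg_cong[OF z[OF that], of "of_rat :: rat \<Rightarrow> 'a"] by (simp add: of_rat_mult)
  then have "(\<Sum>v\<in>S. of_int (z v) * v) = (\<Sum>v\<in>S. of_int d * (of_rat (u v) * v))"
    by (intro sum.cong) auto
  also have "\<dots> = 0" by (simp add: sum_distrib_left[symmetric] S)
  finally have "(\<Sum>v\<in>S. of_int (z v) * v) = 0" .
  moreover have "z v \<noteq> 0"
  proof
    assume "z v = 0"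
    then have "of_int d * u v = 0" using z[OF S(3)] by simp
    then show False using S(4) d(1) by simp
  qed
  ultimately have "zmod.dependent E" unfolding zmod.dependent_explicit using S by blast
  then show False using E_indep by simp
qed

lemma finite_E: "finite E"
proof -
  obtain B :: "'a set" where B: "finite B" "qvs.span B = UNIV"
    using number_field by (auto simp: number_field_def)
  show ?thesis using qvs.independent_span_bound[OF B(1) E_q_indep] B by auto
qed

text \<open>The powers of \<open>x\<close> up to the dimension satisfy a rational relation, so
  \<open>x\<close> is algebraic, and the leading coefficient of an integral equation clears its
  denominator.\<close>

lemma multiple_in_R:
  obtains c :: int where "c \<noteq> 0" "of_int c * x \<in> R"
proof -
  obtain B :: "'a set" where B: "finite B" "qvs.span B = UNIV"
    using number_field by (auto simp: number_field_def)
  have "\<exists>p. (\<forall>i. coeff p i \<in> \<rat>) \<and> p \<noteq> 0 \<and> poly p x = 0"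
  \<comment> \<open>Linear dependence concerns the set of powers. If two powers coincide, as for a
    root of unity, their difference already gives an equation for \<open>x\<close>.\<close>
  proof (cases "inj_on (\<lambda>i. x ^ i) {..card B}")
    case False
    then obtain i j where ij: "x ^ i = x ^ j" "i \<noteq> j" by (auto simp: inj_on_def)
    let ?p = "monom 1 i - monom 1 j :: 'a poly"
    have "coeff ?p i \<noteq> 0" using ij by simp
    then have "?p \<noteq> 0" by (metis coeff_0)
    moreover have "coeff ?p l \<in> \<rat>" for l by auto
    ultimately show ?thesis using ij by (intro exI[of _ ?p]) (auto simp: poly_monom)
  next
    case True
    let ?X = "(\<lambda>i. x ^ i) ` {..card B}"
    have "card ?X > card B" using card_image[OF True] by simp
    then have "qvs.dependent ?X" using qvs.independent_span_bound[OF B(1), of ?X] B by auto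
    then obtain u v where u: "v \<in> ?X" "u v \<noteq> 0" "(\<Sum>v\<in>?X. of_rat (u v) * v) = 0"
      using qvs.dependent_finite[of ?X] by auto
    then have s: "(\<Sum>i\<le>card B. of_rat (u (x ^ i)) * x ^ i) = 0"
      using sum.reindex[OF True, of "\<lambda>v. of_rat (u v) * v"] by simp
    define p :: "'a poly" where "p = (\<Sum>i\<le>card B. monom (of_rat (u (x ^ i))) i)"
    obtain i where i: "i \<le> card B" "u (x ^ i) \<noteq> 0" using u by auto
    have c: "coeff p l = (if l \<le> card B then of_rat (u (x ^ l)) else 0)" for l
      by (auto simp: p_def coeff_sum if_distrib cong: if_cong)
    have "p \<noteq> 0" using c[of i] i by (metis coeff_0 of_rat_eq_0_iff)
    moreover have "poly p x = 0" using s by (simp add: p_def poly_sum poly_monom)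
    ultimately show ?thesis using c by (intro exI[of _ p]) auto
  qed
  then have "algebraic x" by (simp add: algebraic_altdef)
  then obtain q where q: "\<And>i. coeff q i \<in> \<int>" "q \<noteq> 0" "poly q x = 0"
    unfolding algebraic_def by auto
  have "\<forall>i. \<exists>z::int. coeff q i = of_int z" using q(1) unfolding Ints_def by blast
  then obtain z where z: "\<And>i. coeff q i = of_int (z i)" by metis
  define q' where "q' = Abs_poly z"
  have "coeff q' = z" unfolding q'_def
  proof (rule Abs_poly_inverse, clarsimp)
    show "\<forall>\<^sub>\<infinity>n. z n = 0" using MOST_coeff_eq_0[of q] by (simp add: z)
  qed
  then have qq: "q = map_poly of_int q'" by (intro poly_eqI) (simp add: z coeff_map_poly)
  then have "q' \<noteq> 0" using q(2) by auto
  then have "algebraic_int (of_int (lead_coeff q') * x)"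
    using algebraic_imp_multiple_algebraic_int q(3) qq by metis
  then show ?thesis using that[of "lead_coeff q'"] \<open>q' \<noteq> 0\<close> by (auto simp: alg_ints_def)
qed

text \<open>Together with the rational independence this identifies \<open>card E\<close> with the
  degree that normalises the density.\<close>

lemma q_span_E: "qvs.span E = UNIV"
proof -
  have "x \<in> qvs.span E" for x
  proof -
    obtain c :: int where c: "c \<noteq> 0" "of_int c * x \<in> R" using multiple_in_R by blast
    then obtain a where a: "of_int c * x = (\<Sum>e\<in>E. of_int (a e) * e)"
      unfolding R_span zmod.span_finite[OF finite_E] by auto
    have "(\<Sum>e\<in>E. of_rat (of_int (a e)) * e) \<in> qvs.span E"
      by (intro qvs.span_sum qvs.span_scale qvs.span_base)
    then have "of_int c * x \<in> qvs.span E" using a by simp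
    then have "of_rat (1 / of_int c) * (of_int c * x) \<in> qvs.span E" by (rule qvs.span_scale)
    then show ?thesis using c by (simp add: of_rat_divide)
  qed
  then show ?thesis by auto
qed

lemma card_E: "card E = nf_degree TYPE('a)"
  unfolding nf_degree_def
  using qvs.dim_unique[OF _ _ E_q_indep refl, of UNIV] q_span_E by simp

lemma R_0 [simp]: "0 \<in> R" by (simp add: alg_ints_def)
lemma R_1 [simp]: "1 \<in> R" by (simp add: alg_ints_def int_imp_algebraic_int)
lemma R_of_int [simp]: "of_int z \<in> R" by (simp add: alg_ints_def int_imp_algebraic_int)
lemma R_of_nat [simp]: "of_nat z \<in> R" by (simp add: alg_ints_def int_imp_algebraic_int)
lemma R_add [intro]: "x \<in> R \<Longrightarrow> y \<in> R \<Longrightarrow> x + y \<in> R" unfolding R_span by (rule zmod.span_add)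
lemma R_uminus [intro]: "x \<in> R \<Longrightarrow> - x \<in> R" unfolding R_span by (rule zmod.span_neg)
lemma R_diff [intro]: "x \<in> R \<Longrightarrow> y \<in> R \<Longrightarrow> x - y \<in> R" unfolding R_span by (rule zmod.span_diff)
lemma R_mult [intro]: "x \<in> R \<Longrightarrow> y \<in> R \<Longrightarrow> x * y \<in> R"
  by (simp add: alg_ints_def algebraic_int_mult)
lemma R_power [intro]: "x \<in> R \<Longrightarrow> x ^ n \<in> R" by (induction n) auto
lemma R_sum [intro]: "(\<And>i. i \<in> A \<Longrightarrow> f i \<in> R) \<Longrightarrow> sum f A \<in> R" unfolding R_span by (rule zmod.span_sum)
lemma R_prod [intro]: "(\<And>i. i \<in> A \<Longrightarrow> f i \<in> R) \<Longrightarrow> prod f A \<in> R"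
  by (induction A rule: infinite_finite_induct) auto
lemma R_E: "e \<in> E \<Longrightarrow> e \<in> R" unfolding R_span by (rule zmod.span_base)

definition co :: "'a \<Rightarrow> 'a \<Rightarrow> int" where "co x = zmod.representation E x"

definition comb :: "('a \<Rightarrow> int) \<Rightarrow> 'a" where "comb a = (\<Sum>e\<in>E. of_int (a e) * e)"

lemma comb_R [simp, intro]: "comb a \<in> R"
  unfolding comb_def by (intro R_sum R_mult R_of_int R_E)

lemma comb_co: "x \<in> R \<Longrightarrow> comb (co x) = x"
  unfolding comb_def co_def R_span
  by (rule zmod.sum_representation_eq[OF E_indep _ finite_E]) auto

lemma comb_eq_0: "comb a = 0 \<Longrightarrow> e \<in> E \<Longrightarrow> a e = 0"
  using E_indep unfolding zmod.dependent_finite[OF finite_E] comb_def by auto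

lemma comb_add: "comb (\<lambda>e. a e + b e) = comb a + comb b"
  by (simp add: comb_def algebra_simps sum.distrib)

lemma comb_diff: "comb (\<lambda>e. a e - b e) = comb a - comb b"
  by (simp add: comb_def algebra_simps sum_subtractf)

lemma comb_scale: "comb (\<lambda>e. c * a e) = of_int c * comb a"
  by (simp add: comb_def sum_distrib_left mult.assoc)

lemma comb_cong: "(\<And>e. e \<in> E \<Longrightarrow> a e = b e) \<Longrightarrow> comb a = comb b"
  by (simp add: comb_def)

lemma comb_eqD: "comb a = comb b \<Longrightarrow> e \<in> E \<Longrightarrow> a e = b e"
  using comb_eq_0[of "\<lambda>e. a e - b e" e] by (simp add: comb_diff)

lemma co_comb: "e \<in> E \<Longrightarrow> co (comb a) e = a e"
  using comb_eqD[of "co (comb a)" a] by (simp add: comb_co)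

lemma co_eqI: "x \<in> R \<Longrightarrow> y \<in> R \<Longrightarrow> (\<And>e. e \<in> E \<Longrightarrow> co x e = co y e) \<Longrightarrow> x = y"
  by (subst comb_co[symmetric], assumption, subst comb_co[of y, symmetric], assumption, rule comb_cong)

lemma co_add: "x \<in> R \<Longrightarrow> y \<in> R \<Longrightarrow> e \<in> E \<Longrightarrow> co (x + y) e = co x e + co y e"
  using co_comb[of e "\<lambda>e. co x e + co y e"] by (simp add: comb_add comb_co)

lemma co_scale: "x \<in> R \<Longrightarrow> e \<in> E \<Longrightarrow> co (of_int c * x) e = c * co x e"
  using co_comb[of e "\<lambda>e. c * co x e"] by (simp add: comb_scale comb_co)

lemma E_nonempty: "E \<noteq> {}"
proof
  assume "E = {}"
  then have "R = {0}" unfolding R_span by simp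
  then show False using R_1 one_neq_zero by (metis singletonD)
qed

lemma card_E_pos: "card E > 0" using E_nonempty finite_E by (simp add: card_gt_0_iff)

section \<open>A norm on coordinates and its behaviour under products\<close>

definition size :: "'a \<Rightarrow> int" where "size x = (\<Sum>e\<in>E. \<bar>co x e\<bar>)"

text \<open>Bounds the structure constants of the multiplication in the basis. The summands
  \<open>size 1\<close> and 1 are added so that the same constant also bounds the empty product and
  is at least 1.\<close>

definition mconst :: int where "mconst = (\<Sum>e\<in>E. \<Sum>f\<in>E. size (e * f)) + size 1 + 1"

lemma size_nonneg: "size x \<ge> 0" by (simp add: size_def sum_nonneg)

lemma co_le_size: "e \<in> E \<Longrightarrow> \<bar>co x e\<bar> \<le> size x"
  unfolding size_def by (rule member_le_sum) (auto simp: finite_E)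

lemma mconst_ge_1: "mconst \<ge> 1"
  unfolding mconst_def by (simp add: size_nonneg sum_nonneg)

lemma size_1_le: "size 1 \<le> mconst"
  unfolding mconst_def by (simp add: size_nonneg sum_nonneg)

lemma size_add: "x \<in> R \<Longrightarrow> y \<in> R \<Longrightarrow> size (x + y) \<le> size x + size y"
  unfolding size_def sum.distrib[symmetric] by (intro sum_mono) (simp add: co_add)

lemma size_scale: "x \<in> R \<Longrightarrow> size (of_int c * x) = \<bar>c\<bar> * size x"
  unfolding size_def by (simp add: co_scale abs_mult sum_distrib_left)

lemma size_0: "size 0 = 0" using size_scale[of 0 0] by simp

lemma size_uminus: "x \<in> R \<Longrightarrow> size (- x) = size x"
  using size_scale[of x "-1"] by simp

lemma size_sum: "(\<And>i. i \<in> A \<Longrightarrow> f i \<in> R) \<Longrightarrow> size (sum f A) \<le> (\<Sum>i\<in>A. size (f i))"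
proof (induction A rule: infinite_finite_induct)
  case (insert x F)
  then have "size (f x + sum f F) \<le> size (f x) + size (sum f F)" by (intro size_add) auto
  then show ?case using insert by auto
qed (auto simp: size_0)

lemma size_mult:
  assumes "x \<in> R" "y \<in> R"
  shows "size (x * y) \<le> mconst * size x * size y"
proof -
  have "x * y = (\<Sum>e\<in>E. \<Sum>f\<in>E. of_int (co x e * co y f) * (e * f))"
    by (subst comb_co[OF assms(1), symmetric], subst comb_co[OF assms(2), symmetric])
       (simp add: comb_def sum_product mult_ac)
  also have "size \<dots> \<le> (\<Sum>e\<in>E. size (\<Sum>f\<in>E. of_int (co x e * co y f) * (e * f)))"
    by (rule size_sum) (intro R_sum R_mult R_of_int R_E)
  also have "\<dots> \<le> (\<Sum>e\<in>E. \<Sum>f\<in>E. size (of_int (co x e * co y f) * (e * f)))"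
    by (intro sum_mono size_sum R_sum R_mult R_of_int R_E)
  also have "\<dots> = (\<Sum>e\<in>E. \<Sum>f\<in>E. \<bar>co x e\<bar> * \<bar>co y f\<bar> * size (e * f))"
    by (intro sum.cong refl, subst size_scale) (auto intro: R_E simp: abs_mult)
  also have "\<dots> \<le> (\<Sum>e\<in>E. \<Sum>f\<in>E. size x * size y * size (e * f))"
    by (intro sum_mono mult_right_mono mult_mono co_le_size size_nonneg) auto
  also have "\<dots> = size x * size y * (\<Sum>e\<in>E. \<Sum>f\<in>E. size (e * f))"
    by (simp add: sum_distrib_left)
  also have "\<dots> \<le> size x * size y * mconst"
    by (intro mult_left_mono) (auto simp: mconst_def size_nonneg)
  finally show ?thesis by (simp add: mult_ac)
qed

end

lemma abs_det_le:
  fixes A :: "int Matrix.mat"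
  assumes A: "A \<in> carrier_mat n n" and b: "\<And>i j. i < n \<Longrightarrow> j < n \<Longrightarrow> \<bar>A $$ (i,j)\<bar> \<le> b"
  shows "\<bar>Determinant.det A\<bar> \<le> fact n * b ^ n"
proof -
  have "\<bar>Determinant.det A\<bar> \<le> (\<Sum>p\<in>{p. p permutes {0..<n}}. \<bar>signof p * (\<Prod>i=0..<n. A $$ (i, p i))\<bar>)"
    unfolding det_def'[OF A] by (rule sum_abs)
  also have "\<dots> \<le> (\<Sum>p\<in>{p. p permutes {0..<n}}. b ^ n)"
  proof (rule sum_mono)
    fix p assume p: "p \<in> {p. p permutes {0..<n}}"
    have "\<bar>signof p * (\<Prod>i=0..<n. A $$ (i, p i))\<bar> = (\<Prod>i=0..<n. \<bar>A $$ (i, p i)\<bar>)"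
      by (simp add: abs_mult sign_def abs_prod)
    also have "\<dots> \<le> (\<Prod>i=0..<n. b)"
      using p b by (intro prod_mono) (auto simp: permutes_in_image)
    finally show "\<bar>signof p * (\<Prod>i=0..<n. A $$ (i, p i))\<bar> \<le> b ^ n" by simp
  qed
  also have "\<dots> = fact n * b ^ n" by (simp add: card_permutations)
  finally show ?thesis .
qed

context integer_ring
begin

text \<open>\<open>N\<close> is the determinant of multiplication by \<open>D\<close> in the basis,
  that is, the norm of \<open>D\<close>. The adjugate shows that \<open>D\<close> divides it, and
  the bound comes from the Leibniz formula.\<close>

lemma divides_int:
  assumes D: "D \<in> R" "D \<noteq> 0"
  obtains N :: int and r where "N \<noteq> 0" "\<bar>N\<bar> \<le> fact (card E) * (mconst ^ 2 * size D) ^ card E"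
    "r \<in> R" "of_int N = D * r"
proof -
  let ?k = "card E"
  obtain h where h: "bij_betw h {0..<?k} E" using ex_bij_betw_nat_finite[OF finite_E] by auto
  have hE: "h i \<in> E" if "i < ?k" for i using h that by (auto simp: bij_betw_def)
  define A where "A = Matrix.mat ?k ?k (\<lambda>(i,j). co (D * h i) (h j))"
  have A: "A \<in> carrier_mat ?k ?k" by (simp add: A_def)
  have reidx: "(\<Sum>j<?k. f (h j)) = sum f E" for f :: "'a \<Rightarrow> 'a"
    using sum.reindex_bij_betw[OF h, of f] by (simp add: atLeast0LessThan)
  have row: "(\<Sum>j<?k. of_int (A $$ (i,j)) * h j) = D * h i" if "i < ?k" for i
  proof -
    have "(\<Sum>j<?k. of_int (A $$ (i,j)) * h j) = comb (co (D * h i))"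
      using that by (simp add: A_def comb_def reidx[symmetric])
    then show ?thesis using comb_co[of "D * h i"] D hE[OF that] R_E by auto
  qed
  \<comment> \<open>A basis vector has size 1; with \<open>size_mult\<close> this bounds all entries
    of \<open>A\<close>.\<close>
  have sE: "size e \<le> mconst" if "e \<in> E" for e
  proof -
    have "size e = (\<Sum>f\<in>E. \<bar>co e f\<bar>)" by (simp add: size_def)
    also have "\<dots> = (\<Sum>f\<in>E. if f = e then 1 else 0)"
    proof (rule sum.cong[OF refl])
      fix f assume f: "f \<in> E"
      have "comb (\<lambda>f. if f = e then 1 else 0) = e"
      proof -
        have "comb (\<lambda>f. if f = e then 1 else 0) = (\<Sum>f\<in>E. if f = e then f else 0)"
          unfolding comb_def by (intro sum.cong) auto
        then show ?thesis using that finite_E by simp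
      qed
      then show "\<bar>co e f\<bar> = (if f = e then 1 else 0)" using co_comb[OF f, of "\<lambda>f. if f = e then 1 else 0"] by simp
    qed
    also have "\<dots> = 1" using that finite_E by simp
    finally show ?thesis using mconst_ge_1 by simp
  qed
  have bound: "\<bar>A $$ (i,j)\<bar> \<le> mconst ^ 2 * size D" if "i < ?k" "j < ?k" for i j
  proof -
    have "\<bar>A $$ (i,j)\<bar> \<le> size (D * h i)" using that hE by (simp add: A_def co_le_size)
    also have "\<dots> \<le> mconst * size D * size (h i)"
      using size_mult[of D "h i"] D hE[OF that(1)] R_E by auto
    also have "\<dots> \<le> mconst * size D * mconst"
      using sE[OF hE[OF that(1)]] mconst_ge_1 size_nonneg[of D] by (intro mult_left_mono) auto
    finally show ?thesis by (simp add: power2_eq_square mult_ac)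
  qed
  \<comment> \<open>A kernel vector of the transpose is an integer relation between the elements
    \<open>D * h i\<close>; cancelling \<open>D\<close> contradicts the independence of the
    basis.\<close>
  have det0: "Determinant.det A \<noteq> 0"
  proof
    assume "Determinant.det A = 0"
    then have "Determinant.det A\<^sup>T = 0" using det_transpose[OF A] by simp
    then obtain v where v: "v \<in> carrier_vec ?k" "v \<noteq> 0\<^sub>v ?k" "A\<^sup>T *\<^sub>v v = 0\<^sub>v ?k"
      using det_0_iff_vec_prod_zero[of "A\<^sup>T" ?k] A by auto
    have z: "(\<Sum>i<?k. A $$ (i,j) * v $ i) = 0" if "j < ?k" for j
    proof -
      have "(A\<^sup>T *\<^sub>v v) $ j = 0" using v(3) that by simp
      then show ?thesis using that A v(1) by (simp add: scalar_prod_def atLeast0LessThan)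
    qed
    have "D * (\<Sum>i<?k. of_int (v $ i) * h i) = (\<Sum>i<?k. of_int (v $ i) * (D * h i))"
      by (simp add: sum_distrib_left mult_ac)
    also have "\<dots> = (\<Sum>i<?k. \<Sum>j<?k. of_int (A $$ (i,j) * v $ i) * h j)"
      by (intro sum.cong refl) (simp add: row[symmetric] sum_distrib_left mult_ac)
    also have "\<dots> = (\<Sum>j<?k. of_int (\<Sum>i<?k. A $$ (i,j) * v $ i) * h j)"
      by (subst sum.swap) (simp add: sum_distrib_right)
    also have "\<dots> = 0" by (simp add: z)
    finally have s0: "(\<Sum>i<?k. of_int (v $ i) * h i) = 0" using D by simp
    define g where "g e = v $ (inv_into {0..<?k} h e)" for e
    have gh: "g (h i) = v $ i" if "i < ?k" for i
      using h that unfolding g_def by (simp add: bij_betw_def)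
    have "comb g = (\<Sum>i<?k. of_int (g (h i)) * h i)" unfolding comb_def by (rule reidx[symmetric])
    then have "comb g = 0" using s0 gh by simp
    then have "v $ i = 0" if "i < ?k" for i using comb_eq_0[of g, OF _ hE[OF that]] gh[OF that] by simp
    then show False using v(1,2) by auto
  qed
  have adj: "of_int (Determinant.det A) * h i = D * (\<Sum>j<?k. of_int (adj_mat A $$ (i,j)) * h j)"
    if "i < ?k" for i
  proof -
    have "D * (\<Sum>j<?k. of_int (adj_mat A $$ (i,j)) * h j) = (\<Sum>j<?k. of_int (adj_mat A $$ (i,j)) * (D * h j))"
      by (simp add: sum_distrib_left mult_ac)
    also have "\<dots> = (\<Sum>j<?k. \<Sum>l<?k. of_int (adj_mat A $$ (i,j) * A $$ (j,l)) * h l)"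
      by (intro sum.cong refl) (simp add: row[symmetric] sum_distrib_left mult_ac)
    also have "\<dots> = (\<Sum>l<?k. of_int (\<Sum>j<?k. adj_mat A $$ (i,j) * A $$ (j,l)) * h l)"
      by (subst sum.swap) (simp add: sum_distrib_right)
    also have "\<dots> = (\<Sum>l<?k. of_int ((adj_mat A * A) $$ (i,l)) * h l)"
      using A adj_mat(1)[OF A] that
      by (intro sum.cong refl arg_cong[where f = "\<lambda>x. of_int x * _"]) (simp add: scalar_prod_def atLeast0LessThan)
    also have "\<dots> = (\<Sum>l<?k. if l = i then of_int (Determinant.det A) * h i else 0)"
      unfolding adj_mat(3)[OF A] using that by (intro sum.cong refl) auto
    also have "\<dots> = of_int (Determinant.det A) * h i" using that by simp
    finally show ?thesis by simp
  qed
  \<comment> \<open>The adjugate solves \<open>D * y = det A * h i\<close> for every basis element;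
    writing 1 in the basis combines these solutions.\<close>
  define r where "r = (\<Sum>i<?k. of_int (co 1 (h i)) * (\<Sum>j<?k. of_int (adj_mat A $$ (i,j)) * h j))"
  have "r \<in> R" unfolding r_def using hE R_E by (intro R_sum R_mult) auto
  have "of_int (Determinant.det A) * comb (co 1) = (\<Sum>i<?k. of_int (co 1 (h i)) * (of_int (Determinant.det A) * h i))"
    unfolding comb_def reidx[symmetric] by (simp add: sum_distrib_left mult_ac)
  also have "\<dots> = (\<Sum>i<?k. of_int (co 1 (h i)) * (D * (\<Sum>j<?k. of_int (adj_mat A $$ (i,j)) * h j)))"
    by (intro sum.cong refl) (simp only: adj lessThan_iff)
  also have "\<dots> = D * r"
    unfolding r_def sum_distrib_left by (intro sum.cong refl) (simp add: mult_ac)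
  finally have "of_int (Determinant.det A) = D * r" by (simp add: comb_co)
  moreover have "\<bar>Determinant.det A\<bar> \<le> fact ?k * (mconst ^ 2 * size D) ^ ?k"
    using abs_det_le[OF A bound] by simp
  ultimately show ?thesis using that det0 \<open>r \<in> R\<close> by blast
qed

end

subsection \<open>Ideals\<close>

context integer_ring
begin

text \<open>One definition serves both for the box from \<open>- B\<close> to \<open>B\<close> of
  the density and for the residues from 0 to \<open>Q\<close> modulo a rational integer
  \<open>Q\<close>.\<close>

definition rbox :: "int \<Rightarrow> int \<Rightarrow> 'a set" where
  "rbox lo hi = {x \<in> R. \<forall>e\<in>E. lo \<le> co x e \<and> co x e < hi}"

lemma rbox_bij: "bij_betw comb (E \<rightarrow>\<^sub>E {lo..<hi}) (rbox lo hi)"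
proof (rule bij_betwI[where g = "\<lambda>x. restrict (co x) E"])
  show "comb \<in> (E \<rightarrow>\<^sub>E {lo..<hi}) \<rightarrow> rbox lo hi"
  proof
    fix a assume a: "a \<in> E \<rightarrow>\<^sub>E {lo..<hi}"
    show "comb a \<in> rbox lo hi" unfolding rbox_def
      using PiE_mem[OF a] by (auto simp: co_comb)
  qed
  show "(\<lambda>x. restrict (co x) E) \<in> rbox lo hi \<rightarrow> E \<rightarrow>\<^sub>E {lo..<hi}"
    by (auto simp: rbox_def)
  show "restrict (co (comb a)) E = a" if "a \<in> E \<rightarrow>\<^sub>E {lo..<hi}" for a
  proof
    fix e
    show "restrict (co (comb a)) E e = a e"
      using co_comb[of e a] PiE_arb[OF that, of e] by (cases "e \<in> E") (simp_all add: restrict_def)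
  qed
  show "comb (restrict (co x) E) = x" if "x \<in> rbox lo hi" for x
  proof -
    have "comb (restrict (co x) E) = comb (co x)" by (rule comb_cong) simp
    also have "\<dots> = x" using that by (intro comb_co) (simp add: rbox_def)
    finally show ?thesis .
  qed
qed

lemma card_rbox: "card (rbox lo hi) = nat (hi - lo) ^ card E"
  using bij_betw_same_card[OF rbox_bij[of lo hi]] finite_E by (simp add: card_PiE)

lemma finite_rbox: "finite (rbox lo hi)"
  using bij_betw_finite[OF rbox_bij[of lo hi]] finite_E by (simp add: finite_PiE)

lemma rbox_R: "rbox lo hi \<subseteq> R" by (auto simp: rbox_def)

definition red :: "nat \<Rightarrow> 'a \<Rightarrow> 'a" where
  "red Q x = comb (\<lambda>e. co x e mod int Q)"

lemma red_rbox: "Q > 0 \<Longrightarrow> red Q x \<in> rbox 0 (int Q)"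
  by (simp add: rbox_def red_def co_comb)

lemma red_R: "red Q x \<in> R" by (simp add: red_def)

lemma red_decomp: "x \<in> R \<Longrightarrow> x = of_int (int Q) * comb (\<lambda>e. co x e div int Q) + red Q x"
  unfolding red_def comb_scale[symmetric] comb_add[symmetric]
  by (subst comb_co[symmetric], assumption) (rule comb_cong, simp)

text \<open>A nonzero ideal, the unit ideal included, as a plain subset of the field; negatives come
  from multiplication by -1. The link to \<open>ideal\<close> is
  \<open>ideal_iff_nideal\<close>.\<close>

definition nideal :: "'a set \<Rightarrow> bool" where
  "nideal I \<longleftrightarrow> I \<subseteq> R \<and> (\<exists>x\<in>I. x \<noteq> 0) \<and> (\<forall>x\<in>I. \<forall>y\<in>I. x + y \<in> I) \<and> (\<forall>r\<in>R. \<forall>x\<in>I. r * x \<in> I)"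

lemma nidealI:
  assumes "I \<subseteq> R" "x \<in> I" "x \<noteq> 0" "\<And>x y. x \<in> I \<Longrightarrow> y \<in> I \<Longrightarrow> x + y \<in> I"
    "\<And>r x. r \<in> R \<Longrightarrow> x \<in> I \<Longrightarrow> r * x \<in> I"
  shows "nideal I"
  using assms unfolding nideal_def by blast

lemma nideal_sub: "nideal I \<Longrightarrow> x \<in> I \<Longrightarrow> x \<in> R"
  and nideal_add: "nideal I \<Longrightarrow> x \<in> I \<Longrightarrow> y \<in> I \<Longrightarrow> x + y \<in> I"
  and nideal_mult: "nideal I \<Longrightarrow> r \<in> R \<Longrightarrow> x \<in> I \<Longrightarrow> r * x \<in> I"
  and nideal_nonzero: "nideal I \<Longrightarrow> \<exists>x\<in>I. x \<noteq> 0"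
  unfolding nideal_def by blast+

lemma nideal_mult': "nideal I \<Longrightarrow> r \<in> R \<Longrightarrow> x \<in> I \<Longrightarrow> x * r \<in> I"
  using nideal_mult[of I r x] by (simp add: mult.commute)

lemma nideal_0: "nideal I \<Longrightarrow> 0 \<in> I"
  using nideal_nonzero[of I] nideal_mult[of I 0] by auto

lemma nideal_uminus: "nideal I \<Longrightarrow> x \<in> I \<Longrightarrow> - x \<in> I"
  using nideal_mult[of I "-1" x] by (simp add: R_uminus)

lemma nideal_diff: "nideal I \<Longrightarrow> x \<in> I \<Longrightarrow> y \<in> I \<Longrightarrow> x - y \<in> I"
  using nideal_add[of I x "-y"] nideal_uminus[of I y] by simp

lemma nideal_diff_sym: "nideal I \<Longrightarrow> x - y \<in> I \<Longrightarrow> y - x \<in> I"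
  using nideal_uminus[of I "x - y"] by simp

lemma nideal_diff_trans: "nideal I \<Longrightarrow> x - y \<in> I \<Longrightarrow> y - z \<in> I \<Longrightarrow> x - z \<in> I"
  using nideal_add[of I "x - y" "y - z"] by simp

lemma nideal_diff_mem: "nideal I \<Longrightarrow> x - y \<in> I \<Longrightarrow> x \<in> I \<longleftrightarrow> y \<in> I"
  using nideal_add[of I "x - y" y] nideal_diff[of I x "x - y"] by auto

lemma nideal_sum: "nideal I \<Longrightarrow> (\<And>i. i \<in> A \<Longrightarrow> f i \<in> I) \<Longrightarrow> sum f A \<in> I"
  by (induction A rule: infinite_finite_induct) (auto simp: nideal_0 nideal_add)

lemma nideal_R: "nideal R"
  by (rule nidealI[of _ 1]) auto

lemma nideal_1_eq_R: "nideal I \<Longrightarrow> 1 \<in> I \<Longrightarrow> I = R"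
  using nideal_mult[of I _ 1] nideal_sub[of I] by auto

lemma nideal_principal: "a \<in> R \<Longrightarrow> a \<noteq> 0 \<Longrightarrow> nideal {a * r | r. r \<in> R}"
proof (rule nidealI[of _ a])
  show "a \<in> {a * r | r. r \<in> R}" by (auto intro!: exI[of _ 1])
  show "x + y \<in> {a * r | r. r \<in> R}" if "x \<in> {a * r | r. r \<in> R}" "y \<in> {a * r | r. r \<in> R}" for x y
    using that by (auto simp: distrib_left[symmetric])
  show "r * x \<in> {a * r | r. r \<in> R}" if "r \<in> R" "x \<in> {a * r | r. r \<in> R}" for r x
    using that by (auto simp: mult.left_commute[of r])
qed auto

text \<open>The norm of a nonzero element is a multiple of it. A rational integer in
  \<open>I\<close> makes membership in \<open>I\<close> periodic in the coordinates.\<close>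

lemma nideal_pos_nat:
  assumes "nideal I"
  obtains N :: nat where "N > 0" "of_nat N \<in> I"
proof -
  obtain D where D: "D \<in> I" "D \<noteq> 0" using nideal_nonzero[OF assms] by blast
  have "D \<in> R" using nideal_sub[OF assms D(1)] .
  then obtain N r where N: "N \<noteq> 0" "r \<in> R" "of_int N = D * r" using divides_int[OF _ D(2)] by metis
  have "of_int N \<in> I" using nideal_mult'[OF assms N(2) D(1)] N(3) by simp
  then have "of_int \<bar>N\<bar> \<in> I" using nideal_uminus[OF assms, of "of_int N"] by (auto simp: abs_if)
  then have "of_nat (nat \<bar>N\<bar>) \<in> I" by simp
  then show ?thesis using that[of "nat \<bar>N\<bar>"] N(1) by simp
qed

definition cls :: "'a set \<Rightarrow> 'a \<Rightarrow> 'a set" where "cls I x = {y \<in> R. y - x \<in> I}"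

definition idx :: "'a set \<Rightarrow> nat" where "idx I = card (cls I ` R)"

lemma cls_eq_iff:
  assumes "nideal I" "x \<in> R" "y \<in> R"
  shows "cls I x = cls I y \<longleftrightarrow> x - y \<in> I"
proof
  assume "cls I x = cls I y"
  moreover have "x \<in> cls I x" using assms by (simp add: cls_def nideal_0)
  ultimately show "x - y \<in> I" by (simp add: cls_def)
next
  assume *: "x - y \<in> I"
  show "cls I x = cls I y" unfolding cls_def
    using nideal_diff_trans[OF assms(1)] nideal_diff_sym[OF assms(1)] * by blast
qed

lemma red_cong: "nideal I \<Longrightarrow> of_nat Q \<in> I \<Longrightarrow> x \<in> R \<Longrightarrow> x - red Q x \<in> I"
proof -
  assume I: "nideal I" and Q: "of_nat Q \<in> I" and x: "x \<in> R"
  have "x - red Q x = of_nat Q * comb (\<lambda>e. co x e div int Q)"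
    using red_decomp[OF x, of Q] by (simp add: algebra_simps)
  then show ?thesis using nideal_mult'[OF I comb_R Q] by metis
qed

text \<open>Every class meets the finite box of coordinates reduced modulo an integer of the
  ideal.\<close>

lemma finite_cls: "nideal I \<Longrightarrow> finite (cls I ` R)"
proof -
  assume I: "nideal I"
  obtain N where N: "N > 0" "of_nat N \<in> I" using nideal_pos_nat[OF I] .
  have "cls I ` R \<subseteq> cls I ` rbox 0 (int N)"
  proof (rule image_subsetI)
    fix x assume x: "x \<in> R"
    have "cls I x = cls I (red N x)"
      using cls_eq_iff[OF I x red_R] red_cong[OF I N(2) x] by simp
    then show "cls I x \<in> cls I ` rbox 0 (int N)" using red_rbox[OF N(1)] by blast
  qed
  then show ?thesis by (rule finite_surj[OF finite_rbox])
qed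

lemma idx_pos: "nideal I \<Longrightarrow> idx I > 0"
proof -
  assume I: "nideal I"
  have "cls I 0 \<in> cls I ` R" by simp
  then show ?thesis unfolding idx_def card_gt_0_iff using finite_cls[OF I] by blast
qed

definition is_reps :: "'a set \<Rightarrow> 'a set \<Rightarrow> bool" where
  "is_reps I T \<longleftrightarrow> T \<subseteq> R \<and> (\<forall>x\<in>R. \<exists>t\<in>T. x - t \<in> I) \<and> (\<forall>s\<in>T. \<forall>t\<in>T. s - t \<in> I \<longrightarrow> s = t)"

lemma is_reps_bij: "nideal I \<Longrightarrow> is_reps I T \<Longrightarrow> bij_betw (cls I) T (cls I ` R)"
proof -
  assume I: "nideal I" and T: "is_reps I T"
  have TR: "T \<subseteq> R" using T by (simp add: is_reps_def)
  have "inj_on (cls I) T"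
    using T TR cls_eq_iff[OF I] unfolding is_reps_def inj_on_def by blast
  moreover have "cls I x \<in> cls I ` T" if x: "x \<in> R" for x
  proof -
    obtain t where "t \<in> T" "x - t \<in> I" using T x unfolding is_reps_def by blast
    then show ?thesis using cls_eq_iff[OF I x, of t] TR by blast
  qed
  ultimately show ?thesis using TR unfolding bij_betw_def by blast
qed

lemma is_reps_card: "nideal I \<Longrightarrow> is_reps I T \<Longrightarrow> card T = idx I"
  unfolding idx_def by (rule bij_betw_same_card[OF is_reps_bij])

lemma is_reps_finite: "nideal I \<Longrightarrow> is_reps I T \<Longrightarrow> finite T"
  using bij_betw_finite[OF is_reps_bij] finite_cls by blast

definition reps :: "'a set \<Rightarrow> 'a set" where
  "reps I = (\<lambda>c. SOME x. x \<in> R \<and> cls I x = c) ` (cls I ` R)"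

lemma is_reps_reps:
  assumes I: "nideal I"
  shows "is_reps I (reps I)"
proof -
  define f where "f c = (SOME x. x \<in> R \<and> cls I x = c)" for c
  have f: "f c \<in> R \<and> cls I (f c) = c" if "c \<in> cls I ` R" for c
    unfolding f_def by (rule someI_ex) (use that in auto)
  have r: "reps I = f ` (cls I ` R)" unfolding reps_def f_def ..
  have "\<exists>t\<in>reps I. x - t \<in> I" if x: "x \<in> R" for x
    using f[of "cls I x"] x cls_eq_iff[OF I x, of "f (cls I x)"] unfolding r by blast
  moreover have "s = t" if st: "s \<in> reps I" "t \<in> reps I" "s - t \<in> I" for s t
  proof -
    obtain c d where cd: "c \<in> cls I ` R" "d \<in> cls I ` R" "s = f c" "t = f d" using st unfolding r by blast
    then have "cls I s = cls I t" using cls_eq_iff[OF I] st f by metis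
    then show ?thesis using cd f by metis
  qed
  moreover have "reps I \<subseteq> R" unfolding r using f by blast
  ultimately show ?thesis unfolding is_reps_def by blast
qed

lemma reps_R: "nideal I \<Longrightarrow> reps I \<subseteq> R"
  using is_reps_reps[of I] by (auto simp: is_reps_def)

lemma reps_ex: "nideal I \<Longrightarrow> x \<in> R \<Longrightarrow> \<exists>t\<in>reps I. x - t \<in> I"
  using is_reps_reps[of I] unfolding is_reps_def by blast

lemma reps_unique: "nideal I \<Longrightarrow> s \<in> reps I \<Longrightarrow> t \<in> reps I \<Longrightarrow> s - t \<in> I \<Longrightarrow> s = t"
  using is_reps_reps[of I] unfolding is_reps_def by blast

lemma card_reps: "nideal I \<Longrightarrow> card (reps I) = idx I"
  using is_reps_card is_reps_reps by blast

lemma finite_reps: "nideal I \<Longrightarrow> finite (reps I)"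
  using is_reps_finite is_reps_reps by blast

text \<open>Representatives modulo \<open>J\<close> are inequivalent modulo \<open>I\<close>, and
  adding to one of them an element of \<open>J\<close> outside \<open>I\<close> produces a further
  class. The index thus serves as the measure for all minimality and induction arguments on
  ideals.\<close>

lemma idx_psubset:
  assumes I: "nideal I" and J: "nideal J" and sub: "I \<subset> J"
  shows "idx J < idx I"
proof -
  obtain z where z: "z \<in> J" "z \<notin> I" using sub by blast
  have zR: "z \<in> R" using nideal_sub[OF J z(1)] .
  obtain t0 where t0: "t0 \<in> reps J" using reps_ex[OF J R_0] by blast
  have rJ: "reps J \<subseteq> R" by (rule reps_R[OF J])
  have inj: "inj_on (cls I) (reps J)"
  proof (rule inj_onI)
    fix s t assume st: "s \<in> reps J" "t \<in> reps J" "cls I s = cls I t"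
    then have "s - t \<in> I" using cls_eq_iff[OF I] rJ by blast
    then show "s = t" using reps_unique[OF J] st sub by blast
  qed
  have new: "cls I (t0 + z) \<notin> cls I ` reps J"
  proof
    assume "cls I (t0 + z) \<in> cls I ` reps J"
    then obtain t where t: "t \<in> reps J" "cls I (t0 + z) = cls I t" by blast
    then have d: "t0 + z - t \<in> I" using cls_eq_iff[OF I, of "t0 + z" t] rJ t0 zR by blast
    then have "t0 + z - t - z \<in> J" using sub by (intro nideal_diff[OF J _ z(1)]) blast
    then have "t0 = t" using reps_unique[OF J t0 t(1)] by simp
    then show False using d z by simp
  qed
  have "cls I (t0 + z) \<in> cls I ` R" using rJ t0 zR by blast
  then have "cls I ` reps J \<subset> cls I ` R" using rJ new by blast
  then have "card (cls I ` reps J) < card (cls I ` R)" using finite_cls[OF I] by (rule psubset_card_mono[rotated])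
  then show ?thesis using card_image[OF inj] card_reps[OF J] by (simp add: idx_def)
qed

lemma idx_R: "idx R = 1"
proof -
  have "is_reps R {0}" by (auto simp: is_reps_def)
  then show ?thesis using is_reps_card[OF nideal_R] by force
qed

text \<open>\<open>R\<close> is integrally closed: a nonzero ideal is a finitely generated group, so
  the determinant trick applies to it.\<close>

lemma stable_in_R:
  assumes L: "nideal L" and st: "\<And>x. x \<in> L \<Longrightarrow> \<xi> * x \<in> L"
  shows "\<xi> \<in> R"
proof -
  obtain N where N: "N > 0" "of_nat N \<in> L" using nideal_pos_nat[OF L] .
  \<comment> \<open>Generators of \<open>L\<close>: the multiples of the basis by an integer
    \<open>N\<close> of \<open>L\<close>, and the elements of \<open>L\<close> among the residues
    modulo \<open>N\<close>. The element \<open>N\<close> itself is the nonzero vector that the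
    criterion asks for.\<close>
  define W where "W = insert (of_nat N) ((\<lambda>e. of_nat N * e) ` E \<union> (rbox 0 (int N) \<inter> L))"
  have WL: "L \<subseteq> zmod.span W"
  proof
    fix x assume x: "x \<in> L"
    then have xR: "x \<in> R" using nideal_sub[OF L] by blast
    have r: "red N x \<in> L" using red_cong[OF L N(2) xR] nideal_diff_mem[OF L] x by blast
    have "of_int (int N) * comb (\<lambda>e. co x e div int N) = (\<Sum>e\<in>E. of_int (co x e div int N) * (of_nat N * e))"
      unfolding comb_def by (simp add: sum_distrib_left mult_ac)
    also have "\<dots> \<in> zmod.span W"
      by (intro zmod.span_sum zmod.span_scale zmod.span_base) (auto simp: W_def)
    finally have 1: "of_int (int N) * comb (\<lambda>e. co x e div int N) \<in> zmod.span W" .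
    have 2: "red N x \<in> zmod.span W"
      using r red_rbox[OF N(1)] by (intro zmod.span_base) (auto simp: W_def)
    from zmod.span_add[OF 1 2] show "x \<in> zmod.span W" using red_decomp[OF xR, of N] by simp
  qed
  have "W \<subseteq> L"
    using N L by (auto simp: W_def intro!: nideal_mult' R_E)
  then have "\<xi> * w \<in> zmod.span W" if "w \<in> W" for w
    using st[of w] WL that by blast
  moreover have "finite W" using finite_E finite_rbox by (simp add: W_def)
  ultimately have "algebraic_int \<xi>"
    using algebraic_int_if_stable[of W "of_nat N" \<xi>] N(1) by (auto simp: W_def)
  then show ?thesis by (simp add: alg_ints_def)
qed

text \<open>Maximal among the proper nonzero ideals. As all residue rings are finite, these are
  exactly the nonzero prime ideals, and invertibility modulo \<open>p\<close> is directly
  available.\<close>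

definition prm :: "'a set \<Rightarrow> bool" where
  "prm p \<longleftrightarrow> nideal p \<and> 1 \<notin> p \<and> (\<forall>J. nideal J \<and> p \<subseteq> J \<and> 1 \<notin> J \<longrightarrow> J = p)"

lemma prm_nideal: "prm p \<Longrightarrow> nideal p" and prm_1: "prm p \<Longrightarrow> 1 \<notin> p"
  by (auto simp: prm_def)

lemma prm_inv:
  assumes p: "prm p" and a: "a \<in> R" "a \<notin> p"
  obtains b where "b \<in> R" "a * b - 1 \<in> p"
proof -
  have P: "nideal p" using prm_nideal[OF p] .
  let ?J = "{x + a * r | x r. x \<in> p \<and> r \<in> R}"
  have pJ: "p \<subseteq> ?J"
  proof
    fix x assume "x \<in> p"
    then have "x = x + a * 0 \<and> x \<in> p \<and> 0 \<in> R" by simp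
    then show "x \<in> ?J" by blast
  qed
  obtain y where y: "y \<in> p" "y \<noteq> 0" using nideal_nonzero[OF P] by blast
  have "nideal ?J"
  proof (rule nidealI[of _ y])
    show "?J \<subseteq> R" using nideal_sub[OF P] a by blast
    show "y \<in> ?J" "y \<noteq> 0" using y pJ by auto
    show "x + y \<in> ?J" if h: "x \<in> ?J" "y \<in> ?J" for x y
    proof -
      obtain x1 r1 x2 r2 where "x = x1 + a * r1" "y = x2 + a * r2" "x1 \<in> p" "x2 \<in> p" "r1 \<in> R" "r2 \<in> R"
        using h by blast
      then have "x + y = (x1 + x2) + a * (r1 + r2)" "x1 + x2 \<in> p" "r1 + r2 \<in> R"
        using nideal_add[OF P] by (auto simp: algebra_simps)
      then show ?thesis by blast
    qed
    show "r * x \<in> ?J" if h: "r \<in> R" "x \<in> ?J" for r x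
    proof -
      obtain x1 r1 where "x = x1 + a * r1" "x1 \<in> p" "r1 \<in> R" using h by blast
      then have "r * x = r * x1 + a * (r * r1)" "r * x1 \<in> p" "r * r1 \<in> R"
        using nideal_mult[OF P] h by (auto simp: algebra_simps)
      then show ?thesis by blast
    qed
  qed
  moreover have "a \<in> ?J"
  proof -
    have "a = 0 + a * 1 \<and> 0 \<in> p \<and> 1 \<in> R" using nideal_0[OF P] by simp
    then show ?thesis by blast
  qed
  ultimately have "1 \<in> ?J" using p a pJ unfolding prm_def by blast
  then obtain x r where "1 = x + a * r" "x \<in> p" "r \<in> R" by blast
  then have "a * r - 1 = - x" by (simp add: algebra_simps)
  then show ?thesis using that[of r] nideal_uminus[OF P \<open>x \<in> p\<close>] \<open>r \<in> R\<close> by metis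
qed

lemma prm_cancel:
  assumes p: "prm p" and a: "a \<in> R" "a \<notin> p" and b: "b \<in> R" "a * b \<in> p"
  shows "b \<in> p"
proof -
  have P: "nideal p" using prm_nideal[OF p] .
  obtain c where c: "c \<in> R" "a * c - 1 \<in> p" using prm_inv[OF p a] .
  have "c * (a * b) - b * (a * c - 1) \<in> p"
    using nideal_mult[OF P] nideal_diff[OF P] b c by blast
  then show ?thesis by (simp add: algebra_simps)
qed

lemma prm_mult_iff: "prm p \<Longrightarrow> a \<in> R \<Longrightarrow> b \<in> R \<Longrightarrow> a * b \<in> p \<longleftrightarrow> a \<in> p \<or> b \<in> p"
  using prm_cancel[of p a b] nideal_mult[OF prm_nideal, of p a b] nideal_mult'[OF prm_nideal, of p b a] by blast

lemma prm_prod: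
  assumes p: "prm p" and f: "\<And>i. i \<in> A \<Longrightarrow> f i \<in> R" "\<And>i. i \<in> A \<Longrightarrow> f i \<notin> p"
  shows "prod f A \<notin> p"
  using f
proof (induction A rule: infinite_finite_induct)
  case (insert x F)
  then have "prod f F \<in> R" "f x \<in> R" by auto
  then show ?case using insert prm_mult_iff[OF p, of "f x" "prod f F"] by auto
qed (auto simp: prm_1[OF p])

text \<open>A proper ideal above \<open>I\<close> of least index is maximal, so no maximality
  principle for chains of ideals enters.\<close>

lemma ex_prm:
  assumes I: "nideal I" "1 \<notin> I"
  obtains p where "prm p" "I \<subseteq> p"
proof -
  let ?P = "\<lambda>J. nideal J \<and> I \<subseteq> J \<and> 1 \<notin> J"
  obtain p where p: "?P p" "\<And>J. ?P J \<Longrightarrow> idx p \<le> idx J"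
    using ex_has_least_nat[of ?P I idx] I by blast
  have "J = p" if "nideal J" "p \<subseteq> J" "1 \<notin> J" for J
  proof (rule ccontr)
    assume "J \<noteq> p"
    then have "idx J < idx p" using idx_psubset[of p J] that p(1) by blast
    moreover have "idx p \<le> idx J" using p that by blast
    ultimately show False by simp
  qed
  then have "prm p" using p(1) unfolding prm_def by blast
  then show ?thesis using that p(1) by blast
qed

lemma prm_eq: "prm p \<Longrightarrow> prm q \<Longrightarrow> p \<subseteq> q \<Longrightarrow> p = q"
  unfolding prm_def by blast

text \<open>Two powers of \<open>x\<close> agree modulo \<open>I\<close> by finiteness. Its use: for
  \<open>d > 0\<close> the element \<open>1 - x ^ d\<close> lies outside every prime that contains
  \<open>x\<close>.\<close>

lemma power_cong:
  assumes I: "nideal I" and x: "x \<in> R"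
  obtains i d :: nat where "d > 0" "x ^ i * (1 - x ^ d) \<in> I"
proof -
  have "\<not> inj (\<lambda>i. cls I (x ^ i))"
  proof
    assume "inj (\<lambda>i. cls I (x ^ i))"
    moreover have "range (\<lambda>i. cls I (x ^ i)) \<subseteq> cls I ` R" using x by auto
    ultimately show False using finite_cls[OF I] finite_subset range_inj_infinite by blast
  qed
  then obtain i j where ij: "cls I (x ^ i) = cls I (x ^ j)" "i < j"
    unfolding inj_def by (metis linorder_neqE_nat)
  then have "x ^ i - x ^ j \<in> I" using cls_eq_iff[OF I] x by blast
  moreover have "x ^ i - x ^ j = x ^ i * (1 - x ^ (j - i))"
    using ij by (simp add: algebra_simps power_add[symmetric])
  ultimately show ?thesis using that[of "j - i" i] ij by simp
qed

text \<open>Among the \<open>b\<close> whose annihilator modulo \<open>a\<close> lies in \<open>p\<close>, one with annihilator of least index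
  has annihilator exactly \<open>p\<close>; then \<open>\<xi> = b / a\<close> lies in the inverse of \<open>p\<close> but not in \<open>R\<close>.\<close>

lemma prm_inverse:
  assumes p: "prm p"
  obtains \<xi> u v where "u \<in> p" "v \<in> p" "\<xi> * u + v = 1" "\<And>x. x \<in> p \<Longrightarrow> \<xi> * x \<in> R" "\<xi> \<notin> R"
proof -
  have P: "nideal p" using prm_nideal[OF p] .
  obtain a where a: "a \<in> p" "a \<noteq> 0" using nideal_nonzero[OF P] by blast
  have aR: "a \<in> R" using nideal_sub[OF P a(1)] .
  define A where "A = {a * r | r. r \<in> R}"
  have A: "nideal A" unfolding A_def by (rule nideal_principal[OF aR a(2)])
  have aA: "a \<in> A" by (auto simp: A_def intro!: exI[of _ 1])
  define Ann where "Ann b = {r \<in> R. r * b \<in> A}" for b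
  have Ann: "nideal (Ann b)" if b: "b \<in> R" for b
  proof (rule nidealI[of _ a])
    show "a \<in> Ann b" using nideal_mult'[OF A b aA] aR by (simp add: Ann_def)
    show "x + y \<in> Ann b" if "x \<in> Ann b" "y \<in> Ann b" for x y
      using that nideal_add[OF A] by (auto simp: Ann_def distrib_right)
    show "r * x \<in> Ann b" if "r \<in> R" "x \<in> Ann b" for r x
      using that nideal_mult[OF A] by (auto simp: Ann_def mult.assoc)
  qed (auto simp: Ann_def a)
  let ?Q = "\<lambda>b. b \<in> R \<and> Ann b \<subseteq> p"
  have "Ann 1 \<subseteq> p" using nideal_mult'[OF P] a(1) by (auto simp: Ann_def A_def)
  then have "?Q 1" by simp
  then obtain b where b: "?Q b" "\<And>c. ?Q c \<Longrightarrow> idx (Ann c) \<ge> idx (Ann b)"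
    using ex_has_least_nat[of ?Q 1 "\<lambda>b. idx (Ann b)"] by blast
  have bR: "b \<in> R" and bp: "Ann b \<subseteq> p" using b by auto
  have same: "Ann (c * b) = Ann b" if c: "c \<in> R" "Ann (c * b) \<subseteq> p" for c
  proof (rule ccontr)
    assume ne: "Ann (c * b) \<noteq> Ann b"
    have "Ann b \<subseteq> Ann (c * b)"
    proof
      fix x assume "x \<in> Ann b"
      then show "x \<in> Ann (c * b)"
        using nideal_mult[OF A c(1), of "x * b"] by (simp add: Ann_def mult.left_commute)
    qed
    then have "idx (Ann (c * b)) < idx (Ann b)"
      using idx_psubset[OF Ann Ann, of b "c * b"] ne bR c(1) by blast
    moreover have "idx (Ann b) \<le> idx (Ann (c * b))" using b(2) c bR by blast
    ultimately show False by simp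
  qed
  \<comment> \<open>An element outside \<open>p\<close> can be cancelled without changing the
    annihilator.\<close>
  have unit: "Ann (t * b) = Ann b" if t: "t \<in> R" "t \<notin> p" for t
  proof (rule same[OF t(1)])
    show "Ann (t * b) \<subseteq> p"
    proof
      fix u assume u: "u \<in> Ann (t * b)"
      then have "u * t \<in> Ann b" "u \<in> R" using t by (auto simp: Ann_def mult.assoc)
      then show "u \<in> p" using prm_mult_iff[OF p _ t(1)] bp t(2) by blast
    qed
  qed
  \<comment> \<open>Some power of \<open>x\<close> annihilates \<open>b\<close>, because the factor
    \<open>1 - x ^ d\<close> can be cancelled. If \<open>x ^ j\<close> is the least one, then
    \<open>x ^ (j - 1) * b\<close> still has its annihilator inside \<open>p\<close>, so by
    minimality of the index it has the same annihilator as \<open>b\<close>, and that contains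
    \<open>x\<close>.\<close>
  have "x \<in> Ann b" if x: "x \<in> p" for x
  proof -
    have xR: "x \<in> R" using nideal_sub[OF P x] .
    obtain i d where id: "d > 0" "x ^ i * (1 - x ^ d) \<in> Ann b" using power_cong[OF Ann[OF bR] xR] .
    have "x ^ d \<in> p" using id(1) x xR nideal_mult'[OF P, of "x ^ (d - 1)" x]
      by (metis R_power power_minus_mult mult.commute)
    then have "1 - x ^ d \<notin> p" using nideal_add[OF P, of "1 - x ^ d" "x ^ d"] prm_1[OF p] by auto
    moreover have "1 - x ^ d \<in> R" using xR by auto
    ultimately have "Ann ((1 - x ^ d) * b) = Ann b" using unit by blast
    moreover have "x ^ i \<in> Ann ((1 - x ^ d) * b)" using id(2) xR by (auto simp: Ann_def mult.assoc)
    ultimately have ex: "x ^ i \<in> Ann b" by simp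
    define j where "j = (LEAST j. x ^ j \<in> Ann b)"
    have j: "x ^ j \<in> Ann b" "\<And>l. l < j \<Longrightarrow> x ^ l \<notin> Ann b"
      unfolding j_def using ex LeastI not_less_Least by (metis, blast)
    have j0: "j > 0" using j(1) bp prm_1[OF p] by (cases j) auto
    let ?c = "x ^ (j - 1)"
    have cR: "?c \<in> R" using xR by blast
    have "Ann (?c * b) \<subseteq> p"
    proof
      fix u assume u: "u \<in> Ann (?c * b)"
      show "u \<in> p"
      proof (rule ccontr)
        assume "u \<notin> p"
        moreover have uR: "u \<in> R" using u by (simp add: Ann_def)
        ultimately have "Ann (u * b) = Ann b" by (rule unit[rotated])
        moreover have "?c \<in> Ann (u * b)" using u cR by (auto simp: Ann_def mult.left_commute)
        ultimately show False using j(2)[of "j - 1"] j0 by simp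
      qed
    qed
    then have "Ann (?c * b) = Ann b" using same[OF cR] by simp
    moreover have "x \<in> Ann (?c * b)"
    proof -
      have "x * (?c * b) = x ^ j * b"
        unfolding power_minus_mult[OF j0, of x, symmetric] by (simp only: mult_ac)
      moreover have "x ^ j * b \<in> A" using j(1) by (simp add: Ann_def)
      ultimately show ?thesis unfolding Ann_def using xR by (simp only: mem_Collect_eq)
    qed
    ultimately show "x \<in> Ann b" by simp
  qed
  then have xb: "x * b \<in> A" if "x \<in> p" for x using that by (auto simp: Ann_def)
  define \<xi> where "\<xi> = b / a"
  have \<xi>p: "\<xi> * x \<in> R" if x: "x \<in> p" for x
  proof -
    obtain r where "x * b = a * r" "r \<in> R" using xb[OF x] by (auto simp: A_def)
    then show ?thesis using a(2) by (simp add: \<xi>_def field_simps)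
  qed
  have \<xi>R: "\<xi> \<notin> R"
  proof
    assume "\<xi> \<in> R"
    then have "a * \<xi> \<in> A" by (auto simp: A_def)
    then have "1 \<in> Ann b" using a(2) by (simp add: Ann_def \<xi>_def)
    then show False using bp prm_1[OF p] by blast
  qed
  \<comment> \<open>Otherwise \<open>\<xi>\<close> would map \<open>p\<close> into itself and be
    integral by \<open>stable_in_R\<close>. Scaling \<open>y\<close> by an inverse of
    \<open>\<xi> * y\<close> modulo \<open>p\<close> then gives \<open>u\<close> and
    \<open>v\<close>.\<close>
  then obtain y where y: "y \<in> p" "\<xi> * y \<notin> p" using stable_in_R[OF P] by blast
  obtain c where c: "c \<in> R" "(\<xi> * y) * c - 1 \<in> p" using prm_inv[OF p \<xi>p[OF y(1)] y(2)] .
  show ?thesis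
  proof (rule that[of "y * c" "1 - \<xi> * (y * c)" \<xi>])
    show "y * c \<in> p" using nideal_mult'[OF P c(1) y(1)] .
    show "1 - \<xi> * (y * c) \<in> p" using nideal_diff_sym[OF P c(2)] by (simp add: mult.assoc)
  qed (use \<xi>p \<xi>R in auto)
qed

text \<open>Modulo \<open>R\<close> the inverse of \<open>p\<close> is a simple module, so 1 and
  \<open>xi p\<close> generate it; this one element represents the whole inverse below.\<close>

definition xi :: "'a set \<Rightarrow> 'a" where
  "xi p = (SOME \<xi>. (\<exists>u v. u \<in> p \<and> v \<in> p \<and> \<xi> * u + v = 1) \<and> (\<forall>x\<in>p. \<xi> * x \<in> R) \<and> \<xi> \<notin> R)"

lemma xi:
  assumes "prm p"
  shows "\<exists>u v. u \<in> p \<and> v \<in> p \<and> xi p * u + v = 1" "x \<in> p \<Longrightarrow> xi p * x \<in> R" "xi p \<notin> R"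
proof -
  have "\<exists>\<xi>. (\<exists>u v. u \<in> p \<and> v \<in> p \<and> \<xi> * u + v = 1) \<and> (\<forall>x\<in>p. \<xi> * x \<in> R) \<and> \<xi> \<notin> R"
    using prm_inverse[OF assms] by metis
  from someI_ex[OF this]
  show "\<exists>u v. u \<in> p \<and> v \<in> p \<and> xi p * u + v = 1" "x \<in> p \<Longrightarrow> xi p * x \<in> R" "xi p \<notin> R"
    unfolding xi_def by blast+
qed

text \<open>The product of \<open>p\<close> and \<open>I\<close>: if \<open>\<xi> u + v = 1\<close> with \<open>u, v \<in> p\<close>, then
  \<open>x = u (\<xi> x) + v x\<close> lies in \<open>p I\<close> as soon as \<open>x\<close> and \<open>\<xi> x\<close> lie in \<open>I\<close>.\<close>

definition pmul :: "'a set \<Rightarrow> 'a set \<Rightarrow> 'a set" where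
  "pmul p I = {x \<in> I. xi p * x \<in> I}"

lemma pmul_prod: "prm p \<Longrightarrow> nideal I \<Longrightarrow> y \<in> p \<Longrightarrow> x \<in> I \<Longrightarrow> y * x \<in> pmul p I"
  using nideal_mult[of I y x] nideal_mult[of I "xi p * y" x] xi(2)[of p y] nideal_sub[OF prm_nideal, of p y]
  by (auto simp: pmul_def mult.assoc)

lemma pmul_nideal:
  assumes p: "prm p" and I: "nideal I"
  shows "nideal (pmul p I)"
proof -
  obtain a where a: "a \<in> p" "a \<noteq> 0" using nideal_nonzero[OF prm_nideal[OF p]] by blast
  obtain i where i: "i \<in> I" "i \<noteq> 0" using nideal_nonzero[OF I] by blast
  show ?thesis
  proof (rule nidealI[of _ "a * i"])
    show "a * i \<in> pmul p I" by (rule pmul_prod[OF p I a(1) i(1)])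
    show "x + y \<in> pmul p I" if "x \<in> pmul p I" "y \<in> pmul p I" for x y
      using that nideal_add[OF I] by (auto simp: pmul_def distrib_left)
    show "r * x \<in> pmul p I" if "r \<in> R" "x \<in> pmul p I" for r x
      using that nideal_mult[OF I] by (auto simp: pmul_def mult.left_commute)
  qed (use a i nideal_sub[OF I] in \<open>auto simp: pmul_def\<close>)
qed

lemma pmul_subset: "pmul p I \<subseteq> I" by (auto simp: pmul_def)

lemma pmul_subset_p:
  assumes p: "prm p" and I: "nideal I"
  shows "pmul p I \<subseteq> p"
proof
  fix x assume x: "x \<in> pmul p I"
  obtain u v where uv: "u \<in> p" "v \<in> p" "xi p * u + v = 1" using xi(1)[OF p] by blast
  have "(xi p * x) * u + x * v \<in> p"
    using x uv nideal_sub[OF I] prm_nideal[OF p]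
    by (intro nideal_add[OF prm_nideal[OF p]] nideal_mult[OF prm_nideal[OF p]]) (auto simp: pmul_def)
  also have "(xi p * x) * u + x * v = x * (xi p * u + v)" by (simp add: algebra_simps)
  finally show "x \<in> p" using uv by simp
qed

text \<open>Cancellation of \<open>p\<close>: in \<open>x = xi p * (u * x) + v * x\<close> the
  elements \<open>u * x\<close> and \<open>v * x\<close> lie in the product with \<open>p\<close>,
  and \<open>xi p\<close> maps such elements back into \<open>J\<close>.\<close>

lemma pmul_inj:
  assumes p: "prm p" and I: "nideal I" and J: "nideal J" and sub: "pmul p I \<subseteq> pmul p J"
  shows "I \<subseteq> J"
proof
  fix x assume x: "x \<in> I"
  obtain u v where uv: "u \<in> p" "v \<in> p" "xi p * u + v = 1" using xi(1)[OF p] by blast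
  have "u * x \<in> pmul p J" "v * x \<in> pmul p J" using pmul_prod[OF p I _ x] uv sub by auto
  then have "xi p * (u * x) + v * x \<in> J" using nideal_add[OF J] by (auto simp: pmul_def)
  also have "xi p * (u * x) + v * x = (xi p * u + v) * x" by (simp add: algebra_simps)
  finally show "x \<in> J" using uv by simp
qed

lemma pmul_neq: "prm p \<Longrightarrow> nideal I \<Longrightarrow> pmul p I \<noteq> I"
  using stable_in_R[of I "xi p"] xi(3)[of p] by (auto simp: pmul_def)

text \<open>To contain is to divide: the cofactor is the colon ideal of \<open>J\<close> by
  \<open>p\<close>.\<close>

lemma pmul_surj:
  assumes p: "prm p" and J: "nideal J" and sub: "J \<subseteq> p"
  obtains I where "nideal I" "pmul p I = J"
proof -
  have P: "nideal p" using prm_nideal[OF p] .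
  define I where "I = {x \<in> R. \<forall>y\<in>p. y * x \<in> J}"
  obtain j where j: "j \<in> J" "j \<noteq> 0" using nideal_nonzero[OF J] by blast
  have JI: "J \<subseteq> I" using nideal_mult[OF J] nideal_sub[OF P] nideal_sub[OF J] by (auto simp: I_def)
  have I: "nideal I"
  proof (rule nidealI[of _ j])
    show "x + y \<in> I" if "x \<in> I" "y \<in> I" for x y
      using that nideal_add[OF J] by (auto simp: I_def distrib_left)
    show "r * x \<in> I" if "r \<in> R" "x \<in> I" for r x
    proof -
      have "y * (r * x) \<in> J" if "y \<in> p" for y
        using nideal_mult[OF J \<open>r \<in> R\<close>, of "y * x"] \<open>x \<in> I\<close> that
        by (simp add: I_def mult.left_commute)
      then show ?thesis using that by (auto simp: I_def)
    qed
  qed (use j JI in \<open>auto simp: I_def\<close>)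
  obtain u v where uv: "u \<in> p" "v \<in> p" "xi p * u + v = 1" using xi(1)[OF p] by blast
  have "x \<in> J" if "x \<in> pmul p I" for x
  proof -
    have "u * (xi p * x) + v * x \<in> J"
      using that uv by (intro nideal_add[OF J]) (auto simp: pmul_def I_def)
    also have "u * (xi p * x) + v * x = (xi p * u + v) * x" by (simp add: algebra_simps)
    finally show ?thesis using uv by simp
  qed
  moreover have "x \<in> pmul p I" if x: "x \<in> J" for x
  proof -
    have "y * (xi p * x) \<in> J" if "y \<in> p" for y
      using nideal_mult[OF J xi(2)[OF p that] x] by (simp add: mult_ac)
    moreover have "xi p * x \<in> R" using xi(2)[OF p] sub x by blast
    ultimately show ?thesis using JI x by (auto simp: pmul_def I_def)
  qed
  ultimately show ?thesis using that[OF I] by blast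
qed

lemma pmul_subset_prm:
  assumes p: "prm p" and q: "prm q" and I: "nideal I" and ne: "p \<noteq> q"
  shows "pmul p I \<subseteq> q \<longleftrightarrow> I \<subseteq> q"
proof
  assume s: "pmul p I \<subseteq> q"
  obtain a where a: "a \<in> p" "a \<notin> q" using prm_eq[OF p q] ne by blast
  have aR: "a \<in> R" using nideal_sub[OF prm_nideal[OF p]] a by blast
  show "I \<subseteq> q"
  proof
    fix x assume x: "x \<in> I"
    have "a * x \<in> q" using pmul_prod[OF p I a(1) x] s by blast
    then show "x \<in> q" using prm_cancel[OF q aR a(2) nideal_sub[OF I x]] by blast
  qed
qed (use pmul_subset in blast)

text \<open>Multiplying by \<open>xi p\<close> as often as possible removes the common factor \<open>p\<close> of two elements.\<close>

lemma reduce_pair: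
  assumes p: "prm p" and xy: "x \<in> R" "y \<in> R" "x \<noteq> 0"
  obtains r s where "r \<in> R" "s \<in> R" "r * x + s * y = 0" "r \<notin> p \<or> s \<notin> p"
proof -
  have P: "nideal p" using prm_nideal[OF p] .
  let ?G = "\<lambda>k. xi p ^ k * x \<in> R \<and> xi p ^ k * y \<in> R"
  have "\<exists>k. \<not> ?G k"
  proof (rule ccontr)
    assume "\<not> (\<exists>k. \<not> ?G k)"
    then have all: "xi p ^ k * x \<in> R" for k by blast
    \<comment> \<open>The elements that all powers of \<open>xi p\<close> keep in \<open>R\<close>
      would form a nonzero ideal stable under \<open>xi p\<close>, which would force
      \<open>xi p\<close> into \<open>R\<close>.\<close>
    let ?L = "{z. \<forall>k. xi p ^ k * z \<in> R}"
    have "nideal ?L"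
    proof (rule nidealI[of _ x])
      show "?L \<subseteq> R" by (auto dest: spec[of _ 0])
      show "u + v \<in> ?L" if "u \<in> ?L" "v \<in> ?L" for u v
        using that by (auto simp: distrib_left)
      show "r * u \<in> ?L" if "r \<in> R" "u \<in> ?L" for r u
        using that by (auto simp: mult.left_commute)
    qed (use all xy in auto)
    moreover have "xi p * z \<in> ?L" if "z \<in> ?L" for z
    proof clarify
      fix k
      have "xi p ^ Suc k * z \<in> R" using that by blast
      then show "xi p ^ k * (xi p * z) \<in> R" by (simp add: mult_ac)
    qed
    ultimately show False using stable_in_R xi(3)[OF p] by blast
  qed
  then obtain k0 where k0: "\<not> ?G k0" by blast
  have "\<exists>k. ?G k \<and> \<not> ?G (Suc k)"
  proof (rule ccontr)
    assume *: "\<nexists>k. ?G k \<and> \<not> ?G (Suc k)"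
    have "?G k" for k
    proof (induction k)
      case 0
      then show ?case using xy by simp
    next
      case (Suc k)
      then show ?case using * by blast
    qed
    then show False using k0 by blast
  qed
  then obtain k where k: "?G k" "\<not> ?G (Suc k)" by blast
  \<comment> \<open>At the last exponent that keeps both products integral, \<open>p\<close> cannot
    contain both of them. Up to a sign they are the coefficients of the relation.\<close>
  have "xi p ^ k * y \<notin> p \<or> - (xi p ^ k * x) \<notin> p"
  proof (rule ccontr)
    assume "\<not> ?thesis"
    then have "xi p ^ k * y \<in> p" "xi p ^ k * x \<in> p" using nideal_uminus[OF P, of "- (xi p ^ k * x)"] by auto
    then have "?G (Suc k)" using xi(2)[OF p] by (simp add: mult.assoc)
    then show False using k by simp
  qed
  moreover have "(xi p ^ k * y) * x + - (xi p ^ k * x) * y = 0" by simp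
  ultimately show ?thesis using that[of "xi p ^ k * y" "- (xi p ^ k * x)"] k R_uminus by blast
qed

text \<open>Any \<open>x\<close> in \<open>I\<close> outside the product generates \<open>I\<close>
  modulo the product and has annihilator \<open>p\<close>, so the quotient is a line over the
  residue field. Representatives modulo the product are therefore the elements
  \<open>s + t * x\<close>.\<close>

lemma idx_pmul:
  assumes p: "prm p" and I: "nideal I"
  shows "idx (pmul p I) = idx p * idx I"
proof -
  have P: "nideal p" using prm_nideal[OF p] .
  have J: "nideal (pmul p I)" by (rule pmul_nideal[OF p I])
  obtain x where x: "x \<in> I" "x \<notin> pmul p I" using pmul_neq[OF p I] pmul_subset by blast
  have xR: "x \<in> R" using nideal_sub[OF I x(1)] .
  have x0: "x \<noteq> 0" using x nideal_0[OF J] by blast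
  have div: "t \<in> p" if t: "t \<in> R" "t * x \<in> pmul p I" for t
  proof (rule ccontr)
    assume "t \<notin> p"
    then obtain s where s: "s \<in> R" "t * s - 1 \<in> p" using prm_inv[OF p t(1)] by blast
    have "s * (t * x) - (t * s - 1) * x \<in> pmul p I"
      using nideal_mult[OF J s(1) t(2)] pmul_prod[OF p I s(2) x(1)] by (rule nideal_diff[OF J])
    then show False using x(2) by (simp add: algebra_simps)
  qed
  \<comment> \<open>In the relation of \<open>reduce_pair\<close> the coefficient of
    \<open>y\<close> is invertible modulo \<open>p\<close>: with \<open>s\<close> in
    \<open>p\<close>, also \<open>r * x\<close> would lie in the product, which forces
    \<open>r\<close> into \<open>p\<close> as well.\<close>
  have gen: "\<exists>t\<in>R. y - t * x \<in> pmul p I" if y: "y \<in> I" for y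
  proof -
    have yR: "y \<in> R" using nideal_sub[OF I y] .
    obtain r s where rs: "r \<in> R" "s \<in> R" "r * x + s * y = 0" "r \<notin> p \<or> s \<notin> p"
      using reduce_pair[OF p xR yR x0] .
    have "s \<notin> p"
    proof
      assume s: "s \<in> p"
      then have "s * y \<in> pmul p I" using pmul_prod[OF p I _ y] by blast
      moreover have "r * x = - (s * y)" using rs(3) by (simp add: eq_neg_iff_add_eq_0)
      ultimately have "r * x \<in> pmul p I" using nideal_uminus[OF J] by simp
      then show False using div rs s by blast
    qed
    then obtain c where c: "c \<in> R" "s * c - 1 \<in> p" using prm_inv[OF p rs(2)] by blast
    have "- ((s * c - 1) * y) \<in> pmul p I" using pmul_prod[OF p I c(2) y] by (rule nideal_uminus[OF J])
    moreover have "y - (- (c * r)) * x = y + c * (r * x)" by (simp add: algebra_simps)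
    moreover have "r * x = - (s * y)" using rs(3) by (simp add: eq_neg_iff_add_eq_0)
    ultimately have "y - (- (c * r)) * x \<in> pmul p I" by (simp add: algebra_simps)
    then show ?thesis using c rs by blast
  qed
  define T where "T = (\<lambda>(s,t). s + t * x) ` (reps I \<times> reps p)"
  have rI: "reps I \<subseteq> R" and rp: "reps p \<subseteq> R" using reps_R I P by auto
  have uniq: "s = s' \<and> t = t'" if h: "s \<in> reps I" "s' \<in> reps I" "t \<in> reps p" "t' \<in> reps p"
    "(s + t * x) - (s' + t' * x) \<in> pmul p I" for s s' t t'
  proof -
    have "(t - t') * x \<in> I" using h rp nideal_mult[OF I _ x(1)] by blast
    moreover have "(s + t * x) - (s' + t' * x) \<in> I" using h pmul_subset by blast
    ultimately have "(s + t * x) - (s' + t' * x) - (t - t') * x \<in> I" by (rule nideal_diff[OF I, rotated])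
    then have "s - s' \<in> I" by (simp add: algebra_simps)
    then have s: "s = s'" using reps_unique[OF I] h by blast
    then have "(t - t') * x \<in> pmul p I" using h by (simp add: algebra_simps)
    then have "t - t' \<in> p" using div[of "t - t'"] h rp by blast
    then show ?thesis using s reps_unique[OF P] h by blast
  qed
  have "is_reps (pmul p I) T"
    unfolding is_reps_def
  proof (intro conjI ballI impI)
    show "T \<subseteq> R" using rI rp xR by (auto simp: T_def)
    show "\<exists>t\<in>T. z - t \<in> pmul p I" if z: "z \<in> R" for z
    proof -
      obtain s where s: "s \<in> reps I" "z - s \<in> I" using reps_ex[OF I z] by blast
      obtain t where t: "t \<in> R" "z - s - t * x \<in> pmul p I" using gen[OF s(2)] by blast
      obtain t' where t': "t' \<in> reps p" "t - t' \<in> p" using reps_ex[OF P t(1)] by blast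
      have "(z - s - t * x) + (t - t') * x \<in> pmul p I"
        using t(2) pmul_prod[OF p I t'(2) x(1)] by (rule nideal_add[OF J])
      then have "z - (s + t' * x) \<in> pmul p I" by (simp add: algebra_simps)
      then show ?thesis using s t' unfolding T_def by force
    qed
    show "a = b" if ab: "a \<in> T" "b \<in> T" "a - b \<in> pmul p I" for a b
    proof -
      obtain s t where st: "s \<in> reps I" "t \<in> reps p" "a = s + t * x"
        using ab(1) unfolding T_def by auto
      obtain s' t' where st': "s' \<in> reps I" "t' \<in> reps p" "b = s' + t' * x"
        using ab(2) unfolding T_def by auto
      show ?thesis using uniq[OF st(1) st'(1) st(2) st'(2)] ab(3) unfolding st(3) st'(3) by simp
    qed
  qed
  then have "idx (pmul p I) = card T" using is_reps_card[OF J] by simp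
  also have "inj_on (\<lambda>(s,t). s + t * x) (reps I \<times> reps p)"
    using uniq nideal_0[OF J] by (auto simp: inj_on_def)
  then have "card T = card (reps I \<times> reps p)" unfolding T_def by (rule card_image)
  finally show ?thesis using card_reps[OF I] card_reps[OF P] by (simp add: card_cartesian_product mult.commute)
qed

text \<open>Induction on the primes: a solution for \<open>S\<close> is corrected at the new prime
  by a multiple of an element that lies in every old prime but not in the new one.\<close>

lemma crt:
  assumes "finite S" "\<And>p. p \<in> S \<Longrightarrow> prm p" "\<And>p. p \<in> S \<Longrightarrow> t p \<in> R"
  shows "\<exists>x\<in>R. \<forall>p\<in>S. x - t p \<in> p"
  using assms
proof (induction S)
  case empty
  then show ?case by auto
next
  case (insert p S)
  then obtain x where x: "x \<in> R" "\<forall>q\<in>S. x - t q \<in> q" by auto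
  have p: "prm p" and tp: "t p \<in> R" using insert by auto
  have "\<exists>a. a \<in> q \<and> a \<notin> p" if "q \<in> S" for q
    using prm_eq[of q p] insert that by blast
  then obtain a where a: "\<And>q. q \<in> S \<Longrightarrow> a q \<in> q \<and> a q \<notin> p" by metis
  have aR: "a q \<in> R" if "q \<in> S" for q
    using a[OF that] nideal_sub[OF prm_nideal, of q "a q"] insert.prems(1)[of q] that by simp
  let ?e = "prod a S"
  have eR: "?e \<in> R" using aR by (rule R_prod)
  have ep: "?e \<notin> p" by (rule prm_prod[OF p aR]) (use a in auto)
  have eq: "?e \<in> q" if "q \<in> S" for q
  proof -
    have "?e = a q * prod a (S - {q})" using insert that by (simp add: prod.remove)
    moreover have "prod a (S - {q}) \<in> R" by (rule R_prod) (use aR in auto)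
    ultimately show ?thesis
      using nideal_mult'[OF prm_nideal[OF insert.prems(1)[of q]], of "prod a (S - {q})" "a q"] that a
      by simp
  qed
  obtain c where c: "c \<in> R" "?e * c - 1 \<in> p" using prm_inv[OF p eR ep] .
  let ?y = "x + ?e * (c * (t p - x))"
  have "?y - t p = (?e * c - 1) * (t p - x)" by (simp add: algebra_simps)
  then have 1: "?y - t p \<in> p" using nideal_mult'[OF prm_nideal[OF p] _ c(2), of "t p - x"] R_diff[OF tp x(1)] by simp
  have "?y - t q \<in> q" if q: "q \<in> S" for q
  proof -
    have Q: "nideal q" using prm_nideal insert.prems(1) q by simp
    have "(x - t q) + ?e * (c * (t p - x)) \<in> q"
      using x q c tp by (intro nideal_add[OF Q] nideal_mult'[OF Q _ eq[OF q]] R_mult R_diff) auto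
    then show ?thesis by (simp add: algebra_simps)
  qed
  moreover have "?y \<in> R" using x eR c tp by (intro R_add R_mult R_diff) auto
  ultimately show ?case using 1 by (intro bexI[of _ ?y]) auto
qed

end

subsection \<open>Residue classes in boxes\<close>

lemma has_sum_times_nonneg:
  fixes f :: "'b \<Rightarrow> real" and g :: "'c \<Rightarrow> real"
  assumes f: "(f has_sum a) A" and g: "(g has_sum b) B"
    and nn: "\<And>x. x \<in> A \<Longrightarrow> f x \<ge> 0" "\<And>y. y \<in> B \<Longrightarrow> g y \<ge> 0"
  shows "((\<lambda>(x,y). f x * g y) has_sum (a * b)) (A \<times> B)"
proof (rule has_sum_SigmaI)
  show inner: "((\<lambda>y. case (x, y) of (x, y) \<Rightarrow> f x * g y) has_sum f x * b) B" for x
    using has_sum_cmult_right[OF g, of "f x"] by simp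
  show outer: "((\<lambda>x. f x * b) has_sum a * b) A" using has_sum_cmult_left[OF f] .
  show "(\<lambda>(x, y). f x * g y) summable_on A \<times> B"
    by (rule summable_on_SigmaI[OF inner has_sum_imp_summable[OF outer]]) (use nn in auto)
qed

lemma nat_int_double [simp]: "nat (int b + int b) = 2 * b" "nat (2 * int b) = 2 * b"
  by linarith+

context integer_ring
begin

definition rclass :: "'a set set \<Rightarrow> ('a set \<Rightarrow> 'a) \<Rightarrow> 'a set" where
  "rclass S t = {x \<in> R. \<forall>p\<in>S. x - t p \<in> p}"

lemma red_periodic:
  assumes S: "\<And>p. p \<in> S \<Longrightarrow> prm p" "\<And>p. p \<in> S \<Longrightarrow> of_nat Q \<in> p" and x: "x \<in> R"
  shows "red Q x \<in> rclass S t \<longleftrightarrow> x \<in> rclass S t"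
proof -
  have "red Q x - t p \<in> p \<longleftrightarrow> x - t p \<in> p" if "p \<in> S" for p
  proof -
    have P: "nideal p" using prm_nideal S(1) that by blast
    have "(x - t p) - (red Q x - t p) \<in> p" using red_cong[OF P S(2)[OF that] x] by simp
    then show ?thesis using nideal_diff_mem[OF P] by blast
  qed
  then show ?thesis using x red_R by (auto simp: rclass_def)
qed

text \<open>Translation by an element congruent to \<open>t' - t\<close>, followed by reduction
  modulo \<open>Q\<close>, embeds one class into the other. By symmetry all classes are equally
  large.\<close>

lemma card_rclass_le:
  assumes S: "finite S" "\<And>p. p \<in> S \<Longrightarrow> prm p" "\<And>p. p \<in> S \<Longrightarrow> of_nat Q \<in> p" and Q: "Q > 0"
    and t: "\<And>p. p \<in> S \<Longrightarrow> t p \<in> R" "\<And>p. p \<in> S \<Longrightarrow> t' p \<in> R"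
  shows "card (rclass S t \<inter> rbox 0 (int Q)) \<le> card (rclass S t' \<inter> rbox 0 (int Q))"
proof -
  obtain y where y: "y \<in> R" "\<forall>p\<in>S. y - (t' p - t p) \<in> p"
    using crt[OF S(1,2), of "\<lambda>p. t' p - t p"] t by blast
  show ?thesis
  proof (rule card_inj_on_le[where f = "\<lambda>x. red Q (x + y)"])
    show "inj_on (\<lambda>x. red Q (x + y)) (rclass S t \<inter> rbox 0 (int Q))"
    proof (rule inj_onI)
      fix x x' assume xx: "x \<in> rclass S t \<inter> rbox 0 (int Q)" "x' \<in> rclass S t \<inter> rbox 0 (int Q)"
        "red Q (x + y) = red Q (x' + y)"
      have xR: "x \<in> R" "x' \<in> R" using xx by (auto simp: rclass_def)
      show "x = x'"
      proof (rule co_eqI[OF xR])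
        fix e assume e: "e \<in> E"
        have "co (x + y) e mod int Q = co (x' + y) e mod int Q"
          using arg_cong[OF xx(3), of "\<lambda>z. co z e"] e by (simp add: red_def co_comb)
        then have "(co x e + co y e) mod int Q = (co x' e + co y e) mod int Q"
          using xR y(1) e by (simp add: co_add)
        then have "co x e mod int Q = co x' e mod int Q"
          by (metis add_diff_cancel_right' mod_diff_left_eq)
        then show "co x e = co x' e" using xx e by (auto simp: rbox_def)
      qed
    qed
    show "(\<lambda>x. red Q (x + y)) ` (rclass S t \<inter> rbox 0 (int Q)) \<subseteq> rclass S t' \<inter> rbox 0 (int Q)"
    proof (rule image_subsetI)
      fix x assume x: "x \<in> rclass S t \<inter> rbox 0 (int Q)"
      then have xR: "x \<in> R" by (simp add: rclass_def)
      have "x + y - t' p \<in> p" if "p \<in> S" for p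
      proof -
        have "(x - t p) + (y - (t' p - t p)) \<in> p"
          using x y that by (intro nideal_add[OF prm_nideal[OF S(2)[OF that]]]) (auto simp: rclass_def)
        then show ?thesis by (simp add: algebra_simps)
      qed
      then have "x + y \<in> rclass S t'" using xR y(1) R_add by (auto simp: rclass_def)
      then have "red Q (x + y) \<in> rclass S t'"
        using red_periodic[where S = S and Q = Q and x = "x + y" and t = t', OF S(2,3)] xR y(1) by auto
      then show "red Q (x + y) \<in> rclass S t' \<inter> rbox 0 (int Q)" using red_rbox[OF Q] by simp
    qed
    show "finite (rclass S t' \<inter> rbox 0 (int Q))" using finite_rbox by simp
  qed
qed

text \<open>The classes for all systems of representatives partition the residues modulo
  \<open>Q\<close> and have equal size. The product form avoids a division of natural
  numbers.\<close>

lemma card_rclass: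
  assumes S: "finite S" "\<And>p. p \<in> S \<Longrightarrow> prm p" "\<And>p. p \<in> S \<Longrightarrow> of_nat Q \<in> p" and Q: "Q > 0"
    and t: "\<And>p. p \<in> S \<Longrightarrow> t p \<in> R"
  shows "card (rclass S t \<inter> rbox 0 (int Q)) * (\<Prod>p\<in>S. idx p) = Q ^ card E"
proof -
  let ?h = "\<lambda>t. rclass S t \<inter> rbox 0 (int Q)"
  let ?T = "PiE S reps"
  have T: "finite ?T" using S finite_reps prm_nideal by (intro finite_PiE) auto
  have TR: "\<tau> p \<in> R" if "\<tau> \<in> ?T" "p \<in> S" for \<tau> p
    using PiE_mem[OF that] reps_R[OF prm_nideal[OF S(2)[OF that(2)]]] by blast
  have eq: "card (?h \<tau>) = card (?h t)" if "\<tau> \<in> ?T" for \<tau>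
    using card_rclass_le[OF S Q, of t \<tau>] card_rclass_le[OF S Q, of \<tau> t] t TR[OF that] by fastforce
  have "rbox 0 (int Q) = (\<Union>\<tau>\<in>?T. ?h \<tau>)"
  proof
    show "rbox 0 (int Q) \<subseteq> (\<Union>\<tau>\<in>?T. ?h \<tau>)"
    proof
      fix x assume x: "x \<in> rbox 0 (int Q)"
      then have xR: "x \<in> R" by (simp add: rbox_def)
      have "\<exists>s. s \<in> reps p \<and> x - s \<in> p" if "p \<in> S" for p
        using reps_ex[OF prm_nideal[OF S(2)[OF that]] xR] by blast
      then have "\<forall>p. \<exists>s. p \<in> S \<longrightarrow> s \<in> reps p \<and> x - s \<in> p" by blast
      from choice[OF this] obtain s where s: "\<And>p. p \<in> S \<Longrightarrow> s p \<in> reps p \<and> x - s p \<in> p" by blast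
      have "restrict s S \<in> ?T" using s by auto
      moreover have "x \<in> ?h (restrict s S)" using x xR s by (simp add: rclass_def)
      ultimately show "x \<in> (\<Union>\<tau>\<in>?T. ?h \<tau>)" by blast
    qed
  qed blast
  then have "card (rbox 0 (int Q)) = card (\<Union>\<tau>\<in>?T. ?h \<tau>)" by simp
  also have "\<dots> = (\<Sum>\<tau>\<in>?T. card (?h \<tau>))"
  proof (rule card_UN_disjoint[OF T])
    show "\<forall>\<tau>\<in>?T. finite (?h \<tau>)" using finite_rbox by simp
    show "\<forall>\<tau>\<in>?T. \<forall>\<sigma>\<in>?T. \<tau> \<noteq> \<sigma> \<longrightarrow> ?h \<tau> \<inter> ?h \<sigma> = {}"
    proof (intro ballI impI, rule ccontr)
      fix \<tau> \<sigma> assume h: "\<tau> \<in> ?T" "\<sigma> \<in> ?T" "\<tau> \<noteq> \<sigma>" "?h \<tau> \<inter> ?h \<sigma> \<noteq> {}"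
      then obtain x where x: "x \<in> rclass S \<tau>" "x \<in> rclass S \<sigma>" by blast
      have "\<tau> p = \<sigma> p" if p: "p \<in> S" for p
      proof (rule reps_unique[OF prm_nideal[OF S(2)[OF p]]])
        show "\<tau> p \<in> reps p" "\<sigma> p \<in> reps p" using PiE_mem[OF h(1) p] PiE_mem[OF h(2) p] .
        have "(x - \<sigma> p) - (x - \<tau> p) \<in> p"
          by (rule nideal_diff[OF prm_nideal[OF S(2)[OF p]]]) (use x p in \<open>unfold rclass_def, blast+\<close>)
        then show "\<tau> p - \<sigma> p \<in> p" by simp
      qed
      then have "\<tau> = \<sigma>" using h(1,2) by (rule PiE_ext[rotated 2])
      then show False using h by simp
    qed
  qed
  also have "\<dots> = card ?T * card (?h t)" using eq by simp
  also have "card ?T = (\<Prod>p\<in>S. idx p)"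
    using S card_reps prm_nideal by (simp add: card_PiE)
  finally show ?thesis using card_rbox[of 0 "int Q"] by (simp add: mult.commute)
qed

text \<open>A box of side \<open>2 * Q * q\<close> is tiled by \<open>(2 * q) ^ card E\<close>
  translates of the fundamental box along multiples of \<open>Q\<close>.\<close>

lemma card_rclass_box:
  assumes S: "\<And>p. p \<in> S \<Longrightarrow> prm p" "\<And>p. p \<in> S \<Longrightarrow> of_nat Q \<in> p" and Q: "Q > 0"
  shows "card (rclass S t \<inter> rbox (- int (Q * q)) (int (Q * q))) =
    (2 * q) ^ card E * card (rclass S t \<inter> rbox 0 (int Q))"
proof -
  let ?A = "(E \<rightarrow>\<^sub>E {- int q..<int q}) \<times> (rclass S t \<inter> rbox 0 (int Q))"
  let ?f = "\<lambda>(a, r). comb (\<lambda>e. int Q * a e) + r"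
  let ?g = "\<lambda>x. (restrict (\<lambda>e. co x e div int Q) E, red Q x)"
  have cof: "co (?f (a, r)) e = int Q * a e + co r e" if "r \<in> R" "e \<in> E" for a r e
    using that by (simp add: co_add co_comb)
  have fR: "?f (a, r) \<in> R" if "r \<in> R" for a r using that R_add by simp
  have redf: "red Q (?f (a, r)) = r" if "r \<in> rbox 0 (int Q)" for a r
  proof -
    have rR: "r \<in> R" using that by (simp add: rbox_def)
    have "co (?f (a, r)) e mod int Q = co r e" if "e \<in> E" for e
      using cof[OF rR that, of a] \<open>r \<in> rbox 0 (int Q)\<close> that by (simp add: rbox_def)
    then have "red Q (?f (a, r)) = comb (co r)" unfolding red_def by (rule comb_cong)
    then show ?thesis using comb_co[OF rR] by simp
  qed
  have "bij_betw ?f ?A (rclass S t \<inter> rbox (- int (Q * q)) (int (Q * q)))"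
  proof (rule bij_betwI[where g = ?g])
    show "?f \<in> ?A \<rightarrow> rclass S t \<inter> rbox (- int (Q * q)) (int (Q * q))"
    proof
      fix z assume z: "z \<in> ?A"
      obtain a r where ar: "z = (a, r)" by (cases z)
      have a: "a \<in> E \<rightarrow>\<^sub>E {- int q..<int q}" and r: "r \<in> rclass S t" "r \<in> rbox 0 (int Q)"
        using z ar by auto
      have rR: "r \<in> R" using r by (simp add: rbox_def)
      have "red Q (?f z) \<in> rclass S t" using redf[OF r(2)] r(1) ar by simp
      then have "?f z \<in> rclass S t" using red_periodic[OF S fR[OF rR]] ar by simp
      moreover have "- int (Q * q) \<le> co (?f z) e \<and> co (?f z) e < int (Q * q)" if e: "e \<in> E" for e
      proof -
        have b: "0 \<le> co r e" "co r e < int Q" using r(2) e by (auto simp: rbox_def)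
        have "a e \<in> {- int q..<int q}" using PiE_mem[OF a e] .
        then have a1: "- int q \<le> a e" "a e + 1 \<le> int q" by auto
        have "int Q * (- int q) \<le> int Q * a e" "int Q * (a e + 1) \<le> int Q * int q"
          using a1 by (intro mult_left_mono; simp)+
        then show ?thesis using cof[OF rR e, of a] b ar by (simp add: algebra_simps)
      qed
      ultimately show "?f z \<in> rclass S t \<inter> rbox (- int (Q * q)) (int (Q * q))"
        by (auto simp: rbox_def rclass_def)
    qed
    show "?g \<in> rclass S t \<inter> rbox (- int (Q * q)) (int (Q * q)) \<rightarrow> ?A"
    proof
      fix x assume x: "x \<in> rclass S t \<inter> rbox (- int (Q * q)) (int (Q * q))"
      then have xR: "x \<in> R" by (simp add: rbox_def)
      have "co x e div int Q \<in> {- int q..<int q}" if e: "e \<in> E" for e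
      proof -
        have "- (int Q * int q) \<le> co x e" "co x e < int Q * int q"
          using x e by (auto simp: rbox_def)
        then have "- int q * int Q \<le> co x e" "co x e < int q * int Q" by (simp_all add: mult.commute)
        then have lo: "int Q * (- int q) \<le> co x e" and hi: "co x e < int Q * int q"
          by (simp_all add: mult.commute)
        have Q0: "0 < int Q" using Q by simp
        let ?d = "co x e div int Q"
        have "co x e = int Q * ?d + co x e mod int Q" by simp
        moreover have "0 \<le> co x e mod int Q" "co x e mod int Q < int Q" using Q0 by auto
        ultimately have "int Q * ?d \<le> co x e" "co x e < int Q * (?d + 1)"
          unfolding distrib_left by linarith+
        then have "int Q * ?d < int Q * int q" "int Q * (- int q) < int Q * (?d + 1)"
          using lo hi by linarith+
        then have "?d < int q" "- int q < ?d + 1" using Q0 mult_less_cancel_left_pos by blast+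
        then show ?thesis by simp
      qed
      then show "?g x \<in> ?A" using x red_periodic[OF S xR] red_rbox[OF Q] by auto
    qed
    show "?g (?f z) = z" if z: "z \<in> ?A" for z
    proof -
      obtain a r where ar: "z = (a, r)" by (cases z)
      have a: "a \<in> E \<rightarrow>\<^sub>E {- int q..<int q}" and r: "r \<in> rbox 0 (int Q)" using z ar by auto
      have rR: "r \<in> R" using r by (simp add: rbox_def)
      have "restrict (\<lambda>e. co (?f z) e div int Q) E e = a e" for e
      proof (cases "e \<in> E")
        case True
        then have "co (?f z) e div int Q = a e"
          using cof[OF rR True, of a] r Q ar by (simp add: rbox_def)
        then show ?thesis using True by simp
      next
        case False
        then show ?thesis using PiE_arb[OF a False] by simp
      qed
      then have "restrict (\<lambda>e. co (?f z) e div int Q) E = a" by blast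
      then show ?thesis using redf[OF r, of a] ar by simp
    qed
    show "?f (?g x) = x" if "x \<in> rclass S t \<inter> rbox (- int (Q * q)) (int (Q * q))" for x
    proof -
      have xR: "x \<in> R" using that by (simp add: rbox_def)
      have "comb (\<lambda>e. int Q * restrict (\<lambda>e. co x e div int Q) E e) =
          comb (\<lambda>e. int Q * (co x e div int Q))" by (rule comb_cong) simp
      also have "\<dots> = of_int (int Q) * comb (\<lambda>e. co x e div int Q)" by (rule comb_scale)
      finally show ?thesis using red_decomp[OF xR, of Q] by simp
    qed
  qed
  from bij_betw_same_card[OF this] show ?thesis
    using finite_E by (simp add: card_cartesian_product card_PiE)
qed

abbreviation box :: "nat \<Rightarrow> 'a set" where "box B \<equiv> rbox (- int B) (int B)"

lemma card_box: "card (box B) = (2 * B) ^ card E"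
  by (simp add: card_rbox)

lemma box_mono: "B \<le> B' \<Longrightarrow> box B \<subseteq> box B'"
  by (fastforce simp: rbox_def)

text \<open>\<open>B\<close> is enclosed between consecutive multiples of \<open>Q\<close>, whose
  boxes are tiled exactly.\<close>

lemma card_rclass_box_bounds:
  assumes S: "\<And>p. p \<in> S \<Longrightarrow> prm p" "\<And>p. p \<in> S \<Longrightarrow> of_nat Q \<in> p" and Q: "Q > 0"
  shows "(2 * (B div Q)) ^ card E * card (rclass S t \<inter> rbox 0 (int Q)) \<le> card (rclass S t \<inter> box B)"
    and "card (rclass S t \<inter> box B) \<le> (2 * (B div Q + 1)) ^ card E * card (rclass S t \<inter> rbox 0 (int Q))"
proof -
  have "Q * (B div Q) \<le> B" by simp
  then have "rclass S t \<inter> box (Q * (B div Q)) \<subseteq> rclass S t \<inter> box B"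
    using box_mono by blast
  then show "(2 * (B div Q)) ^ card E * card (rclass S t \<inter> rbox 0 (int Q)) \<le> card (rclass S t \<inter> box B)"
    using card_rclass_box[where S = S and t = t and q = "B div Q", OF S Q] card_mono[of "rclass S t \<inter> box B"] finite_rbox
    by (metis finite_Int)
  have "B \<le> Q * (B div Q + 1)" using Q dividend_less_times_div[of Q B] by (simp add: algebra_simps)
  then have "rclass S t \<inter> box B \<subseteq> rclass S t \<inter> box (Q * (B div Q + 1))"
    using box_mono by blast
  then show "card (rclass S t \<inter> box B) \<le> (2 * (B div Q + 1)) ^ card E * card (rclass S t \<inter> rbox 0 (int Q))"
    using card_rclass_box[where S = S and t = t and q = "B div Q + 1", OF S Q]
      card_mono[of "rclass S t \<inter> box (Q * (B div Q + 1))"] finite_rbox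
    by (metis finite_Int)
qed

lemma pos_int_common:
  assumes "finite S" "\<And>p. p \<in> S \<Longrightarrow> prm p"
  obtains Q :: nat where "Q > 0" "\<And>p. p \<in> S \<Longrightarrow> of_nat Q \<in> p"
proof -
  have "\<exists>N::nat. N > 0 \<and> of_nat N \<in> p" if "p \<in> S" for p
    using nideal_pos_nat[OF prm_nideal[OF assms(2)[OF that]]] by blast
  then obtain N :: "'a set \<Rightarrow> nat" where N: "\<And>p. p \<in> S \<Longrightarrow> N p > 0 \<and> of_nat (N p) \<in> p" by metis
  have "of_nat (prod N S) \<in> p" if p: "p \<in> S" for p
  proof -
    have "(of_nat (N p) :: 'a) * of_nat (prod N (S - {p})) \<in> p"
      using N[OF p] by (intro nideal_mult'[OF prm_nideal[OF assms(2)[OF p]] R_of_nat]) simp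
    then show ?thesis unfolding prod.remove[OF assms(1) p, of N] of_nat_mult .
  qed
  moreover have "prod N S > 0" using N by (intro prod_pos) auto
  ultimately show ?thesis using that by blast
qed

lemma rclass_density:
  assumes S: "finite S" "\<And>p. p \<in> S \<Longrightarrow> prm p" and t: "\<And>p. p \<in> S \<Longrightarrow> t p \<in> R"
  shows "(\<lambda>B. real (card (rclass S t \<inter> box B)) / real (card (box B))) \<longlonglongrightarrow> 1 / (\<Prod>p\<in>S. real (idx p))"
proof -
  obtain Q where Q: "Q > 0" "\<And>p. p \<in> S \<Longrightarrow> of_nat Q \<in> p" using pos_int_common[OF S] by metis
  let ?k = "card E"
  define h where "h = real (card (rclass S t \<inter> rbox 0 (int Q)))"
  have "h * (\<Prod>p\<in>S. real (idx p)) = real Q ^ ?k"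
    unfolding h_def using arg_cong[OF card_rclass[where S = S and t = t, OF S Q(2,1) t], of real] by simp
  moreover have pos: "(\<Prod>p\<in>S. real (idx p)) > 0" using idx_pos prm_nideal S(2) by (intro prod_pos) auto
  ultimately have h: "(1 / real Q) ^ ?k * h = 1 / (\<Prod>p\<in>S. real (idx p))"
    using Q(1) by (simp add: field_simps)
  have fl: "(\<lambda>B. real (B div Q) / real B) \<longlonglongrightarrow> 1 / real Q"
  proof (rule real_tendsto_sandwich)
    show "\<forall>\<^sub>F B in sequentially. 1 / real Q - 1 / real B \<le> real (B div Q) / real B"
    proof (rule eventually_mono[OF eventually_gt_at_top[of 0]])
      fix B :: nat assume B: "B > 0"
      have "B < Q * (B div Q + 1)" using Q(1) dividend_less_times_div[of Q B] by (simp add: algebra_simps)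
      then have "real B < real Q * (real (B div Q) + 1)"
        by (metis of_nat_1 of_nat_add of_nat_less_iff of_nat_mult)
      then have "real B / real Q - 1 \<le> real (B div Q)" using Q(1) by (simp add: field_simps)
      then have "(real B / real Q - 1) / real B \<le> real (B div Q) / real B" by (intro divide_right_mono) auto
      then show "1 / real Q - 1 / real B \<le> real (B div Q) / real B" using B by (simp add: diff_divide_distrib)
    qed
    show "\<forall>\<^sub>F B in sequentially. real (B div Q) / real B \<le> 1 / real Q"
    proof (rule eventually_mono[OF eventually_gt_at_top[of 0]])
      fix B :: nat assume B: "B > 0"
      have "Q * (B div Q) \<le> B" by simp
      then have "real Q * real (B div Q) \<le> real B" by (metis of_nat_le_iff of_nat_mult)
      then have "real (B div Q) \<le> real B / real Q" using Q(1) by (simp add: field_simps)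
      then have "real (B div Q) / real B \<le> (real B / real Q) / real B" by (intro divide_right_mono) auto
      then show "real (B div Q) / real B \<le> 1 / real Q" using B by simp
    qed
    show "(\<lambda>B. 1 / real Q - 1 / real B) \<longlonglongrightarrow> 1 / real Q"
      using tendsto_diff[OF tendsto_const lim_1_over_n, of "1 / real Q"] by simp
  qed simp
  have lo: "(\<lambda>B. (real (B div Q) / real B) ^ ?k * h) \<longlonglongrightarrow> (1 / real Q) ^ ?k * h"
    by (intro tendsto_intros fl)
  have hi: "(\<lambda>B. (real (B div Q) / real B + 1 / real B) ^ ?k * h) \<longlonglongrightarrow> (1 / real Q + 0) ^ ?k * h"
    by (intro tendsto_intros fl lim_1_over_n)
  show ?thesis
  proof (rule real_tendsto_sandwich[OF _ _ lo[unfolded h] hi[unfolded add_0_right h]])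
    show "\<forall>\<^sub>F B in sequentially. (real (B div Q) / real B) ^ ?k * h \<le> real (card (rclass S t \<inter> box B)) / real (card (box B))"
    proof (rule eventually_mono[OF eventually_gt_at_top[of 0]])
      fix B :: nat assume B: "B > 0"
      have "(2 * real (B div Q)) ^ ?k * h \<le> real (card (rclass S t \<inter> box B))"
      proof -
        have "real ((2 * (B div Q)) ^ ?k * card (rclass S t \<inter> rbox 0 (int Q))) \<le> real (card (rclass S t \<inter> box B))"
          unfolding of_nat_le_iff by (rule card_rclass_box_bounds(1)[OF S(2) Q(2,1)])
        then show ?thesis by (simp add: h_def)
      qed
      then have "(2 * real (B div Q)) ^ ?k * h / (2 * real B) ^ ?k \<le> real (card (rclass S t \<inter> box B)) / (2 * real B) ^ ?k"
        by (intro divide_right_mono) auto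
      then show "(real (B div Q) / real B) ^ ?k * h \<le> real (card (rclass S t \<inter> box B)) / real (card (box B))"
        by (simp add: card_box power_mult_distrib power_divide)
    qed
    show "\<forall>\<^sub>F B in sequentially. real (card (rclass S t \<inter> box B)) / real (card (box B)) \<le> (real (B div Q) / real B + 1 / real B) ^ ?k * h"
    proof (rule eventually_mono[OF eventually_gt_at_top[of 0]])
      fix B :: nat assume B: "B > 0"
      have "real (card (rclass S t \<inter> box B)) \<le> real ((2 * (B div Q + 1)) ^ ?k * card (rclass S t \<inter> rbox 0 (int Q)))"
        unfolding of_nat_le_iff by (rule card_rclass_box_bounds(2)[OF S(2) Q(2,1)])
      also have "\<dots> = (2 * (real (B div Q) + 1)) ^ ?k * h"
        unfolding h_def by (simp add: add.commute)
      finally have "real (card (rclass S t \<inter> box B)) / (2 * real B) ^ ?k \<le> (2 * (real (B div Q) + 1)) ^ ?k * h / (2 * real B) ^ ?k"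
        by (intro divide_right_mono) auto
      also have "\<dots> = (real (B div Q) / real B + 1 / real B) ^ ?k * h"
      proof -
        have "(2 * (real (B div Q) + 1)) ^ ?k / (2 * real B) ^ ?k = (real (B div Q) / real B + 1 / real B) ^ ?k"
          unfolding power_divide[symmetric] mult_divide_mult_cancel_left_if add_divide_distrib by simp
        then show ?thesis by (metis times_divide_eq_left)
      qed
      finally show "real (card (rclass S t \<inter> box B)) / real (card (box B)) \<le> (real (B div Q) / real B + 1 / real B) ^ ?k * h"
        by (simp add: card_box)
    qed
  qed
qed

subsection \<open>Residue characteristics and the Euler product\<close>

text \<open>The residue characteristic; \<open>pchar_prime\<close> shows that this least positive
  integer is a prime number.\<close>

definition pchar :: "'a set \<Rightarrow> nat" where
  "pchar p = (LEAST l. l > 0 \<and> of_nat l \<in> p)"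

lemma pchar:
  assumes "prm p"
  shows "pchar p > 0" "of_nat (pchar p) \<in> p" "\<And>l. l > 0 \<Longrightarrow> of_nat l \<in> p \<Longrightarrow> pchar p \<le> l"
proof -
  have ex: "\<exists>l. l > 0 \<and> (of_nat l :: 'a) \<in> p" using nideal_pos_nat[OF prm_nideal[OF assms]] by metis
  show "pchar p > 0" "of_nat (pchar p) \<in> p" using LeastI_ex[OF ex] by (auto simp: pchar_def)
  show "pchar p \<le> l" if "l > 0" "of_nat l \<in> p" for l
    unfolding pchar_def using that by (intro Least_le) auto
qed

lemma pchar_dvd_nat:
  assumes p: "prm p" "of_nat l \<in> p"
  shows "pchar p dvd l"
proof -
  have P: "nideal p" using prm_nideal[OF p(1)] .
  have "(of_nat l :: 'a) = of_nat (pchar p * (l div pchar p) + l mod pchar p)" by simp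
  then have "(of_nat l :: 'a) - of_nat (pchar p) * of_nat (l div pchar p) = of_nat (l mod pchar p)"
    by (simp only: of_nat_add of_nat_mult) simp
  moreover have "(of_nat l :: 'a) - of_nat (pchar p) * of_nat (l div pchar p) \<in> p"
    using nideal_diff[OF P p(2) nideal_mult'[OF P R_of_nat pchar(2)[OF p(1)]]] .
  ultimately have "of_nat (l mod pchar p) \<in> p" by simp
  then have "l mod pchar p = 0"
    using pchar(3)[OF p(1), of "l mod pchar p"] pchar(1)[OF p(1)] mod_less_divisor[of "pchar p" l] by linarith
  then show ?thesis by auto
qed

lemma pchar_dvd_int:
  assumes p: "prm p" "of_int l \<in> p"
  shows "int (pchar p) dvd l"
proof -
  have "(of_nat (nat \<bar>l\<bar>) :: 'a) \<in> p"
    using p(2) nideal_uminus[OF prm_nideal[OF p(1)] p(2)] by (cases "l \<ge> 0") auto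
  then have "int (pchar p) dvd int (nat \<bar>l\<bar>)"
    using pchar_dvd_nat[OF p(1)] by (simp only: int_dvd_int_iff)
  then show ?thesis by simp
qed

lemma pchar_ge_2: "prm p \<Longrightarrow> pchar p \<ge> 2"
  using pchar(1,2)[of p] prm_1[of p] by (cases "pchar p = 1") auto

lemma pchar_prime:
  assumes p: "prm p"
  shows "prime (pchar p)"
proof (rule prime_natI)
  show "pchar p \<ge> 2" by (rule pchar_ge_2[OF p])
  fix a b assume ab: "pchar p dvd a * b"
  then obtain c where "a * b = pchar p * c" by blast
  then have "(of_nat a :: 'a) * of_nat b = of_nat (pchar p) * of_nat c" by (metis of_nat_mult)
  then have "(of_nat a :: 'a) * of_nat b \<in> p"
    using nideal_mult'[OF prm_nideal[OF p] R_of_nat pchar(2)[OF p]] by metis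
  then show "pchar p dvd a \<or> pchar p dvd b"
    using prm_mult_iff[OF p] pchar_dvd_nat[OF p] by auto
qed

text \<open>The integers from 0 to \<open>pchar p - 1\<close> are pairwise incongruent modulo
  \<open>p\<close>.\<close>

lemma pchar_le_idx:
  assumes p: "prm p"
  shows "pchar p \<le> idx p"
proof -
  have P: "nideal p" using prm_nideal[OF p] .
  have "inj_on (\<lambda>i. cls p (of_nat i)) {..<pchar p}"
  proof (rule linorder_inj_onI')
    fix i j assume ij: "i \<in> {..<pchar p}" "j \<in> {..<pchar p}" "i < j"
    show "cls p (of_nat i) \<noteq> cls p (of_nat j)"
    proof
      assume "cls p (of_nat i) = cls p (of_nat j)"
      then have "(of_nat j :: 'a) - of_nat i \<in> p" using cls_eq_iff[OF P R_of_nat R_of_nat] nideal_diff_sym[OF P] by metis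
      then have "of_nat (j - i) \<in> p" using ij by (simp add: of_nat_diff)
      then show False using pchar(3)[OF p, of "j - i"] ij by auto
    qed
  qed
  then have "pchar p = card ((\<lambda>i. cls p (of_nat i)) ` {..<pchar p})" by (simp add: card_image)
  also have "\<dots> \<le> card (cls p ` R)" by (intro card_mono finite_cls[OF P]) auto
  finally show ?thesis by (simp add: idx_def)
qed

text \<open>Apply the class count with modulus \<open>l\<close>: the class of 0 is nonempty, so the
  product of the norms is at most \<open>l ^ card E\<close>, while each norm is at least
  \<open>l\<close>.\<close>

lemma primes_over:
  "finite {p. prm p \<and> pchar p = l}" "card {p. prm p \<and> pchar p = l} \<le> card E"
proof -
  have "card G \<le> card E" if G: "G \<subseteq> {p. prm p \<and> pchar p = l}" "finite G" for G
  proof (cases "G = {}")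
    case False
    have Gp: "prm p" "pchar p = l" if "p \<in> G" for p using that G by auto
    obtain p0 where p0: "p0 \<in> G" using False by blast
    have l: "l \<ge> 2" using pchar_ge_2[OF Gp(1)[OF p0]] Gp(2)[OF p0] by simp
    have "card (rclass G (\<lambda>_. 0) \<inter> rbox 0 (int l)) * (\<Prod>p\<in>G. idx p) = l ^ card E"
      by (rule card_rclass[OF G(2)]) (use Gp l pchar(2) in auto)
    moreover from this have "card (rclass G (\<lambda>_. 0) \<inter> rbox 0 (int l)) > 0"
      using l by (metis gr0I mult_0 not_numeral_le_zero power_eq_0_iff)
    ultimately have "(\<Prod>p\<in>G. idx p) \<le> l ^ card E"
      by (metis One_nat_def Suc_leI mult_le_mono1 nat_mult_1)
    moreover have "(\<Prod>p\<in>G. l) \<le> (\<Prod>p\<in>G. idx p)"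
      by (intro prod_mono) (use pchar_le_idx Gp in auto)
    ultimately have "l ^ card G \<le> l ^ card E" by simp
    then show ?thesis using l by (simp add: power_increasing_iff)
  qed simp
  from finite_if_finite_subsets_card_bdd[of "{p. prm p \<and> pchar p = l}", OF this]
  show "finite {p. prm p \<and> pchar p = l}" "card {p. prm p \<and> pchar p = l} \<le> card E" by auto
qed

lemma rclass_single: "rclass {p} (\<lambda>_. t) = {x \<in> R. x - t \<in> p}"
  by (auto simp: rclass_def)

text \<open>The box is covered by cubes of side \<open>l = pchar p\<close>. Rounding up costs
  \<open>2 * (B div l + 1) * l \<le> 2 * B + 2 * l \<le> 3 * (2 * B)\<close> per coordinate, which
  is the origin of the 3.\<close>

lemma card_class_small:
  assumes p: "prm p" and t: "t \<in> R" and small: "pchar p \<le> 2 * B"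
  shows "real (card {x \<in> box B. x - t \<in> p}) \<le> 3 ^ card E * real (card (box B)) / real (idx p)"
proof -
  let ?k = "card E" and ?l = "pchar p"
  have l: "?l > 0" using pchar(1)[OF p] .
  define h where "h = card (rclass {p} (\<lambda>_. t) \<inter> rbox 0 (int ?l))"
  have h: "h * idx p = ?l ^ ?k"
    unfolding h_def using card_rclass[of "{p}" ?l "\<lambda>_. t"] p t l pchar(2)[OF p] by simp
  have "{x \<in> box B. x - t \<in> p} = rclass {p} (\<lambda>_. t) \<inter> box B"
    unfolding rclass_single using rbox_R by blast
  then have "card {x \<in> box B. x - t \<in> p} \<le> (2 * (B div ?l + 1)) ^ ?k * h"
    unfolding h_def using card_rclass_box_bounds(2)[where S = "{p}" and Q = ?l and B = B and t = "\<lambda>_. t"] p l pchar(2)[OF p] by simp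
  then have "card {x \<in> box B. x - t \<in> p} * idx p \<le> ((2 * (B div ?l + 1)) ^ ?k * h) * idx p" by simp
  also have "\<dots> = (2 * (B div ?l + 1) * ?l) ^ ?k"
    unfolding mult.assoc h by (simp only: power_mult_distrib mult.assoc)
  also have "\<dots> \<le> (3 * (2 * B)) ^ ?k"
  proof (rule power_mono)
    have "B div ?l * ?l \<le> B" by simp
    moreover have "2 * (B div ?l + 1) * ?l = 2 * (B div ?l * ?l) + 2 * ?l"
      by (simp only: distrib_right distrib_left mult_1 mult_1_right mult.assoc)
    ultimately show "2 * (B div ?l + 1) * ?l \<le> 3 * (2 * B)" using small by linarith
  qed simp
  finally have "real (card {x \<in> box B. x - t \<in> p} * idx p) \<le> real ((3 * (2 * B)) ^ ?k)"
    by (simp only: of_nat_le_iff)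
  then have "real (card {x \<in> box B. x - t \<in> p}) * real (idx p) \<le> 3 ^ ?k * real (card (box B))"
    unfolding card_box power_mult_distrib[of 3] by simp
  then show ?thesis using idx_pos[OF prm_nideal[OF p]] by (simp add: pos_le_divide_eq)
qed

text \<open>Some basis element lies outside \<open>p\<close>; its coefficient is determined modulo \<open>pchar p\<close> by the others.\<close>

lemma card_class_large:
  assumes p: "prm p" and t: "t \<in> R" and large: "2 * B \<le> pchar p"
  shows "card {x \<in> box B. x - t \<in> p} \<le> (2 * B) ^ (card E - 1)"
proof -
  have P: "nideal p" using prm_nideal[OF p] .
  have "\<exists>e\<in>E. e \<notin> p"
  proof (rule ccontr)
    assume "\<not> ?thesis"
    then have "comb (co 1) \<in> p"
      unfolding comb_def by (intro nideal_sum[OF P] nideal_mult[OF P] R_of_int) auto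
    then show False using prm_1[OF p] by (simp add: comb_co)
  qed
  then obtain e where e: "e \<in> E" "e \<notin> p" by blast
  let ?X = "{x \<in> box B. x - t \<in> p}"
  have inj: "inj_on (\<lambda>x. restrict (co x) (E - {e})) ?X"
  proof (rule inj_onI)
    fix x y assume xy: "x \<in> ?X" "y \<in> ?X" "restrict (co x) (E - {e}) = restrict (co y) (E - {e})"
    have R: "x \<in> R" "y \<in> R" using xy by (auto simp: rbox_def)
    have other: "co x f = co y f" if "f \<in> E" "f \<noteq> e" for f
      using fun_cong[OF xy(3), of f] that by simp
    have "(x - t) - (y - t) \<in> p" using xy nideal_diff[OF P, of "x - t" "y - t"] by blast
    then have "x - y \<in> p" by simp
    also have "x - y = comb (\<lambda>f. co x f - co y f)" using R by (simp add: comb_diff comb_co)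
    also have "\<dots> = (\<Sum>f\<in>{e}. of_int (co x f - co y f) * f)"
      unfolding comb_def using e finite_E other by (intro sum.mono_neutral_right) auto
    finally have "of_int (co x e - co y e) * e \<in> p" by simp
    then have "of_int (co x e - co y e) \<in> p"
      using prm_mult_iff[OF p R_of_int R_E[OF e(1)]] e(2) by blast
    then have dv: "int (pchar p) dvd co x e - co y e" using pchar_dvd_int[OF p] by blast
    have "- int B \<le> co x e" "co x e < int B" "- int B \<le> co y e" "co y e < int B"
      using xy e by (auto simp: rbox_def)
    then have "\<bar>co x e - co y e\<bar> < int (2 * B)" by linarith
    then have "\<bar>co x e - co y e\<bar> < int (pchar p)" using large by linarith
    then have "co x e = co y e" using dv zdvd_imp_le[of "int (pchar p)" "\<bar>co x e - co y e\<bar>"] by auto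
    then have "co x f = co y f" if "f \<in> E" for f using other[OF that] by (cases "f = e") auto
    then show "x = y" by (rule co_eqI[OF R])
  qed
  have "card ?X = card ((\<lambda>x. restrict (co x) (E - {e})) ` ?X)" using card_image[OF inj] by simp
  also have "\<dots> \<le> card ((E - {e}) \<rightarrow>\<^sub>E {- int B..<int B})"
  proof (rule card_mono)
    show "finite ((E - {e}) \<rightarrow>\<^sub>E {- int B..<int B})" by (rule finite_PiE) (use finite_E in auto)
    show "(\<lambda>x. restrict (co x) (E - {e})) ` ?X \<subseteq> (E - {e}) \<rightarrow>\<^sub>E {- int B..<int B}"
    proof (rule image_subsetI)
      fix x assume "x \<in> ?X"
      then have "\<forall>f\<in>E. - int B \<le> co x f \<and> co x f < int B" by (simp add: rbox_def)
      then show "restrict (co x) (E - {e}) \<in> (E - {e}) \<rightarrow>\<^sub>E {- int B..<int B}" by simp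
    qed
  qed
  also have "\<dots> = (2 * B) ^ (card E - 1)"
    using finite_E e by (simp add: card_PiE)
  finally show ?thesis .
qed

lemma idx_ge_2: "prm p \<Longrightarrow> idx p \<ge> 2"
  using pchar_ge_2 pchar_le_idx le_trans by blast

text \<open>At most \<open>card E\<close> primes lie over each rational integer \<open>l\<close>,
  with norm at least \<open>l\<close>, so the series is dominated by \<open>card E\<close> times the
  sum of \<open>1 / l ^ 2\<close>.\<close>

lemma summable_primes:
  assumes "s \<ge> 2"
  shows "(\<lambda>p. 1 / real (idx p) ^ s) summable_on {p. prm p}"
proof (rule nonneg_bdd_above_summable_on)
  let ?f = "\<lambda>l::nat. 1 / real l ^ 2"
  have summ: "summable ?f" using inverse_power_summable[of 2, where 'a = real] by (simp add: field_simps)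
  have "sum (\<lambda>p. 1 / real (idx p) ^ s) F \<le> real (card E) * suminf ?f" if F: "F \<subseteq> {p. prm p}" "finite F" for F
  proof -
    have "sum (\<lambda>p. 1 / real (idx p) ^ s) F \<le> sum (\<lambda>p. ?f (pchar p)) F"
    proof (rule sum_mono)
      fix p assume "p \<in> F"
      then have p: "prm p" using F by auto
      have i: "real (idx p) \<ge> real (pchar p)" "real (pchar p) \<ge> 2"
        using pchar_le_idx[OF p] pchar_ge_2[OF p] by auto
      have "real (pchar p) ^ 2 \<le> real (idx p) ^ 2" using i by (intro power_mono) auto
      also have "\<dots> \<le> real (idx p) ^ s" using i assms by (intro power_increasing) auto
      finally show "1 / real (idx p) ^ s \<le> ?f (pchar p)" using i by (intro divide_left_mono) auto
    qed
    also have "\<dots> = (\<Sum>l\<in>pchar ` F. \<Sum>p | p \<in> F \<and> pchar p = l. ?f (pchar p))"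
      by (rule sum.image_gen[OF F(2)])
    also have "\<dots> \<le> (\<Sum>l\<in>pchar ` F. real (card E) * ?f l)"
    proof (rule sum_mono)
      fix l
      have "(\<Sum>p | p \<in> F \<and> pchar p = l. ?f (pchar p)) = real (card {p\<in>F. pchar p = l}) * ?f l" by simp
      also have "card {p\<in>F. pchar p = l} \<le> card {p. prm p \<and> pchar p = l}"
        using F by (intro card_mono primes_over) auto
      then have "real (card {p\<in>F. pchar p = l}) * ?f l \<le> real (card E) * ?f l"
        using primes_over(2)[of l] by (intro mult_right_mono) auto
      finally show "(\<Sum>p | p \<in> F \<and> pchar p = l. ?f (pchar p)) \<le> real (card E) * ?f l" .
    qed
    also have "\<dots> = real (card E) * sum ?f (pchar ` F)" by (simp add: sum_distrib_left)
    also have "\<dots> \<le> real (card E) * suminf ?f"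
      using F(2) by (intro mult_left_mono sum_le_suminf[OF summ]) auto
    finally show ?thesis .
  qed
  then show "bdd_above (sum (\<lambda>p. 1 / real (idx p) ^ s) ` {F. F \<subseteq> {p. prm p} \<and> finite F})"
    unfolding bdd_above_def by blast
qed auto

section \<open>Factorisation over finitely many primes and the Euler product\<close>

lemma finite_prm_containing:
  assumes I: "nideal I"
  shows "finite {p. prm p \<and> I \<subseteq> p}"
proof -
  obtain N where N: "N > 0" "of_nat N \<in> I" using nideal_pos_nat[OF I] .
  have "{p. prm p \<and> I \<subseteq> p} \<subseteq> (\<Union>l\<in>{..N}. {p. prm p \<and> pchar p = l})"
    using pchar(3) N by auto
  then show ?thesis using primes_over(1) finite_subset by (metis (no_types, lifting) finite_UN finite_atMost)
qed

text \<open>The ideals composed of primes in \<open>S\<close>. The unit ideal lies in no prime, so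
  it always belongs to this set, and it is the only member for empty \<open>S\<close>.\<close>

definition supp_ideals :: "'a set set \<Rightarrow> 'a set set" where
  "supp_ideals S = {I. nideal I \<and> (\<forall>q. prm q \<and> I \<subseteq> q \<longrightarrow> q \<in> S)}"

lemma pmul_pow:
  assumes p: "prm p" and I: "nideal I"
  shows "nideal ((pmul p ^^ k) I)" "idx ((pmul p ^^ k) I) = idx p ^ k * idx I"
  by (induction k) (simp_all add: I pmul_nideal[OF p] idx_pmul[OF p])

lemma pmul_pow_subset:
  assumes p: "prm p" and q: "prm q" and I: "nideal I" and ne: "p \<noteq> q"
  shows "(pmul p ^^ k) I \<subseteq> q \<longleftrightarrow> I \<subseteq> q"
  by (induction k) (simp_all add: pmul_subset_prm[OF p q pmul_pow(1)[OF p I] ne])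

text \<open>The exponent of \<open>p\<close> and the cofactor prime to \<open>p\<close> are unique,
  since multiplication by \<open>p\<close> can be cancelled and its image lies in
  \<open>p\<close>.\<close>

lemma pmul_pow_cancel:
  assumes p: "prm p" and I: "nideal I" "\<not> I \<subseteq> p" and J: "nideal J" "\<not> J \<subseteq> p"
    and eq: "(pmul p ^^ k) I = (pmul p ^^ l) J"
  shows "k = l \<and> I = J"
  using eq
proof (induction k arbitrary: l)
  case 0
  then show ?case using I J pmul_subset_p[OF p pmul_pow(1)[OF p J(1)]] by (cases l) auto
next
  case (Suc k)
  show ?case
  proof (cases l)
    case 0
    then show ?thesis using Suc.prems J pmul_subset_p[OF p pmul_pow(1)[OF p I(1)], of k] by auto
  next
    case (Suc l')
    then have "pmul p ((pmul p ^^ k) I) = pmul p ((pmul p ^^ l') J)" using Suc.prems by simp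
    then have "(pmul p ^^ k) I = (pmul p ^^ l') J"
      using pmul_inj[OF p pmul_pow(1)[OF p I(1)] pmul_pow(1)[OF p J(1)], of k l']
        pmul_inj[OF p pmul_pow(1)[OF p J(1)] pmul_pow(1)[OF p I(1)], of l' k] by blast
    then show ?thesis using Suc.IH Suc by blast
  qed
qed

text \<open>As long as \<open>p\<close> contains the ideal, a factor \<open>p\<close> can be split
  off, and the index drops.\<close>

lemma pmul_pow_decomp:
  assumes p: "prm p" and J: "nideal J"
  obtains k I where "nideal I" "\<not> I \<subseteq> p" "(pmul p ^^ k) I = J"
proof -
  have "\<exists>k I. nideal I \<and> \<not> I \<subseteq> p \<and> (pmul p ^^ k) I = J"
    using J
  proof (induction "idx J" arbitrary: J rule: less_induct)
    case less
    show ?case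
    proof (cases "J \<subseteq> p")
      case False
      then show ?thesis using less.prems by (intro exI[of _ 0] exI[of _ J]) auto
    next
      case True
      obtain I where I: "nideal I" "pmul p I = J" using pmul_surj[OF p less.prems True] .
      have "idx I < idx J" using idx_pmul[OF p I(1)] I(2) idx_ge_2[OF p] idx_pos[OF I(1)] by auto
      then obtain k I' where "nideal I'" "\<not> I' \<subseteq> p" "(pmul p ^^ k) I' = I" using less.hyps I(1) by blast
      then show ?thesis using I by (intro exI[of _ "Suc k"] exI[of _ I']) auto
    qed
  qed
  then show ?thesis using that by blast
qed

text \<open>Unique factorisation in the form that the Euler product consumes: one prime is adjoined
  at a time, so a full factorisation into primes is never written down.\<close>

lemma supp_ideals_bij:
  assumes S: "\<And>q. q \<in> S \<Longrightarrow> prm q" and p: "prm p" "p \<notin> S"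
  shows "bij_betw (\<lambda>(k,I). (pmul p ^^ k) I) (UNIV \<times> supp_ideals S) (supp_ideals (insert p S))"
proof -
  have mem: "nideal I" "\<not> I \<subseteq> p" if "I \<in> supp_ideals S" for I
    using that p by (auto simp: supp_ideals_def)
  show ?thesis unfolding bij_betw_def
  proof
    show "inj_on (\<lambda>(k,I). (pmul p ^^ k) I) (UNIV \<times> supp_ideals S)"
    proof (rule inj_onI)
      fix z z' assume h: "z \<in> UNIV \<times> supp_ideals S" "z' \<in> UNIV \<times> supp_ideals S"
        "(case z of (k,I) \<Rightarrow> (pmul p ^^ k) I) = (case z' of (k,I) \<Rightarrow> (pmul p ^^ k) I)"
      obtain k I l J where z: "z = (k, I)" "z' = (l, J)" by (cases z, cases z')
      have "I \<in> supp_ideals S" "J \<in> supp_ideals S" using h z by auto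
      then have "k = l \<and> I = J" using pmul_pow_cancel[OF p(1) mem mem, of I J k l] h(3) z by simp
      then show "z = z'" using z by simp
    qed
    show "(\<lambda>(k,I). (pmul p ^^ k) I) ` (UNIV \<times> supp_ideals S) = supp_ideals (insert p S)"
    proof (intro equalityI subsetI)
      fix J assume "J \<in> (\<lambda>(k,I). (pmul p ^^ k) I) ` (UNIV \<times> supp_ideals S)"
      then obtain k I where kI: "I \<in> supp_ideals S" "J = (pmul p ^^ k) I" by auto
      have "q \<in> insert p S" if q: "prm q" "J \<subseteq> q" for q
      proof (cases "q = p")
        case False
        then have "I \<subseteq> q" using pmul_pow_subset[OF p(1) q(1) mem(1)[OF kI(1)], of k] q(2) kI(2) by auto
        then show ?thesis using kI(1) q(1) by (simp add: supp_ideals_def)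
      qed simp
      then show "J \<in> supp_ideals (insert p S)"
        using pmul_pow(1)[OF p(1) mem(1)[OF kI(1)]] kI(2) unfolding supp_ideals_def by blast
    next
      fix J assume J: "J \<in> supp_ideals (insert p S)"
      then have "nideal J" by (simp add: supp_ideals_def)
      then obtain k I where kI: "nideal I" "\<not> I \<subseteq> p" "(pmul p ^^ k) I = J"
        by (rule pmul_pow_decomp[OF p(1)])
      have "q \<in> S" if q: "prm q" "I \<subseteq> q" for q
      proof -
        have "q \<noteq> p" using q kI by blast
        then have "J \<subseteq> q" using pmul_pow_subset[OF p(1) q(1) kI(1), of k] q(2) kI(3) by auto
        then show ?thesis using J q(1) \<open>q \<noteq> p\<close> unfolding supp_ideals_def by blast
      qed
      then have "I \<in> supp_ideals S" using kI(1) by (simp add: supp_ideals_def)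
      then show "J \<in> (\<lambda>(k,I). (pmul p ^^ k) I) ` (UNIV \<times> supp_ideals S)"
        using kI(3) by (intro image_eqI[of _ _ "(k, I)"]) auto
    qed
  qed
qed

text \<open>Adjoining a prime multiplies the sum by a geometric series, through the bijection with
  pairs of an exponent and an ideal supported on the earlier primes.\<close>

lemma euler_partial:
  assumes "finite S" "\<And>p. p \<in> S \<Longrightarrow> prm p" and s: "s > 0"
  shows "((\<lambda>I. 1 / real (idx I) ^ s) has_sum (\<Prod>p\<in>S. 1 / (1 - 1 / real (idx p) ^ s))) (supp_ideals S)"
  using assms(1,2)
proof (induction S)
  case empty
  have "supp_ideals {} = {R}"
  proof (intro equalityI subsetI)
    fix I assume I: "I \<in> supp_ideals {}"
    then have "nideal I" "1 \<in> I" using ex_prm[of I] unfolding supp_ideals_def by blast+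
    then show "I \<in> {R}" using nideal_1_eq_R by simp
  qed (use nideal_R prm_1 in \<open>auto simp: supp_ideals_def\<close>)
  then show ?case by (simp add: has_sum_finite_iff idx_R)
next
  case (insert p S)
  have p: "prm p" using insert.prems by simp
  let ?q = "1 / real (idx p) ^ s"
  have "real (idx p) ^ s \<ge> 2 ^ s" using idx_ge_2[OF p] by (intro power_mono) auto
  moreover have "(2::real) ^ s > 1" using s by simp
  ultimately have "real (idx p) ^ s > 1" by linarith
  then have q: "0 \<le> ?q" "?q < 1" by (auto simp: divide_less_eq_1)
  have "((\<lambda>k. ?q ^ k) has_sum (1 / (1 - ?q))) UNIV"
    using q geometric_sums[of ?q] by (intro sums_nonneg_imp_has_sum) (auto simp del: power_divide)
  from has_sum_times_nonneg[OF this insert.IH]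
  have "((\<lambda>(k,I). ?q ^ k * (1 / real (idx I) ^ s)) has_sum
      (1 / (1 - ?q) * (\<Prod>p\<in>S. 1 / (1 - 1 / real (idx p) ^ s)))) (UNIV \<times> supp_ideals S)"
    using insert.prems by simp
  also have "?this \<longleftrightarrow> ((\<lambda>z. 1 / real (idx ((\<lambda>(k,I). (pmul p ^^ k) I) z)) ^ s) has_sum
      (1 / (1 - ?q) * (\<Prod>p\<in>S. 1 / (1 - 1 / real (idx p) ^ s)))) (UNIV \<times> supp_ideals S)"
  proof (rule has_sum_cong)
    fix z assume z: "z \<in> (UNIV :: nat set) \<times> supp_ideals S"
    obtain k I where kI: "z = (k, I)" by (cases z)
    have "nideal I" using z kI by (simp add: supp_ideals_def)
    then show "(case z of (k,I) \<Rightarrow> ?q ^ k * (1 / real (idx I) ^ s)) = 1 / real (idx ((\<lambda>(k,I). (pmul p ^^ k) I) z)) ^ s"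
      using kI pmul_pow(2)[OF p, of I k]
      by (simp add: power_mult_distrib power_mult[symmetric] mult.commute power_divide)
  qed
  also have "\<dots> \<longleftrightarrow> ((\<lambda>I. 1 / real (idx I) ^ s) has_sum
      (1 / (1 - ?q) * (\<Prod>p\<in>S. 1 / (1 - 1 / real (idx p) ^ s)))) (supp_ideals (insert p S))"
    using has_sum_reindex_bij_betw[OF supp_ideals_bij[OF _ p insert.hyps(2)],
        of "\<lambda>I. 1 / real (idx I) ^ s"] insert.prems by simp
  finally show ?case using insert by simp
qed

definition zeta :: "nat \<Rightarrow> real" where
  "zeta s = infsum (\<lambda>I. 1 / real (idx I) ^ s) {I. nideal I}"

lemma local_factor_bounds:
  assumes p: "prm p" and s: "s \<ge> 1"
  shows "0 \<le> 1 / real (idx p) ^ s" "1 / real (idx p) ^ s \<le> 1 / 2"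
proof -
  have "(2::real) ^ 1 \<le> 2 ^ s" using s by (intro power_increasing) auto
  also have "\<dots> \<le> real (idx p) ^ s" using idx_ge_2[OF p] by (intro power_mono) auto
  finally have "2 \<le> real (idx p) ^ s" by simp
  then show "1 / real (idx p) ^ s \<le> 1 / 2" using idx_ge_2[OF p] by (intro divide_left_mono) auto
qed simp

text \<open>A finite set of ideals involves finitely many primes, so its sum is at most a partial
  Euler product; these products are bounded through the convergent series over the primes.\<close>

lemma zeta_summable:
  assumes s: "s \<ge> 2"
  shows "(\<lambda>I. 1 / real (idx I) ^ s) summable_on {I. nideal I}"
proof (rule nonneg_bdd_above_summable_on)
  let ?q = "\<lambda>p. 1 / real (idx p) ^ s"
  define C where "C = exp (2 * infsum ?q {p. prm p})"
  have prod_le: "(\<Prod>p\<in>S. 1 / (1 - ?q p)) \<le> C" if S: "finite S" "S \<subseteq> {p. prm p}" for S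
  proof -
    have "(\<Prod>p\<in>S. 1 / (1 - ?q p)) \<le> (\<Prod>p\<in>S. exp (2 * ?q p))"
    proof (rule prod_mono)
      fix p assume "p \<in> S"
      then have q: "0 \<le> ?q p" "?q p \<le> 1 / 2" using local_factor_bounds[of p s] S s by auto
      define x where "x = ?q p"
      have x: "0 \<le> x" "x \<le> 1 / 2" using q unfolding x_def .
      \<comment> \<open>The aim is \<open>1 / (1 - x) \<le> exp (2 * x)\<close>, which holds for
        \<open>x\<close> up to one half; that range is ensured by the index being at least
        2.\<close>
      have "x * x \<le> x * (1 / 2)" using x by (intro mult_left_mono) auto
      then have "1 \<le> (1 + 2 * x) * (1 - x)" by (simp add: algebra_simps)
      also have "\<dots> \<le> exp (2 * x) * (1 - x)" using x exp_ge_add_one_self[of "2 * x"] by (intro mult_right_mono) auto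
      finally have "1 / (1 - x) \<le> exp (2 * x)" using x by (simp add: field_simps)
      then show "0 \<le> 1 / (1 - ?q p) \<and> 1 / (1 - ?q p) \<le> exp (2 * ?q p)"
        using x unfolding x_def[symmetric] by simp
    qed
    also have "\<dots> = exp (2 * sum ?q S)" using S by (simp add: exp_sum sum_distrib_left)
    also have "\<dots> \<le> C" unfolding C_def
      using S summable_primes[OF s] by (simp add: finite_sum_le_infsum)
    finally show ?thesis .
  qed
  have "sum (\<lambda>I. 1 / real (idx I) ^ s) F \<le> C" if F: "F \<subseteq> {I. nideal I}" "finite F" for F
  proof -
    define S where "S = (\<Union>I\<in>F. {p. prm p \<and> I \<subseteq> p})"
    have S: "finite S" "S \<subseteq> {p. prm p}" using F finite_prm_containing unfolding S_def by auto
    have "F \<subseteq> supp_ideals S" using F unfolding S_def supp_ideals_def by blast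
    then have "sum (\<lambda>I. 1 / real (idx I) ^ s) F \<le> (\<Prod>p\<in>S. 1 / (1 - ?q p))"
      using euler_partial[of S s] S s F(2) by (intro finite_sum_le_has_sum[where A = "supp_ideals S"]) auto
    then show ?thesis using prod_le[OF S] by simp
  qed
  then show "bdd_above (sum (\<lambda>I. 1 / real (idx I) ^ s) ` {F. F \<subseteq> {I. nideal I} \<and> finite F})"
    unfolding bdd_above_def by blast
qed simp

text \<open>Once \<open>S\<close> contains all primes dividing the ideals of a finite set, the
  product lies between their finite sum and \<open>zeta s\<close>. The limit along finite sets
  spares an enumeration of the primes.\<close>

lemma euler_product:
  assumes s: "s \<ge> 2"
  shows "((\<lambda>S. \<Prod>p\<in>S. 1 / (1 - 1 / real (idx p) ^ s)) \<longlongrightarrow> zeta s) (finite_subsets_at_top {p. prm p})"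
proof (rule tendstoI)
  fix e :: real assume e: "e > 0"
  let ?f = "\<lambda>I. 1 / real (idx I) ^ s"
  have hs: "(?f has_sum zeta s) {I. nideal I}" unfolding zeta_def using zeta_summable[OF s] by simp
  obtain F where F: "finite F" "F \<subseteq> {I. nideal I}" "dist (sum ?f F) (zeta s) \<le> e / 2"
    using has_sum_finite_approximation[OF hs, of "e / 2"] e by auto
  define S0 where "S0 = (\<Union>I\<in>F. {p. prm p \<and> I \<subseteq> p})"
  have S0: "finite S0" "S0 \<subseteq> {p. prm p}" using F finite_prm_containing unfolding S0_def by auto
  show "\<forall>\<^sub>F S in finite_subsets_at_top {p. prm p}. dist (\<Prod>p\<in>S. 1 / (1 - 1 / real (idx p) ^ s)) (zeta s) < e"
    unfolding eventually_finite_subsets_at_top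
  proof (intro exI[of _ S0] conjI S0 allI impI)
    fix S assume S: "finite S \<and> S0 \<subseteq> S \<and> S \<subseteq> {p. prm p}"
    have eu: "(?f has_sum (\<Prod>p\<in>S. 1 / (1 - 1 / real (idx p) ^ s))) (supp_ideals S)"
      by (rule euler_partial) (use S s in auto)
    have "F \<subseteq> supp_ideals S" using F(2) S unfolding S0_def supp_ideals_def by blast
    then have "sum ?f F \<le> (\<Prod>p\<in>S. 1 / (1 - 1 / real (idx p) ^ s))"
      using eu F(1) by (intro finite_sum_le_has_sum[where A = "supp_ideals S"]) auto
    moreover have "(\<Prod>p\<in>S. 1 / (1 - 1 / real (idx p) ^ s)) \<le> zeta s"
      by (rule has_sum_mono2[OF eu hs]) (auto simp: supp_ideals_def)
    ultimately show "dist (\<Prod>p\<in>S. 1 / (1 - 1 / real (idx p) ^ s)) (zeta s) < e"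
      using F(3) e by (simp add: dist_real_def)
  qed
qed

lemma zeta_ge_1:
  assumes s: "s \<ge> 2"
  shows "zeta s \<ge> 1"
proof -
  have "sum (\<lambda>I. 1 / real (idx I) ^ s) {R} \<le> zeta s"
    unfolding zeta_def using zeta_summable[OF s] nideal_R by (intro finite_sum_le_infsum) auto
  then show ?thesis by (simp add: idx_R)
qed

end

subsection \<open>Independence modulo primes and completion\<close>

lemma det_2x2:
  fixes A :: "'b::comm_ring_1 Matrix.mat"
  assumes A: "A \<in> carrier_mat 2 2"
  shows "Determinant.det A = A $$ (0,0) * A $$ (1,1) - A $$ (0,1) * A $$ (1,0)"
proof -
  have c: "mat_delete A i 0 \<in> carrier_mat 1 1" for i
    using mat_delete_carrier[OF A] by simp
  have "{..<2::nat} = {0, 1}" by auto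
  then have "Determinant.det A = A $$ (0,0) * cofactor A 0 0 + A $$ (1,0) * cofactor A 1 0"
    using laplace_expansion_column[OF A, of 0] by simp
  then show ?thesis
    using A unfolding cofactor_def det_single[OF c] by (simp add: mat_delete_def mult.commute)
qed

text \<open>The minor of the first \<open>j\<close> rows and the columns
  \<open>\<sigma> 0, ..., \<sigma> (j - 1)\<close>. Matrices are functions on pairs of indices, so
  that boxes of matrices are sets of the form \<open>PiE\<close>.\<close>

definition minr :: "nat \<Rightarrow> (nat \<Rightarrow> nat) \<Rightarrow> (nat \<times> nat \<Rightarrow> 'b::comm_ring_1) \<Rightarrow> 'b" where
  "minr j \<sigma> a = Determinant.det (Matrix.mat j j (\<lambda>(i,l). a (i, \<sigma> l)))"

text \<open>The cofactors along a further column appended to the minor. They do not involve that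
  column, so one vector serves for every choice of it.\<close>

definition crow :: "nat \<Rightarrow> (nat \<Rightarrow> nat) \<Rightarrow> (nat \<times> nat \<Rightarrow> 'b::comm_ring_1) \<Rightarrow> nat \<Rightarrow> 'b" where
  "crow j \<sigma> a i = (-1) ^ (i + j) *
     Determinant.det (Matrix.mat j j (\<lambda>(i',l). a (if i' < i then i' else Suc i', \<sigma> l)))"

lemma crow_last: "crow j \<sigma> a j = minr j \<sigma> a"
proof -
  have "Matrix.mat j j (\<lambda>(i',l). a (if i' < j then i' else Suc i', \<sigma> l)) = Matrix.mat j j (\<lambda>(i,l). a (i, \<sigma> l))"
    by (rule eq_matI) auto
  then show ?thesis by (simp add: crow_def minr_def mult_2[symmetric])
qed

lemma minr_expand:
  "minr (Suc j) (\<sigma>(j := c)) a = (\<Sum>i<Suc j. a (i, c) * crow j \<sigma> a i)"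
proof -
  let ?A = "Matrix.mat (Suc j) (Suc j) (\<lambda>(i,l). a (i, (\<sigma>(j := c)) l))"
  have "mat_delete ?A i j = Matrix.mat j j (\<lambda>(i',l). a (if i' < i then i' else Suc i', \<sigma> l))"
    if "i < Suc j" for i
    unfolding mat_delete_def by (rule eq_matI) auto
  then have "minr (Suc j) (\<sigma>(j := c)) a = (\<Sum>i<Suc j. ?A $$ (i,j) * crow j \<sigma> a i)"
    unfolding minr_def crow_def by (subst laplace_expansion_column[of _ "Suc j" j]) (auto simp: cofactor_def)
  then show ?thesis by simp
qed

lemma minr_cong:
  "(\<And>i l. i < j \<Longrightarrow> l < j \<Longrightarrow> a (i, \<sigma> l) = b (i, \<tau> l)) \<Longrightarrow> minr j \<sigma> a = minr j \<tau> b"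
  unfolding minr_def by (intro arg_cong[where f = Determinant.det] eq_matI) auto

lemma minr_0 [simp]: "minr 0 \<sigma> a = 1"
  by (simp add: minr_def)

context integer_ring
begin

lemma det_in_R:
  assumes A: "A \<in> carrier_mat d d" and e: "\<And>i j. i < d \<Longrightarrow> j < d \<Longrightarrow> A $$ (i,j) \<in> R"
  shows "Determinant.det A \<in> R"
  unfolding det_def'[OF A]
proof (intro R_sum R_mult R_prod)
  fix p assume p: "p \<in> {p. p permutes {0..<d}}"
  show "signof p \<in> R" by (auto simp: sign_def intro: R_uminus)
  fix i assume "i \<in> {0..<d}"
  then show "A $$ (i, p i) \<in> R" using p permutes_in_image[of p "{0..<d}" i] by (intro e) auto
qed

lemma adj_in_R:
  assumes A: "A \<in> carrier_mat d d" and e: "\<And>i j. i < d \<Longrightarrow> j < d \<Longrightarrow> A $$ (i,j) \<in> R"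
    and ij: "i < d" "j < d"
  shows "adj_mat A $$ (i,j) \<in> R"
proof -
  have "Determinant.det (mat_delete A j i) \<in> R"
    by (rule det_in_R[OF mat_delete_carrier[OF A]]) (use A e in \<open>auto simp: mat_delete_def\<close>)
  then show ?thesis using A ij by (auto simp: adj_mat_def cofactor_def intro!: R_mult R_power R_uminus)
qed

text \<open>Multiplication of the relation by the adjugate isolates \<open>w i0\<close> times the
  determinant.\<close>

lemma row_relation_det:
  assumes p: "nideal p" and A: "A \<in> carrier_mat d d" "\<And>i j. i < d \<Longrightarrow> j < d \<Longrightarrow> A $$ (i,j) \<in> R"
    and rel: "\<And>l. l < d \<Longrightarrow> (\<Sum>i<d. w i * A $$ (i,l)) \<in> p" and i0: "i0 < d"
  shows "w i0 * Determinant.det A \<in> p"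
proof -
  have "(\<Sum>l<d. (\<Sum>i<d. w i * A $$ (i,l)) * adj_mat A $$ (l,i0)) \<in> p"
  proof (rule nideal_sum[OF p])
    fix l assume "l \<in> {..<d}"
    then have l: "l < d" by simp
    show "(\<Sum>i<d. w i * A $$ (i,l)) * adj_mat A $$ (l,i0) \<in> p"
      by (rule nideal_mult'[OF p adj_in_R[OF A l i0] rel[OF l]])
  qed
  also have "(\<Sum>l<d. (\<Sum>i<d. w i * A $$ (i,l)) * adj_mat A $$ (l,i0)) =
      (\<Sum>i<d. w i * (\<Sum>l<d. A $$ (i,l) * adj_mat A $$ (l,i0)))"
    by (simp only: sum_distrib_left sum_distrib_right mult.assoc) (rule sum.swap)
  also have "\<dots> = (\<Sum>i<d. w i * (A * adj_mat A) $$ (i,i0))"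
    using A(1) adj_mat(1)[OF A(1)] i0
    by (intro sum.cong refl arg_cong[where f = "\<lambda>x. _ * x"]) (simp add: scalar_prod_def atLeast0LessThan)
  also have "\<dots> = (\<Sum>i<d. if i = i0 then w i0 * Determinant.det A else 0)"
    unfolding adj_mat(2)[OF A(1)] using i0 by (intro sum.cong refl) auto
  also have "\<dots> = w i0 * Determinant.det A" using i0 by simp
  finally show ?thesis .
qed

text \<open>Linear independence of the rows over the residue field, expressed by lifts to
  \<open>R\<close> so that no quotient field is formed.\<close>

definition indep :: "'a set \<Rightarrow> nat \<Rightarrow> nat \<Rightarrow> (nat \<times> nat \<Rightarrow> 'a) \<Rightarrow> bool" where
  "indep p m j a \<longleftrightarrow> (\<forall>w. (\<forall>i<j. w i \<in> R) \<and> (\<forall>c<m. (\<Sum>i<j. w i * a (i,c)) \<in> p) \<longrightarrow> (\<forall>i<j. w i \<in> p))"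

lemma indepD:
  assumes "indep p m j a" "\<And>i. i < j \<Longrightarrow> w i \<in> R" "\<And>c. c < m \<Longrightarrow> (\<Sum>i<j. w i * a (i,c)) \<in> p" "i < j"
  shows "w i \<in> p"
  using assms unfolding indep_def by blast

lemma minr_in_R:
  assumes "\<And>i l. i < j \<Longrightarrow> l < j \<Longrightarrow> a (i, \<sigma> l) \<in> R"
  shows "minr j \<sigma> a \<in> R"
  unfolding minr_def by (rule det_in_R[of _ j]) (use assms in auto)

lemma minor_indep:
  assumes p: "prm p" and a: "\<And>i c. i < j \<Longrightarrow> c < m \<Longrightarrow> a (i,c) \<in> R"
    and \<sigma>: "\<And>l. l < j \<Longrightarrow> \<sigma> l < m" and np: "minr j \<sigma> a \<notin> p"
  shows "indep p m j a"
  unfolding indep_def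
proof (intro allI impI, elim conjE)
  fix w i assume w: "\<forall>i<j. w i \<in> R" "\<forall>c<m. (\<Sum>i<j. w i * a (i,c)) \<in> p" and i: "i < j"
  let ?A = "Matrix.mat j j (\<lambda>(i,l). a (i, \<sigma> l))"
  have "w i * Determinant.det ?A \<in> p"
    by (rule row_relation_det[OF prm_nideal[OF p]]) (use a \<sigma> w i in auto)
  then have "w i * minr j \<sigma> a \<in> p" by (simp add: minr_def)
  moreover have "minr j \<sigma> a \<in> R" by (rule minr_in_R) (use a \<sigma> in auto)
  ultimately show "w i \<in> p" using prm_mult_iff[OF p] w(1) i np by blast
qed

text \<open>Greedy enlargement starts at the empty minor, which is 1. If it never stopped, it would
  end in an \<open>n\<close> by \<open>n\<close> minor outside \<open>p\<close>, and the rows would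
  be independent. The map \<open>\<sigma>\<close> is extensional so that only finitely many pairs
  \<open>(j, \<sigma>)\<close> occur.\<close>

lemma not_indep_stuck:
  assumes p: "prm p" and a: "\<And>i c. i < n \<Longrightarrow> c < m \<Longrightarrow> a (i,c) \<in> R" and dep: "\<not> indep p m n a"
  obtains j \<sigma> where "j < n" "\<sigma> \<in> {..<j} \<rightarrow>\<^sub>E {..<m}" "minr j \<sigma> a \<notin> p"
    "\<And>c. c < m \<Longrightarrow> minr (Suc j) (\<sigma>(j := c)) a \<in> p"
proof -
  have "\<exists>j<n. \<exists>\<sigma>\<in>{..<j} \<rightarrow>\<^sub>E {..<m}. minr j \<sigma> a \<notin> p \<and> (\<forall>c<m. minr (Suc j) (\<sigma>(j := c)) a \<in> p)"
  proof (rule ccontr)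
    assume *: "\<not> ?thesis"
    have "j \<le> n \<Longrightarrow> \<exists>\<sigma>\<in>{..<j} \<rightarrow>\<^sub>E {..<m}. minr j \<sigma> a \<notin> p" for j
    proof (induction j)
      case 0
      then show ?case using prm_1[OF p] by simp
    next
      case (Suc j)
      then obtain \<sigma> where \<sigma>: "\<sigma> \<in> {..<j} \<rightarrow>\<^sub>E {..<m}" "minr j \<sigma> a \<notin> p" by auto
      have "j < n" using Suc.prems by simp
      then obtain c where c: "c < m" "minr (Suc j) (\<sigma>(j := c)) a \<notin> p" using * \<sigma> by blast
      have "\<sigma>(j := c) \<in> {..<Suc j} \<rightarrow>\<^sub>E {..<m}"
        using \<sigma>(1) c(1) unfolding lessThan_Suc by (intro PiE_fun_upd) auto
      then show ?case using c(2) by blast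
    qed
    then obtain \<sigma> where \<sigma>: "\<sigma> \<in> {..<n} \<rightarrow>\<^sub>E {..<m}" "minr n \<sigma> a \<notin> p" by auto
    have "indep p m n a" by (rule minor_indep[OF p a _ \<sigma>(2)]) (use PiE_mem[OF \<sigma>(1)] in auto)
    then show False using dep by simp
  qed
  then show ?thesis using that by blast
qed

lemma indep_cong:
  assumes p: "prm p" and d: "\<And>i c. i < n \<Longrightarrow> c < m \<Longrightarrow> a (i,c) - b (i,c) \<in> p"
  shows "indep p m n a \<longleftrightarrow> indep p m n b"
proof -
  have "(\<Sum>i<n. w i * a (i,c)) \<in> p \<longleftrightarrow> (\<Sum>i<n. w i * b (i,c)) \<in> p"
    if w: "\<forall>i<n. w i \<in> R" and c: "c < m" for w c
  proof (rule nideal_diff_mem[OF prm_nideal[OF p]])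
    have "(\<Sum>i<n. w i * (a (i,c) - b (i,c))) \<in> p"
      using w d c by (intro nideal_sum nideal_mult prm_nideal[OF p]) auto
    then show "(\<Sum>i<n. w i * a (i,c)) - (\<Sum>i<n. w i * b (i,c)) \<in> p"
      by (simp add: sum_subtractf right_diff_distrib)
  qed
  then show ?thesis unfolding indep_def by blast
qed

lemma indep_shrink:
  assumes p: "prm p" and i: "indep p m (Suc j) a"
  shows "indep p m j a"
  unfolding indep_def
proof (intro allI impI, elim conjE)
  fix w k assume w: "\<forall>i<j. w i \<in> R" "\<forall>c<m. (\<Sum>i<j. w i * a (i,c)) \<in> p" and k: "k < j"
  have "(if k < j then w k else 0) \<in> p"
  proof (rule indepD[OF i])
    fix c assume "c < m"
    have "(\<Sum>i<Suc j. (if i < j then w i else 0) * a (i,c)) = (\<Sum>i<j. w i * a (i,c))" by simp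
    then show "(\<Sum>i<Suc j. (if i < j then w i else 0) * a (i,c)) \<in> p" using w(2) \<open>c < m\<close> by simp
  qed (use w k in auto)
  then show "w k \<in> p" using k by simp
qed

section \<open>Stable range and the completion of unimodular rows\<close>

definition completes :: "nat \<Rightarrow> (nat \<Rightarrow> 'a) \<Rightarrow> bool" where
  "completes r y \<longleftrightarrow> (\<exists>G\<in>carrier_mat r r. (\<forall>i<r. \<forall>c<r. G $$ (i,c) \<in> R) \<and>
     (\<forall>c<r. G $$ (0,c) = y c) \<and> (\<exists>v\<in>R. Determinant.det G * v = 1))"

text \<open>The two by two block with rows \<open>y 0, y 1\<close> and
  \<open>- \<beta>, \<alpha>\<close> has determinant 1; the identity fills the remaining diagonal
  block.\<close>

lemma completes_pair:
  assumes r: "r \<ge> 2" and y: "\<And>c. c < r \<Longrightarrow> y c \<in> R" and ab: "\<alpha> \<in> R" "\<beta> \<in> R" "\<alpha> * y 0 + \<beta> * y 1 = 1"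
  shows "completes r y"
proof -
  define A where "A = Matrix.mat 2 2 (\<lambda>(i,c). if i = 0 then y c else if c = 0 then - \<beta> else \<alpha>)"
  define B where "B = Matrix.mat 2 (r - 2) (\<lambda>(i,c). if i = 0 then y (c + 2) else 0)"
  define G where "G = four_block_mat A B (0\<^sub>m (r - 2) 2) (1\<^sub>m (r - 2))"
  have A: "A \<in> carrier_mat 2 2" and B: "B \<in> carrier_mat 2 (r - 2)" by (auto simp: A_def B_def)
  have G: "G \<in> carrier_mat r r" using r A unfolding G_def by (metis four_block_carrier_mat le_add_diff_inverse one_carrier_mat)
  have "Determinant.det G = Determinant.det A * Determinant.det (1\<^sub>m (r - 2))"
    unfolding G_def by (rule det_four_block_mat_lower_left_zero[OF A B refl]) simp
  also have "\<dots> = 1" using det_2x2[OF A] ab(3) by (simp add: A_def algebra_simps)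
  finally have det: "Determinant.det G * 1 = 1" by simp
  have "G $$ (i,c) \<in> R" if "i < r" "c < r" for i c
    using that r y ab unfolding G_def A_def B_def by (auto intro: R_uminus)
  moreover have "G $$ (0,c) = y c" if "c < r" for c
  proof (cases "c < 2")
    case True
    then show ?thesis using that r unfolding G_def A_def B_def by auto
  next
    case False
    then obtain c' where "c = c' + 2" using le_Suc_ex[of 2 c] by (auto simp: add.commute)
    then show ?thesis using that r unfolding G_def A_def B_def by simp
  qed
  ultimately show ?thesis unfolding completes_def using G det R_1 by blast
qed

text \<open>Adding multiples of later columns to column \<open>k\<close> is undone by the unipotent
  matrix \<open>C\<close> on the right, which is lower triangular because only columns after
  \<open>k\<close> are used.\<close>

lemma completes_col:
  assumes k: "k < r" and y: "\<And>c. c < r \<Longrightarrow> y c \<in> R" and w: "\<And>i. i < r \<Longrightarrow> w i \<in> R"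
    and comp: "completes r (y(k := y k + (\<Sum>i\<in>{k<..<r}. y i * w i)))"
  shows "completes r y"
proof -
  define y' where "y' = y(k := y k + (\<Sum>i\<in>{k<..<r}. y i * w i))"
  obtain G v where G: "G \<in> carrier_mat r r" "\<And>i c. i < r \<Longrightarrow> c < r \<Longrightarrow> G $$ (i,c) \<in> R"
    "\<And>c. c < r \<Longrightarrow> G $$ (0,c) = y' c" and v: "v \<in> R" "Determinant.det G * v = 1"
    using comp unfolding completes_def y'_def by blast
  define C where "C = Matrix.mat r r (\<lambda>(i,c). if i = c then 1 else if c = k \<and> k < i then - w i else 0)"
  have C: "C \<in> carrier_mat r r" by (simp add: C_def)
  have "Determinant.det C = prod_list (diag_mat C)"
    by (rule det_lower_triangular[OF _ C]) (auto simp: C_def)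
  also have "diag_mat C = map (\<lambda>_. 1) [0..<r]" unfolding diag_mat_def by (auto simp: C_def)
  also have "prod_list (map (\<lambda>_. 1 :: 'a) [0..<r]) = 1" by (induction r) auto
  finally have dC: "Determinant.det C = 1" .
  have ent: "(G * C) $$ (i,c) = (\<Sum>l<r. G $$ (i,l) * C $$ (l,c))" if "i < r" "c < r" for i c
    using that G(1) C by (simp add: scalar_prod_def atLeast0LessThan)
  have "(G * C) $$ (i,c) \<in> R" if "i < r" "c < r" for i c
    unfolding ent[OF that] using that G(2) w by (intro R_sum R_mult) (auto simp: C_def intro: R_uminus)
  moreover have "(G * C) $$ (0,c) = y c" if c: "c < r" for c
  proof -
    have r0: "0 < r" using c by simp
    have e: "(G * C) $$ (0,c) = (\<Sum>l<r. y' l * (if l = c then 1 else if c = k \<and> k < l then - w l else 0))"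
      unfolding ent[OF r0 c] using G(3) c by (intro sum.cong refl) (simp add: C_def)
    show ?thesis
    proof (cases "c = k")
      case False
      then have "(G * C) $$ (0,c) = (\<Sum>l<r. if l = c then y' c else 0)"
        unfolding e by (intro sum.cong refl) auto
      then show ?thesis using False c by (simp add: y'_def)
    next
      case True
      have "(G * C) $$ (0,c) = (\<Sum>l<r. (if l = k then y' k else 0) + (if l \<in> {k<..<r} then - (y l * w l) else 0))"
        unfolding e using True by (intro sum.cong refl) (auto simp: y'_def)
      also have "\<dots> = y' k + (\<Sum>l<r. if l \<in> {k<..<r} then - (y l * w l) else 0)"
        unfolding sum.distrib using k by simp
      also have "(\<Sum>l<r. if l \<in> {k<..<r} then - (y l * w l) else 0) = (\<Sum>l\<in>{k<..<r}. - (y l * w l))"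
        by (rule sum.mono_neutral_cong_right) auto
      finally show ?thesis using True by (simp add: y'_def sum_negf)
    qed
  qed
  moreover have "Determinant.det (G * C) * v = 1" using v det_mult[OF G(1) C] dC by simp
  ultimately show ?thesis unfolding completes_def using v(1) mult_carrier_mat[OF G(1) C] by blast
qed

text \<open>Every multiple of 2 has even coordinates, but \<open>comb\<close> of the constant 1 has
  not. Hence \<open>R\<close> is not a field and has at least one prime.\<close>

lemma two_not_unit: "1 \<notin> {2 * r | r. r \<in> R}"
proof
  assume "1 \<in> {2 * r | r. r \<in> R}"
  then obtain r where r: "1 = 2 * r" "r \<in> R" by auto
  let ?x = "comb (\<lambda>_. 1)"
  obtain e where e: "e \<in> E" using E_nonempty by blast
  have x: "of_int 2 * (r * ?x) = ?x"
    unfolding mult.assoc[symmetric] of_int_numeral r(1)[symmetric] by simp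
  have "co ?x e = co (of_int 2 * (r * ?x)) e" unfolding x ..
  also have "\<dots> = 2 * co (r * ?x) e" using e r by (intro co_scale R_mult comb_R)
  finally have "co ?x e = 2 * co (r * ?x) e" .
  then have "1 = 2 * co (r * ?x) e" using co_comb[OF e, of "\<lambda>_. 1"] by simp
  then show False by presburger
qed

lemma ex_one_prm: "\<exists>p. prm p"
proof -
  have "(2 :: 'a) \<in> R" using R_of_int[of 2] by (simp only: of_int_numeral)
  then have "nideal {2 * r | r. r \<in> R}" by (rule nideal_principal) simp
  then obtain p where "prm p" by (rule ex_prm[OF _ two_not_unit])
  then show ?thesis by blast
qed

text \<open>A prime containing \<open>a\<close> contains \<open>s = 1 - b ^ d\<close> exactly when it does not contain \<open>b\<close>; in either case
  it does not contain \<open>b + s * c\<close>.\<close>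

lemma stable_pair:
  assumes abc: "a \<in> R" "b \<in> R" "c \<in> R" "a \<noteq> 0"
    and uv: "u \<in> R" "v \<in> R" "a * u + b * v + c = 1"
  obtains s \<alpha> \<beta> where "s \<in> R" "\<alpha> \<in> R" "\<beta> \<in> R" "\<alpha> * a + \<beta> * (b + s * c) = 1"
proof -
  let ?A = "{a * r | r. r \<in> R}"
  have A: "nideal ?A" by (rule nideal_principal[OF abc(1,4)])
  obtain i d where d: "d > 0" "b ^ i * (1 - b ^ d) \<in> ?A" using power_cong[OF A abc(2)] .
  define s where "s = 1 - b ^ d"
  have s: "s \<in> R" unfolding s_def using abc by auto
  define f where "f = b + s * c"
  have f: "f \<in> R" unfolding f_def using abc s by auto
  let ?J = "{\<alpha> * a + \<beta> * f | \<alpha> \<beta>. \<alpha> \<in> R \<and> \<beta> \<in> R}"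
  have aJ: "a \<in> ?J"
  proof -
    have "a = 1 * a + 0 * f \<and> 1 \<in> R \<and> 0 \<in> R" by simp
    then show ?thesis by blast
  qed
  have fJ: "f \<in> ?J"
  proof -
    have "f = 0 * a + 1 * f \<and> 0 \<in> R \<and> 1 \<in> R" by simp
    then show ?thesis by blast
  qed
  have J: "nideal ?J"
  proof (rule nidealI[of _ a])
    show "?J \<subseteq> R" using abc f by auto
    show "x + y \<in> ?J" if h: "x \<in> ?J" "y \<in> ?J" for x y
    proof -
      obtain a1 b1 a2 b2 where "x = a1 * a + b1 * f" "y = a2 * a + b2 * f" "a1 \<in> R" "b1 \<in> R" "a2 \<in> R" "b2 \<in> R"
        using h by blast
      then have "x + y = (a1 + a2) * a + (b1 + b2) * f \<and> a1 + a2 \<in> R \<and> b1 + b2 \<in> R"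
        by (auto simp: algebra_simps)
      then show ?thesis by blast
    qed
    show "r * x \<in> ?J" if h: "r \<in> R" "x \<in> ?J" for r x
    proof -
      obtain a1 b1 where "x = a1 * a + b1 * f" "a1 \<in> R" "b1 \<in> R" using h by blast
      then have "r * x = (r * a1) * a + (r * b1) * f \<and> r * a1 \<in> R \<and> r * b1 \<in> R"
        using h by (auto simp: algebra_simps)
      then show ?thesis by blast
    qed
  qed (use aJ abc in auto)
  have "1 \<in> ?J"
  proof (rule ccontr)
    assume "1 \<notin> ?J"
    then obtain q where q: "prm q" "?J \<subseteq> q" using ex_prm[OF J] by blast
    have Q: "nideal q" using prm_nideal[OF q(1)] .
    have aq: "a \<in> q" and fq: "f \<in> q" using aJ fJ q(2) by auto
    have Aq: "?A \<subseteq> q" using nideal_mult'[OF Q _ aq] by blast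
    have bi: "b ^ i \<in> q \<Longrightarrow> b \<in> q" for i
      using prm_mult_iff[OF q(1)] abc(2) prm_1[OF q(1)] by (induction i) auto
    show False
    proof (cases "b \<in> q")
      case True
      have "b ^ d \<in> q" using d(1) nideal_mult'[OF Q _ True, of "b ^ (d - 1)"] abc(2)
        by (metis R_power power_minus_mult mult.commute)
      then have "s \<notin> q" using nideal_add[OF Q, of s "b ^ d"] prm_1[OF q(1)] by (auto simp: s_def)
      moreover have "s * c \<in> q" using nideal_diff[OF Q fq True] by (simp add: f_def)
      ultimately have cq: "c \<in> q" using prm_mult_iff[OF q(1) s abc(3)] by blast
      have "a * u + b * v + c \<in> q"
        by (intro nideal_add[OF Q] nideal_mult'[OF Q] uv aq True cq)
      then show False using uv(3) prm_1[OF q(1)] by simp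
    next
      case False
      have "b ^ i * s \<in> q" using d(2) Aq unfolding s_def by blast
      then have "s \<in> q" using prm_mult_iff[OF q(1) R_power[OF abc(2)] s] bi False by blast
      then have "f - s * c \<in> q" using nideal_diff[OF Q fq nideal_mult'[OF Q abc(3)]] by blast
      then show False using False by (simp add: f_def)
    qed
  qed
  then obtain \<alpha> \<beta> where "1 = \<alpha> * a + \<beta> * f" "\<alpha> \<in> R" "\<beta> \<in> R" by blast
  then show ?thesis using that[OF s, of \<alpha> \<beta>] by (simp add: f_def)
qed

text \<open>The ideal generated by the entries lies in no prime, so it contains 1.\<close>

lemma unimodular_row_combination:
  fixes r :: nat
  assumes y: "\<And>c. c < r \<Longrightarrow> y c \<in> R" and um: "\<And>p. prm p \<Longrightarrow> \<exists>c<r. y c \<notin> p"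
  obtains z where "\<And>c. z c \<in> R" "(\<Sum>c<r. y c * z c) = 1"
proof -
  let ?J = "{(\<Sum>c<r. y c * z c) | z. \<forall>c. z c \<in> R}"
  have yJ: "y c \<in> ?J" if "c < r" for c
  proof -
    have "(\<Sum>i<r. y i * (if i = c then 1 else 0)) = (\<Sum>i<r. if i = c then y i else 0)"
      by (intro sum.cong) auto
    also have "\<dots> = y c" by (subst sum.delta) (use that in auto)
    finally have "y c = (\<Sum>i<r. y i * (if i = c then 1 else 0)) \<and> (\<forall>i. (if i = c then 1 else 0) \<in> R)"
      by (simp del: sum.delta)
    then show ?thesis by (intro CollectI exI[of _ "\<lambda>i. if i = c then 1 else 0"])
  qed
  \<comment> \<open>\<open>nideal\<close> asks for a nonzero element: an entry outside some prime is
    one. The existence of a prime keeps the hypothesis on the row from being vacuous.\<close>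
  obtain p where p: "prm p" using ex_one_prm by blast
  obtain c0 where c0: "c0 < r" "y c0 \<notin> p" using um[OF p] by blast
  then have y0: "y c0 \<noteq> 0" using nideal_0[OF prm_nideal[OF p]] by auto
  have J: "nideal ?J"
  proof (rule nidealI[OF _ yJ[OF c0(1)] y0])
    show "?J \<subseteq> R" using y by (auto intro!: R_sum R_mult)
    show "a + b \<in> ?J" if h: "a \<in> ?J" "b \<in> ?J" for a b
    proof -
      obtain z z' where z: "a = (\<Sum>c<r. y c * z c)" "b = (\<Sum>c<r. y c * z' c)" "\<forall>c. z c \<in> R" "\<forall>c. z' c \<in> R"
        using h by blast
      then have "a + b = (\<Sum>c<r. y c * (z c + z' c)) \<and> (\<forall>c. z c + z' c \<in> R)"
        by (auto simp: distrib_left sum.distrib)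
      then show ?thesis by (intro CollectI exI[of _ "\<lambda>c. z c + z' c"])
    qed
    show "s * a \<in> ?J" if h: "s \<in> R" "a \<in> ?J" for s a
    proof -
      obtain z where z: "a = (\<Sum>c<r. y c * z c)" "\<forall>c. z c \<in> R" using h by blast
      then have "s * a = (\<Sum>c<r. y c * (s * z c)) \<and> (\<forall>c. s * z c \<in> R)"
        using h(1) by (auto simp: sum_distrib_left mult.left_commute)
      then show ?thesis by (intro CollectI exI[of _ "\<lambda>c. s * z c"])
    qed
  qed
  have "1 \<in> ?J"
  proof (rule ccontr)
    assume "1 \<notin> ?J"
    then obtain q where "prm q" "?J \<subseteq> q" using ex_prm[OF J] by blast
    then show False using um[of q] yJ by blast
  qed
  then obtain z where "1 = (\<Sum>c<r. y c * z c)" "\<forall>c. z c \<in> R" by blast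
  then show ?thesis using that[of z] by simp
qed

text \<open>The entries after the first two are gathered into one element \<open>c\<close>; by
  \<open>stable_pair\<close> a multiple of it can be added to \<open>y 1\<close> such that the first
  two entries generate 1. Then \<open>completes_col\<close> undoes the change.\<close>

lemma unimodular_row_completes:
  assumes r: "r \<ge> 2" and y: "\<And>c. c < r \<Longrightarrow> y c \<in> R" and um: "\<And>p. prm p \<Longrightarrow> \<exists>c<r. y c \<notin> p"
  shows "completes r y"
proof -
  obtain z where z: "\<And>c. z c \<in> R" "(\<Sum>c<r. y c * z c) = 1"
    using unimodular_row_combination[OF y um] by blast
  have r0: "0 < r" and r1: "1 < r" using r by auto
  have split0: "{..<r} = insert 0 {0<..<r}" and split1: "{0<..<r} = insert 1 {1<..<r}"
    using r by auto
  have sum0: "y 0 * z 0 + (\<Sum>c\<in>{0<..<r}. y c * z c) = 1"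
    using z(2) unfolding split0 by simp
  show ?thesis
  \<comment> \<open>\<open>stable_pair\<close> asks for a nonzero first entry. For
    \<open>y 0 = 0\<close> the other entries already combine to 1, and adding this combination makes
    the first entry 1.\<close>
  proof (cases "y 0 = 0")
    case True
    let ?y = "y(0 := y 0 + (\<Sum>i\<in>{0<..<r}. y i * z i))"
    have comp: "completes r ?y"
      by (rule completes_pair[OF r, where \<alpha> = 1 and \<beta> = 0]) (use y sum0 True in auto)
    show ?thesis by (rule completes_col[OF r0 _ _ comp]) (use y z in auto)
  next
    case False
    define c where "c = (\<Sum>i\<in>{1<..<r}. y i * z i)"
    have cR: "c \<in> R" unfolding c_def using y z by (intro R_sum R_mult) auto
    have "y 0 * z 0 + y 1 * z 1 + c = 1" using sum0 unfolding split1 by (simp add: c_def add.assoc)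
    then obtain s \<alpha> \<beta> where s: "s \<in> R" "\<alpha> \<in> R" "\<beta> \<in> R" "\<alpha> * y 0 + \<beta> * (y 1 + s * c) = 1"
      using stable_pair[OF y[OF r0] y[OF r1] cR False z(1) z(1)] by blast
    let ?y = "y(1 := y 1 + (\<Sum>i\<in>{1<..<r}. y i * (s * z i)))"
    have eq: "(\<Sum>i\<in>{1<..<r}. y i * (s * z i)) = s * c"
      unfolding c_def by (simp add: sum_distrib_left mult.left_commute)
    have yR: "?y c \<in> R" if "c < r" for c
      unfolding eq using y that s(1) cR r1 by (auto intro!: R_add R_mult)
    have comp: "completes r ?y"
      by (rule completes_pair[OF r yR s(2,3)]) (use s(4) in \<open>simp_all add: eq[unfolded One_nat_def]\<close>)
    show ?thesis by (rule completes_col[OF r1 _ _ comp]) (use y s z in auto)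
  qed
qed

text \<open>The matrix is completed one row at a time: in the basis given by an invertible matrix \<open>W\<close> with the
  correct first \<open>j\<close> rows, the tail of the next row is unimodular.\<close>

lemma extend_rows:
  assumes "j < m" "\<And>i c. i < j \<Longrightarrow> c < m \<Longrightarrow> a (i,c) \<in> R" "\<And>p. prm p \<Longrightarrow> indep p m j a"
  shows "\<exists>W\<in>carrier_mat m m. (\<forall>i<m. \<forall>c<m. W $$ (i,c) \<in> R) \<and> (\<exists>u\<in>R. Determinant.det W * u = 1) \<and>
    (\<forall>i<j. \<forall>c<m. W $$ (i,c) = a (i,c))"
  using assms
proof (induction j)
  case 0
  show ?case
    by (rule bexI[of _ "1\<^sub>m m"]) (auto intro: bexI[of _ 1])
next
  case (Suc j)
  have jm: "j < m" using Suc.prems(1) by simp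
  obtain W u where W: "W \<in> carrier_mat m m" "\<And>i c. i < m \<Longrightarrow> c < m \<Longrightarrow> W $$ (i,c) \<in> R"
    and u: "u \<in> R" "Determinant.det W * u = 1" and Wa: "\<And>i c. i < j \<Longrightarrow> c < m \<Longrightarrow> W $$ (i,c) = a (i,c)"
    using Suc.IH[OF jm] Suc.prems(2,3) indep_shrink by (metis less_SucI)
  \<comment> \<open>The coordinates of the new row in the basis formed by the rows of
    \<open>W\<close>: as \<open>u\<close> inverts the determinant, \<open>u\<close> times the
    adjugate is the inverse matrix.\<close>
  define x where "x c = u * (\<Sum>l<m. a (j,l) * adj_mat W $$ (l,c))" for c
  have aR: "a (j,l) \<in> R" if "l < m" for l using Suc.prems(2)[of j l] that by simp
  have xR: "x c \<in> R" if "c < m" for c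
    unfolding x_def using adj_in_R[OF W _ that] aR u by (intro R_mult R_sum) auto
  have xW: "(\<Sum>c<m. x c * W $$ (c,l)) = a (j,l)" if l: "l < m" for l
  proof -
    have "(\<Sum>c<m. x c * W $$ (c,l)) = (\<Sum>c<m. \<Sum>k<m. u * (a (j,k) * (adj_mat W $$ (k,c) * W $$ (c,l))))"
      unfolding x_def by (simp only: sum_distrib_left sum_distrib_right mult.assoc)
    also have "\<dots> = (\<Sum>k<m. u * (a (j,k) * (\<Sum>c<m. adj_mat W $$ (k,c) * W $$ (c,l))))"
      by (subst sum.swap) (simp only: sum_distrib_left)
    also have "\<dots> = (\<Sum>k<m. u * (a (j,k) * (adj_mat W * W) $$ (k,l)))"
      using W(1) adj_mat(1)[OF W(1)] l
      by (intro sum.cong refl arg_cong[where f = "\<lambda>x. u * (_ * x)"]) (simp add: scalar_prod_def atLeast0LessThan)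
    also have "\<dots> = (\<Sum>k<m. if k = l then u * (a (j,l) * Determinant.det W) else 0)"
      unfolding adj_mat(3)[OF W(1)] using l by (intro sum.cong refl) auto
    also have "\<dots> = (Determinant.det W * u) * a (j,l)" using l by (simp add: mult_ac)
    finally show ?thesis using u by simp
  qed
  \<comment> \<open>The tail of the new row has length at least two because
    \<open>Suc j < m\<close>, as \<open>unimodular_row_completes\<close> requires.\<close>
  define r where "r = m - j"
  have r: "r \<ge> 2" "m = j + r" using Suc.prems(1) by (auto simp: r_def)
  have "\<exists>c<r. x (j + c) \<notin> p" if p: "prm p" for p
  proof (rule ccontr)
    assume "\<not> ?thesis"
    then have xp: "x (j + c) \<in> p" if "c < r" for c using that by blast
    have P: "nideal p" using prm_nideal[OF p] .
    \<comment> \<open>If the tail lay in \<open>p\<close>, the new row would be congruent to a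
      combination of the earlier ones; this is a relation with last coefficient 1.\<close>
    let ?w = "\<lambda>i. if i < j then - x i else 1"
    have "?w j \<in> p"
    proof (rule indepD[OF Suc.prems(3)[OF p], where w = ?w])
      show "?w i \<in> R" if "i < Suc j" for i using xR[of i] jm by (auto intro: R_uminus)
      show "(\<Sum>i<Suc j. ?w i * a (i,l)) \<in> p" if l: "l < m" for l
      proof -
        have "(\<Sum>i<Suc j. ?w i * a (i,l)) = a (j,l) - (\<Sum>i<j. x i * W $$ (i,l))"
          using Wa l by (simp add: sum_negf)
        also have "\<dots> = (\<Sum>c\<in>{..<m} - {..<j}. x c * W $$ (c,l))"
          unfolding xW[OF l, symmetric] using jm by (subst sum_diff) auto
        also have "\<dots> \<in> p"
        proof (rule nideal_sum[OF P])
          fix c assume c: "c \<in> {..<m} - {..<j}"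
          then have "x (j + (c - j)) \<in> p" by (intro xp) (auto simp: r_def)
          then show "x c * W $$ (c,l) \<in> p" using c W(2)[of c l] l by (intro nideal_mult'[OF P]) auto
        qed
        finally show ?thesis .
      qed
    qed simp
    then show False using prm_1[OF p] by simp
  qed
  then have "completes r (\<lambda>c. x (j + c))"
    by (intro unimodular_row_completes[OF r(1)] xR) (auto simp: r)
  then obtain G v where G: "G \<in> carrier_mat r r" "\<And>i c. i < r \<Longrightarrow> c < r \<Longrightarrow> G $$ (i,c) \<in> R"
    "\<And>c. c < r \<Longrightarrow> G $$ (0,c) = x (j + c)" and v: "v \<in> R" "Determinant.det G * v = 1"
    unfolding completes_def by blast
  \<comment> \<open>\<open>T\<close> keeps the first \<open>j\<close> rows of \<open>W\<close>. Its
    next row is all of \<open>x\<close>, with the tail as first row of \<open>G\<close>, so that row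
    \<open>j\<close> of \<open>T * W\<close> is the prescribed one.\<close>
  define X where "X = Matrix.mat r j (\<lambda>(i,c). if i = 0 then x c else 0)"
  define T where "T = four_block_mat (1\<^sub>m j) (0\<^sub>m j r) X G"
  have X: "X \<in> carrier_mat r j" by (simp add: X_def)
  have T: "T \<in> carrier_mat m m" unfolding T_def r(2) using four_block_carrier_mat[OF one_carrier_mat G(1)] .
  have "Determinant.det T = Determinant.det (1\<^sub>m j) * Determinant.det G"
    unfolding T_def by (rule det_four_block_mat_upper_right_zero[OF _ refl X G(1)]) simp
  then have dT: "Determinant.det T = Determinant.det G" by simp
  have T_R: "T $$ (i,c) \<in> R" if "i < m" "c < m" for i c
    using that G X xR unfolding T_def X_def r(2) by auto
  have T_top: "T $$ (i,c) = (if i = c then 1 else 0)" if "i < j" "c < m" for i c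
    using that G(1) unfolding T_def r(2) by auto
  have T_row: "T $$ (j,c) = x c" if "c < m" for c
    using that G X r(1) unfolding T_def X_def r(2) by auto
  have ent: "(T * W) $$ (i,c) = (\<Sum>l<m. T $$ (i,l) * W $$ (l,c))" if "i < m" "c < m" for i c
    using that T W(1) by (simp add: scalar_prod_def atLeast0LessThan)
  show ?case
  proof (intro bexI[of _ "T * W"] conjI allI impI)
    show "T * W \<in> carrier_mat m m" using T W(1) by simp
    show "(T * W) $$ (i,c) \<in> R" if "i < m" "c < m" for i c
      unfolding ent[OF that] using that W(2) T_R by (intro R_sum R_mult) auto
    have "Determinant.det (T * W) * (v * u) = (Determinant.det G * v) * (Determinant.det W * u)"
      using det_mult[OF T W(1)] dT by (simp add: mult_ac)
    then have "Determinant.det (T * W) * (v * u) = 1" using u v by simp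
    then show "\<exists>u\<in>R. Determinant.det (T * W) * u = 1" using u v by blast
    show "(T * W) $$ (i,c) = a (i,c)" if i: "i < Suc j" and c: "c < m" for i c
    proof (cases "i = j")
      case True
      have "(T * W) $$ (j,c) = (\<Sum>l<m. x l * W $$ (l,c))"
        unfolding ent[OF jm c] using T_row by (intro sum.cong) auto
      then show ?thesis using xW[OF c] True by simp
    next
      case False
      then have ij: "i < j" "i < m" using i jm by auto
      have "(T * W) $$ (i,c) = (\<Sum>l<m. if l = i then W $$ (i,c) else 0)"
        unfolding ent[OF ij(2) c] using T_top ij by (intro sum.cong) auto
      then show ?thesis using Wa[OF ij(1) c] ij by simp
    qed
  qed
qed

text \<open>A relation modulo \<open>p\<close> between the rows of \<open>M\<close> extends by zeros
  to the completed matrix, whose determinant is a unit. Conversely, the lower rows of the matrix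
  from \<open>extend_rows\<close> are a completion.\<close>

lemma rectangular_unimodular_iff:
  assumes nm: "n < m"
  shows "rectangular_unimodular R n m M \<longleftrightarrow>
    M \<in> carrier_mat n m \<and> (\<forall>i<n. \<forall>c<m. M $$ (i,c) \<in> R) \<and> (\<forall>p. prm p \<longrightarrow> indep p m n (($$) M))"
proof
  assume "rectangular_unimodular R n m M"
  then obtain N u where M: "M \<in> carrier_mat n m" "elements_mat M \<subseteq> R"
    and N: "N \<in> carrier_mat (m - n) m" "elements_mat N \<subseteq> R"
    and u: "u \<in> R" "Determinant.det (M @\<^sub>r N) * u = 1"
    unfolding rectangular_unimodular_def by blast
  have MR: "M $$ (i,c) \<in> R" if "i < n" "c < m" for i c
    using M that elements_matI[of M n m i c] by auto
  have NR: "N $$ (i,c) \<in> R" if "i < m - n" "c < m" for i c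
    using N that elements_matI[of N "m - n" m i c] by auto
  let ?W = "M @\<^sub>r N"
  have W: "?W \<in> carrier_mat m m" using carrier_append_rows[OF M(1) N(1)] nm by simp
  have We: "?W $$ (i,c) = (if i < n then M $$ (i,c) else N $$ (i - n,c))" if "i < m" "c < m" for i c
    using that M(1) N(1) nm unfolding append_rows_def by auto
  have WR: "?W $$ (i,c) \<in> R" if "i < m" "c < m" for i c
    using We[OF that] MR NR that by auto
  have "indep p m n (($$) M)" if p: "prm p" for p
    unfolding indep_def
  proof (intro allI impI, elim conjE)
    fix w i assume w: "\<forall>i<n. w i \<in> R" "\<forall>c<m. (\<Sum>i<n. w i * M $$ (i,c)) \<in> p" and i: "i < n"
    let ?w = "\<lambda>i. if i < n then w i else 0"
    have "?w i * Determinant.det ?W \<in> p"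
    proof (rule row_relation_det[OF prm_nideal[OF p] W WR])
      fix l assume l: "l < m"
      have "(\<Sum>i<m. ?w i * ?W $$ (i,l)) = (\<Sum>i<n. w i * M $$ (i,l))"
        by (rule sum.mono_neutral_cong_right) (use We l nm in auto)
      then show "(\<Sum>i<m. ?w i * ?W $$ (i,l)) \<in> p" using w(2) l by simp
    qed (use i nm in auto)
    then have "?w i * Determinant.det ?W * u \<in> p" using u(1) nideal_mult'[OF prm_nideal[OF p]] by blast
    then show "w i \<in> p" using u(2) i by (simp add: mult.assoc)
  qed
  then show "M \<in> carrier_mat n m \<and> (\<forall>i<n. \<forall>c<m. M $$ (i,c) \<in> R) \<and> (\<forall>p. prm p \<longrightarrow> indep p m n (($$) M))"
    using M MR by blast
next
  assume h: "M \<in> carrier_mat n m \<and> (\<forall>i<n. \<forall>c<m. M $$ (i,c) \<in> R) \<and> (\<forall>p. prm p \<longrightarrow> indep p m n (($$) M))"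
  then have "\<exists>W\<in>carrier_mat m m. (\<forall>i<m. \<forall>c<m. W $$ (i,c) \<in> R) \<and> (\<exists>u\<in>R. Determinant.det W * u = 1) \<and>
      (\<forall>i<n. \<forall>c<m. W $$ (i,c) = M $$ (i,c))"
    by (intro extend_rows[OF nm]) simp_all
  then obtain W u where W: "W \<in> carrier_mat m m" "\<And>i c. i < m \<Longrightarrow> c < m \<Longrightarrow> W $$ (i,c) \<in> R"
    and u: "u \<in> R" "Determinant.det W * u = 1" and Wa: "\<And>i c. i < n \<Longrightarrow> c < m \<Longrightarrow> W $$ (i,c) = M $$ (i,c)"
    by auto
  define N where "N = Matrix.mat (m - n) m (\<lambda>(i,c). W $$ (n + i, c))"
  have N: "N \<in> carrier_mat (m - n) m" by (simp add: N_def)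
  have "M @\<^sub>r N = W"
    using h N W(1) Wa nm unfolding append_rows_def by (intro eq_matI) (auto simp: N_def)
  moreover have "elements_mat N \<subseteq> R" unfolding elements_mat_def using W(2) by (auto simp: N_def)
  moreover have "elements_mat M \<subseteq> R" unfolding elements_mat_def using h by auto
  ultimately show "rectangular_unimodular R n m M"
    unfolding rectangular_unimodular_def using h N u by auto
qed

end

subsection \<open>Local densities\<close>

lemma card_le_fibres:
  assumes "finite A" "finite Y" "f ` A \<subseteq> Y" "\<And>y. y \<in> Y \<Longrightarrow> real (card {x \<in> A. f x = y}) \<le> b"
  shows "real (card A) \<le> b * real (card Y)"
proof -
  have "A = (\<Union>y\<in>Y. {x \<in> A. f x = y})" using assms(3) by auto
  then have "card A \<le> (\<Sum>y\<in>Y. card {x \<in> A. f x = y})"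
    using card_UN_le[OF assms(2), of "\<lambda>y. {x \<in> A. f x = y}"] by simp
  then have "real (card A) \<le> real (\<Sum>y\<in>Y. card {x \<in> A. f x = y})" by (simp only: of_nat_le_iff)
  also have "\<dots> = (\<Sum>y\<in>Y. real (card {x \<in> A. f x = y}))" by simp
  also have "\<dots> \<le> (\<Sum>y\<in>Y. b)" by (intro sum_mono assms(4))
  finally show ?thesis by (simp add: mult.commute)
qed

text \<open>The counting principle behind both tail estimates: the entries outside \<open>J\<close>
  are free, and within a fibre every entry at \<open>J\<close> has at most \<open>b\<close> choices.
  The sets \<open>Z\<close> may depend on a member \<open>f0\<close> of the fibre, as only nonempty
  fibres contribute.\<close>

lemma card_PiE_determined:
  fixes X :: "'b set" and A :: "('i \<Rightarrow> 'b) set"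
  assumes fin: "finite I" "finite X" and J: "J \<subseteq> I" and A: "A \<subseteq> I \<rightarrow>\<^sub>E X" and b: "b \<ge> 0"
    and Z: "\<And>f0. f0 \<in> A \<Longrightarrow> \<exists>Z. (\<forall>x\<in>J. finite (Z x) \<and> real (card (Z x)) \<le> b) \<and>
      (\<forall>f\<in>A. (\<forall>y\<in>I - J. f y = f0 y) \<longrightarrow> (\<forall>x\<in>J. f x \<in> Z x))"
  shows "real (card A) \<le> b ^ card J * real (card X) ^ (card I - card J)"
proof -
  have finJ: "finite J" using J fin(1) finite_subset by blast
  have finA: "finite A" using A fin by (meson finite_PiE finite_subset)
  have "real (card A) \<le> b ^ card J * real (card ((I - J) \<rightarrow>\<^sub>E X))"
  proof (rule card_le_fibres[OF finA])
    show "finite ((I - J) \<rightarrow>\<^sub>E X)" using fin by (intro finite_PiE) auto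
    show "(\<lambda>f. restrict f (I - J)) ` A \<subseteq> (I - J) \<rightarrow>\<^sub>E X" using A by fastforce
    fix g assume g: "g \<in> (I - J) \<rightarrow>\<^sub>E X"
    let ?F = "{f \<in> A. restrict f (I - J) = g}"
    show "real (card ?F) \<le> b ^ card J"
    proof (cases "?F = {}")
      case True
      then show ?thesis using b by (simp only: card.empty) simp
    next
      case False
      then obtain f0 where f0: "f0 \<in> A" "restrict f0 (I - J) = g" by blast
      obtain Z where Z1: "\<And>x. x \<in> J \<Longrightarrow> finite (Z x) \<and> real (card (Z x)) \<le> b"
        and Z2: "\<And>f x. f \<in> A \<Longrightarrow> \<forall>y\<in>I - J. f y = f0 y \<Longrightarrow> x \<in> J \<Longrightarrow> f x \<in> Z x"
        using Z[OF f0(1)] by blast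
      have agree: "\<forall>y\<in>I - J. f y = f0 y" if "f \<in> ?F" for f
        using that f0(2) by (metis (mono_tags, lifting) mem_Collect_eq restrict_apply')
      have "card ?F \<le> card (PiE J Z)"
      proof (rule card_inj_on_le[where f = "\<lambda>f. restrict f J"])
        show "inj_on (\<lambda>f. restrict f J) ?F"
        proof (rule inj_onI)
          fix f h assume fh: "f \<in> ?F" "h \<in> ?F" "restrict f J = restrict h J"
          have fh': "f \<in> I \<rightarrow>\<^sub>E X" "h \<in> I \<rightarrow>\<^sub>E X" using fh A by auto
          show "f = h"
          proof (rule PiE_ext[OF fh'])
            fix x assume x: "x \<in> I"
            show "f x = h x"
            proof (cases "x \<in> J")
              case True
              then show ?thesis using fun_cong[OF fh(3), of x] by simp
            next
              case False
              then show ?thesis using agree[OF fh(1)] agree[OF fh(2)] x by simp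
            qed
          qed
        qed
        show "(\<lambda>f. restrict f J) ` ?F \<subseteq> PiE J Z"
        proof (rule image_subsetI)
          fix f assume f: "f \<in> ?F"
          then have "f x \<in> Z x" if "x \<in> J" for x using Z2[OF _ agree[OF f] that] by blast
          then show "restrict f J \<in> PiE J Z" by auto
        qed
        show "finite (PiE J Z)" using finJ Z1 by (intro finite_PiE) auto
      qed
      then have "real (card ?F) \<le> real (card (PiE J Z))" by simp
      also have "\<dots> = (\<Prod>x\<in>J. real (card (Z x)))" using finJ by (simp add: card_PiE)
      also have "\<dots> \<le> (\<Prod>x\<in>J. b)" using Z1 by (intro prod_mono) auto
      finally show ?thesis by simp
    qed
  qed
  also have "card ((I - J) \<rightarrow>\<^sub>E X) = card X ^ (card I - card J)"
    using fin J finJ by (simp add: card_PiE card_Diff_subset)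
  finally show ?thesis by simp
qed

abbreviation (input) cells :: "nat \<Rightarrow> nat \<Rightarrow> (nat \<times> nat) set" where
  "cells n m \<equiv> {..<n} \<times> {..<m}"

context integer_ring
begin

definition dep_rows :: "'a set \<Rightarrow> nat \<Rightarrow> nat \<Rightarrow> (nat \<times> nat \<Rightarrow> 'a) \<Rightarrow> (nat \<Rightarrow> 'a) set" where
  "dep_rows p m j a = {r \<in> {..<m} \<rightarrow>\<^sub>E reps p. \<exists>w\<in>{..<j} \<rightarrow>\<^sub>E reps p. \<forall>c<m. r c - (\<Sum>i<j. w i * a (i,c)) \<in> p}"

text \<open>Coefficient vectors modulo \<open>p\<close> correspond to the rows in the span;
  injectivity is the independence of the rows.\<close>

lemma card_dep_rows:
  assumes p: "prm p" and a: "\<And>i c. i < j \<Longrightarrow> c < m \<Longrightarrow> a (i,c) \<in> R" and ind: "indep p m j a"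
  shows "card (dep_rows p m j a) = idx p ^ j"
proof -
  have P: "nideal p" using prm_nideal[OF p] .
  define rp where "rp x = (SOME t. t \<in> reps p \<and> x - t \<in> p)" for x
  have rp: "rp x \<in> reps p" "x - rp x \<in> p" if "x \<in> R" for x
    using someI_ex[of "\<lambda>t. t \<in> reps p \<and> x - t \<in> p"] reps_ex[OF P that] unfolding rp_def by blast+
  have wR: "w i \<in> R" if "w \<in> {..<j} \<rightarrow>\<^sub>E reps p" "i < j" for w i
    using PiE_mem[OF that(1), of i] that(2) reps_R[OF P] by auto
  have sR: "(\<Sum>i<j. w i * a (i,c)) \<in> R" if "w \<in> {..<j} \<rightarrow>\<^sub>E reps p" "c < m" for w c
    using wR[OF that(1)] a that(2) by (intro R_sum R_mult) auto
  define F where "F w = (\<lambda>c\<in>{..<m}. rp (\<Sum>i<j. w i * a (i,c)))" for w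
  have "bij_betw F ({..<j} \<rightarrow>\<^sub>E reps p) (dep_rows p m j a)"
    unfolding bij_betw_def
  proof
    show "inj_on F ({..<j} \<rightarrow>\<^sub>E reps p)"
    proof (rule inj_onI)
      fix w v assume wv: "w \<in> {..<j} \<rightarrow>\<^sub>E reps p" "v \<in> {..<j} \<rightarrow>\<^sub>E reps p" "F w = F v"
      have "(\<Sum>i<j. (w i - v i) * a (i,c)) \<in> p" if c: "c < m" for c
      proof -
        let ?x = "\<Sum>i<j. w i * a (i,c)" and ?y = "\<Sum>i<j. v i * a (i,c)"
        have "rp ?x = rp ?y" using fun_cong[OF wv(3), of c] c by (simp add: F_def)
        moreover have "(?x - rp ?x) - (?y - rp ?y) \<in> p"
          by (intro nideal_diff[OF P] rp sR wv c)
        ultimately have "?x - ?y \<in> p" by simp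
        then show ?thesis by (simp add: left_diff_distrib sum_subtractf)
      qed
      then have d: "w i - v i \<in> p" if "i < j" for i
        using indepD[OF ind, of "\<lambda>i. w i - v i" i] wR[OF wv(1)] wR[OF wv(2)] that by auto
      show "w = v"
      proof (rule PiE_ext[OF wv(1,2)])
        fix i assume i: "i \<in> {..<j}"
        then show "w i = v i"
          using reps_unique[OF P PiE_mem[OF wv(1) i] PiE_mem[OF wv(2) i]] d by simp
      qed
    qed
    show "F ` ({..<j} \<rightarrow>\<^sub>E reps p) = dep_rows p m j a"
    proof (intro equalityI subsetI)
      fix r assume "r \<in> F ` ({..<j} \<rightarrow>\<^sub>E reps p)"
      then obtain w where w: "w \<in> {..<j} \<rightarrow>\<^sub>E reps p" "r = F w" by blast
      have "r \<in> {..<m} \<rightarrow>\<^sub>E reps p" using rp(1)[OF sR[OF w(1)]] w(2) by (auto simp: F_def)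
      moreover have "\<forall>c<m. r c - (\<Sum>i<j. w i * a (i,c)) \<in> p"
        using nideal_diff_sym[OF P rp(2)[OF sR[OF w(1)]]] w(2) by (simp add: F_def)
      ultimately show "r \<in> dep_rows p m j a" using w(1) unfolding dep_rows_def by blast
    next
      fix r assume "r \<in> dep_rows p m j a"
      then obtain w where r: "r \<in> {..<m} \<rightarrow>\<^sub>E reps p" and w: "w \<in> {..<j} \<rightarrow>\<^sub>E reps p"
        "\<forall>c<m. r c - (\<Sum>i<j. w i * a (i,c)) \<in> p" unfolding dep_rows_def by blast
      have "F w \<in> {..<m} \<rightarrow>\<^sub>E reps p" using rp(1)[OF sR[OF w(1)]] by (auto simp: F_def)
      then have "r = F w"
      proof (rule PiE_ext[OF r])
        fix c assume c: "c \<in> {..<m}"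
        let ?x = "\<Sum>i<j. w i * a (i,c)"
        have "(r c - ?x) + (?x - rp ?x) \<in> p"
          using w(2) c rp(2)[OF sR[OF w(1)]] by (intro nideal_add[OF P]) auto
        then have "r c - rp ?x \<in> p" by simp
        then have "r c = rp ?x" using reps_unique[OF P PiE_mem[OF r c] rp(1)[OF sR[OF w(1)]]] c by simp
        then show "r c = F w c" using c by (simp add: F_def)
      qed
      then show "r \<in> F ` ({..<j} \<rightarrow>\<^sub>E reps p)" using w(1) by blast
    qed
  qed
  from bij_betw_same_card[OF this] show ?thesis using card_reps[OF P] by (simp add: card_PiE)
qed

definition add_row :: "nat \<Rightarrow> (nat \<times> nat \<Rightarrow> 'a) \<Rightarrow> (nat \<Rightarrow> 'a) \<Rightarrow> nat \<times> nat \<Rightarrow> 'a" where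
  "add_row j a r = (\<lambda>x. if fst x = j then r (snd x) else a x)"

lemma indep_add_row:
  assumes p: "prm p" and a: "\<And>i c. i < j \<Longrightarrow> c < m \<Longrightarrow> a (i,c) \<in> R" and r: "r \<in> {..<m} \<rightarrow>\<^sub>E reps p"
  shows "indep p m (Suc j) (add_row j a r) \<longleftrightarrow> indep p m j a \<and> r \<notin> dep_rows p m j a"
proof -
  have P: "nideal p" using prm_nideal[OF p] .
  have rR: "r c \<in> R" if "c < m" for c using PiE_mem[OF r, of c] that reps_R[OF P] by auto
  have sum_add: "(\<Sum>i<Suc j. w i * add_row j a r (i,c)) = (\<Sum>i<j. w i * a (i,c)) + w j * r c" for w c
    by (simp add: add_row_def)
  show ?thesis
  proof
    assume i: "indep p m (Suc j) (add_row j a r)"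
    have "indep p m j (add_row j a r)" by (rule indep_shrink[OF p i])
    then have "indep p m j a"
      using indep_cong[OF p, of j m "add_row j a r" a] nideal_0[OF P] by (simp add: add_row_def)
    moreover have "r \<notin> dep_rows p m j a"
    proof
      assume "r \<in> dep_rows p m j a"
      then obtain w where w: "w \<in> {..<j} \<rightarrow>\<^sub>E reps p" "\<forall>c<m. r c - (\<Sum>i<j. w i * a (i,c)) \<in> p"
        unfolding dep_rows_def by blast
      let ?w = "\<lambda>i. if i < j then - w i else 1"
      have "?w j \<in> p"
      proof (rule indepD[OF i, where w = ?w])
        show "?w i \<in> R" if "i < Suc j" for i
          using PiE_mem[OF w(1), of i] reps_R[OF P] by (auto intro!: R_uminus)
        show "(\<Sum>i<Suc j. ?w i * add_row j a r (i,c)) \<in> p" if "c < m" for c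
          unfolding sum_add using w(2) that by (simp add: sum_negf)
      qed simp
      then show False using prm_1[OF p] by simp
    qed
    ultimately show "indep p m j a \<and> r \<notin> dep_rows p m j a" by simp
  next
    assume h: "indep p m j a \<and> r \<notin> dep_rows p m j a"
    show "indep p m (Suc j) (add_row j a r)"
      unfolding indep_def
    proof (intro allI impI, elim conjE)
      fix w i assume w: "\<forall>i<Suc j. w i \<in> R" "\<forall>c<m. (\<Sum>i<Suc j. w i * add_row j a r (i,c)) \<in> p"
        and i: "i < Suc j"
      \<comment> \<open>An invertible last coefficient could be divided out and would exhibit
        \<open>r\<close> in the span of the earlier rows.\<close>
      have wj: "w j \<in> p"
      proof (rule ccontr)
        assume "w j \<notin> p"
        then obtain b where b: "b \<in> R" "w j * b - 1 \<in> p" using prm_inv[OF p] w(1) by blast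
        have "\<exists>t\<in>reps p. - (b * w i) - t \<in> p" if "i < j" for i
          using that w(1) b by (intro reps_ex[OF P]) (auto intro!: R_uminus)
        then have "\<forall>i. \<exists>t. i < j \<longrightarrow> t \<in> reps p \<and> - (b * w i) - t \<in> p" by blast
        from choice[OF this] obtain t where t: "\<And>i. i < j \<Longrightarrow> t i \<in> reps p \<and> - (b * w i) - t i \<in> p"
          by blast
        have "r c - (\<Sum>i<j. restrict t {..<j} i * a (i,c)) \<in> p" if c: "c < m" for c
        proof -
          have 1: "b * ((\<Sum>i<j. w i * a (i,c)) + w j * r c) \<in> p"
            using w(2) c b(1) unfolding sum_add by (intro nideal_mult[OF P]) auto
          have 2: "(\<Sum>i<j. (- (b * w i) - t i) * a (i,c)) \<in> p"
            using t a c by (intro nideal_sum[OF P] nideal_mult'[OF P]) auto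
          have 3: "(w j * b - 1) * r c \<in> p" using nideal_mult'[OF P rR[OF c] b(2)] .
          have "b * ((\<Sum>i<j. w i * a (i,c)) + w j * r c) + (\<Sum>i<j. (- (b * w i) - t i) * a (i,c)) - (w j * b - 1) * r c
              = r c - (\<Sum>i<j. t i * a (i,c))"
            by (simp add: algebra_simps sum_subtractf sum_negf sum_distrib_left)
          then show ?thesis using nideal_diff[OF P nideal_add[OF P 1 2] 3] by simp
        qed
        moreover have "restrict t {..<j} \<in> {..<j} \<rightarrow>\<^sub>E reps p" using t by auto
        ultimately have "r \<in> dep_rows p m j a" using r unfolding dep_rows_def by blast
        then show False using h by simp
      qed
      show "w i \<in> p"
      proof (cases "i = j")
        case False
        have "(\<Sum>i<j. w i * a (i,c)) \<in> p" if c: "c < m" for c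
        proof -
          have "((\<Sum>i<j. w i * a (i,c)) + w j * r c) - w j * r c \<in> p"
            using w(2) c nideal_mult'[OF P rR[OF c] wj] unfolding sum_add by (intro nideal_diff[OF P]) auto
          then show ?thesis by simp
        qed
        then show ?thesis using indepD[of p m j a w i] h w(1) False i by auto
      qed (use wj in simp)
    qed
  qed
qed

text \<open>The familiar count of matrices of full rank over a field with \<open>idx p\<close>
  elements: each new row has to avoid the span of the rows before it.\<close>

lemma card_indep:
  assumes p: "prm p" and nm: "n \<le> m"
  shows "card {a \<in> cells n m \<rightarrow>\<^sub>E reps p. indep p m n a} = (\<Prod>i<n. idx p ^ m - idx p ^ i)"
  using nm
proof (induction n)
  case 0
  have "{a \<in> cells 0 m \<rightarrow>\<^sub>E reps p. indep p m 0 a} = {\<lambda>x. undefined}" by (auto simp: indep_def)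
  then show ?case by simp
next
  case (Suc j)
  have P: "nideal p" using prm_nideal[OF p] .
  let ?X = "\<lambda>j. {a \<in> cells j m \<rightarrow>\<^sub>E reps p. indep p m j a}"
  let ?Y = "\<lambda>a. ({..<m} \<rightarrow>\<^sub>E reps p) - dep_rows p m j a"
  have aR: "a (i,c) \<in> R" if "a \<in> cells j m \<rightarrow>\<^sub>E reps p" "i < j" "c < m" for a i c
    using PiE_mem[OF that(1), of "(i,c)"] that(2,3) reps_R[OF P] by auto
  have "bij_betw (\<lambda>(a,r). add_row j a r) (SIGMA a:?X j. ?Y a) (?X (Suc j))"
  proof (rule bij_betwI[where g = "\<lambda>f. (restrict f (cells j m), \<lambda>c\<in>{..<m}. f (j,c))"])
    show "(\<lambda>(a,r). add_row j a r) \<in> (SIGMA a:?X j. ?Y a) \<rightarrow> ?X (Suc j)"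
    proof
      fix z assume z: "z \<in> (SIGMA a:?X j. ?Y a)"
      obtain a r where ar: "z = (a,r)" by (cases z)
      have a: "a \<in> cells j m \<rightarrow>\<^sub>E reps p" "indep p m j a"
        and r: "r \<in> {..<m} \<rightarrow>\<^sub>E reps p" "r \<notin> dep_rows p m j a" using z ar by auto
      have "add_row j a r \<in> cells (Suc j) m \<rightarrow>\<^sub>E reps p"
      proof (rule PiE_I)
        show "add_row j a r x \<in> reps p" if "x \<in> cells (Suc j) m" for x
          using that PiE_mem[OF a(1), of x] PiE_mem[OF r(1), of "snd x"] by (auto simp: add_row_def less_Suc_eq)
        show "add_row j a r x = undefined" if "x \<notin> cells (Suc j) m" for x
          using that PiE_arb[OF a(1), of x] PiE_arb[OF r(1), of "snd x"]
          by (cases x) (auto simp: add_row_def)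
      qed
      moreover have "indep p m (Suc j) (add_row j a r)"
        using indep_add_row[where j = j and a = a and m = m and r = r, OF p] aR[OF a(1)] a(2) r by blast
      ultimately show "(case z of (a,r) \<Rightarrow> add_row j a r) \<in> ?X (Suc j)" using ar by simp
    qed
    show "(\<lambda>f. (restrict f (cells j m), \<lambda>c\<in>{..<m}. f (j,c))) \<in> ?X (Suc j) \<rightarrow> (SIGMA a:?X j. ?Y a)"
    proof
      fix f assume f: "f \<in> ?X (Suc j)"
      let ?a = "restrict f (cells j m)" and ?r = "\<lambda>c\<in>{..<m}. f (j,c)"
      have fm: "f x \<in> reps p" if "x \<in> cells (Suc j) m" for x using f PiE_mem[OF _ that] by blast
      have a: "?a \<in> cells j m \<rightarrow>\<^sub>E reps p" using fm by auto
      have r: "?r \<in> {..<m} \<rightarrow>\<^sub>E reps p" using fm by auto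
      have "indep p m (Suc j) (add_row j ?a ?r)"
        using f indep_cong[OF p, of "Suc j" m f "add_row j ?a ?r"] nideal_0[OF P]
        by (simp add: add_row_def less_Suc_eq)
      then show "(?a, ?r) \<in> (SIGMA a:?X j. ?Y a)"
        using indep_add_row[where j = j and a = ?a and m = m and r = ?r, OF p] aR[OF a] a r by blast
    qed
    show "(\<lambda>f. (restrict f (cells j m), \<lambda>c\<in>{..<m}. f (j,c))) ((\<lambda>(a,r). add_row j a r) z) = z"
      if z: "z \<in> (SIGMA a:?X j. ?Y a)" for z
    proof -
      obtain a r where ar: "z = (a,r)" by (cases z)
      have a: "a \<in> cells j m \<rightarrow>\<^sub>E reps p" and r: "r \<in> {..<m} \<rightarrow>\<^sub>E reps p" using z ar by auto
      have "restrict (add_row j a r) (cells j m) x = a x" for x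
        using PiE_arb[OF a, of x] by (cases "x \<in> cells j m") (auto simp: add_row_def)
      moreover have "(\<lambda>c\<in>{..<m}. add_row j a r (j,c)) c = r c" for c
        using PiE_arb[OF r, of c] by (cases "c < m") (auto simp: add_row_def)
      ultimately show ?thesis using ar by auto
    qed
    show "(\<lambda>(a,r). add_row j a r) ((\<lambda>f. (restrict f (cells j m), \<lambda>c\<in>{..<m}. f (j,c))) f) = f"
      if f: "f \<in> ?X (Suc j)" for f
    proof
      fix x
      have "f \<in> cells (Suc j) m \<rightarrow>\<^sub>E reps p" using f by simp
      from PiE_arb[OF this, of x]
      show "(\<lambda>(a,r). add_row j a r) ((\<lambda>f. (restrict f (cells j m), \<lambda>c\<in>{..<m}. f (j,c))) f) x = f x"
        by (cases x) (auto simp: add_row_def restrict_def less_Suc_eq)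
    qed
  qed
  then have "card (?X (Suc j)) = card (SIGMA a:?X j. ?Y a)" by (simp add: bij_betw_same_card)
  also have fX: "finite (?X j)" using finite_reps[OF P] by (simp add: finite_PiE)
  have fY: "finite ({..<m} \<rightarrow>\<^sub>E reps p)" using finite_reps[OF P] by (simp add: finite_PiE)
  have "card (SIGMA a:?X j. ?Y a) = (\<Sum>a\<in>?X j. card (?Y a))"
    using fX fY by (intro card_SigmaI) auto
  also have "\<dots> = (\<Sum>a\<in>?X j. idx p ^ m - idx p ^ j)"
  proof (rule sum.cong[OF refl])
    fix a assume a: "a \<in> ?X j"
    have sub: "dep_rows p m j a \<subseteq> {..<m} \<rightarrow>\<^sub>E reps p" by (auto simp: dep_rows_def)
    have "card (?Y a) = card ({..<m} \<rightarrow>\<^sub>E reps p) - card (dep_rows p m j a)"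
      by (rule card_Diff_subset[OF finite_subset[OF sub fY] sub])
    also have "card (dep_rows p m j a) = idx p ^ j"
      using a by (intro card_dep_rows[where j = j and a = a and m = m, OF p]) (auto intro: aR)
    finally show "card (?Y a) = idx p ^ m - idx p ^ j" using card_reps[OF P] by (simp add: card_PiE)
  qed
  also have "\<dots> = (\<Prod>i<Suc j. idx p ^ m - idx p ^ i)" using Suc by simp
  finally show ?case .
qed

lemma box_R: "x \<in> box B \<Longrightarrow> x \<in> R" by (simp add: rbox_def)

lemma box_entry_R: "a \<in> cells n m \<rightarrow>\<^sub>E box B \<Longrightarrow> i < n \<Longrightarrow> c < m \<Longrightarrow> a (i,c) \<in> R"
  using PiE_mem[of a "cells n m" "\<lambda>_. box B" "(i,c)"] box_R by auto

text \<open>The condition modulo the primes of \<open>S\<close> selects residue matrices. For each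
  of them the entries range independently over residue classes, so the count is a product of the
  counts in \<open>rclass_density\<close>.\<close>

lemma indep_density:
  assumes S: "finite S" "\<And>p. p \<in> S \<Longrightarrow> prm p" and nm: "n \<le> m"
  shows "(\<lambda>B. real (card {a \<in> cells n m \<rightarrow>\<^sub>E box B. \<forall>p\<in>S. indep p m n a}) / real (card (box B)) ^ (n * m))
    \<longlonglongrightarrow> (\<Prod>p\<in>S. \<Prod>i<n. 1 - 1 / real (idx p) ^ (m - i))"
proof -
  let ?I = "cells n m"
  define Th where "Th = PiE S (\<lambda>p. {g \<in> ?I \<rightarrow>\<^sub>E reps p. indep p m n g})"
  define Cl where "Cl \<tau> B = PiE ?I (\<lambda>x. rclass S (\<lambda>p. \<tau> p x) \<inter> box B)" for \<tau> B
  have fin: "finite Th" unfolding Th_def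
    using S finite_reps prm_nideal by (intro finite_PiE) (auto intro!: finite_PiE finite_Collect_conjI)
  have ThR: "\<tau> p x \<in> reps p" "\<tau> p x \<in> R" if "\<tau> \<in> Th" "p \<in> S" "x \<in> ?I" for \<tau> p x
  proof -
    have "\<tau> p \<in> ?I \<rightarrow>\<^sub>E reps p" using PiE_mem[OF that(1)[unfolded Th_def] that(2)] by simp
    then show "\<tau> p x \<in> reps p" using PiE_mem that(3) by blast
    then show "\<tau> p x \<in> R" using reps_R[OF prm_nideal[OF S(2)[OF that(2)]]] by blast
  qed
  have decomp: "{a \<in> ?I \<rightarrow>\<^sub>E box B. \<forall>p\<in>S. indep p m n a} = (\<Union>\<tau>\<in>Th. Cl \<tau> B)" for B
  proof (intro equalityI subsetI)
    fix a assume a: "a \<in> {a \<in> ?I \<rightarrow>\<^sub>E box B. \<forall>p\<in>S. indep p m n a}"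
    then have aB: "a \<in> ?I \<rightarrow>\<^sub>E box B" by simp
    have "\<exists>t. t \<in> reps p \<and> a x - t \<in> p" if "p \<in> S" "x \<in> ?I" for p x
      using reps_ex[OF prm_nideal[OF S(2)[OF that(1)]] box_R[OF PiE_mem[OF aB that(2)]]] by blast
    then have "\<forall>p x. \<exists>t. p \<in> S \<longrightarrow> x \<in> ?I \<longrightarrow> t \<in> reps p \<and> a x - t \<in> p" by blast
    then obtain t where t: "\<And>p x. p \<in> S \<Longrightarrow> x \<in> ?I \<Longrightarrow> t p x \<in> reps p \<and> a x - t p x \<in> p" by metis
    define \<tau> where "\<tau> = (\<lambda>p\<in>S. \<lambda>x\<in>?I. t p x)"
    have "indep p m n (\<lambda>x\<in>?I. t p x)" if "p \<in> S" for p
      using indep_cong[OF S(2)[OF that], of n m a "\<lambda>x\<in>?I. t p x"] t[OF that] a that by auto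
    then have "\<tau> \<in> Th" using t unfolding Th_def \<tau>_def by auto
    moreover have "a \<in> Cl \<tau> B" unfolding Cl_def
    proof (rule PiE_I)
      fix x assume x: "x \<in> ?I"
      then show "a x \<in> rclass S (\<lambda>p. \<tau> p x) \<inter> box B"
        using PiE_mem[OF aB x] t box_R by (auto simp: rclass_def \<tau>_def)
    qed (use PiE_arb[OF aB] in auto)
    ultimately show "a \<in> (\<Union>\<tau>\<in>Th. Cl \<tau> B)" by blast
  next
    fix a assume "a \<in> (\<Union>\<tau>\<in>Th. Cl \<tau> B)"
    then obtain \<tau> where \<tau>: "\<tau> \<in> Th" "a \<in> Cl \<tau> B" by blast
    have ax: "a x \<in> rclass S (\<lambda>p. \<tau> p x)" "a x \<in> box B" if "x \<in> ?I" for x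
      using PiE_mem[OF \<tau>(2)[unfolded Cl_def] that] by auto
    have "indep p m n a" if p: "p \<in> S" for p
    proof -
      have "indep p m n (\<tau> p)" using PiE_mem[OF \<tau>(1)[unfolded Th_def] p] by simp
      moreover have "a (i,c) - \<tau> p (i,c) \<in> p" if "i < n" "c < m" for i c
        using ax(1)[of "(i,c)"] that p by (simp add: rclass_def)
      ultimately show ?thesis using indep_cong[OF S(2)[OF p], of n m a "\<tau> p"] by blast
    qed
    moreover have "a \<in> ?I \<rightarrow>\<^sub>E box B"
    proof (rule PiE_I)
      show "a x = undefined" if "x \<notin> ?I" for x using PiE_arb[OF \<tau>(2)[unfolded Cl_def] that] .
    qed (use ax in auto)
    ultimately show "a \<in> {a \<in> ?I \<rightarrow>\<^sub>E box B. \<forall>p\<in>S. indep p m n a}" by blast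
  qed
  have card_eq: "real (card {a \<in> ?I \<rightarrow>\<^sub>E box B. \<forall>p\<in>S. indep p m n a}) / real (card (box B)) ^ (n * m) =
      (\<Sum>\<tau>\<in>Th. \<Prod>x\<in>?I. real (card (rclass S (\<lambda>p. \<tau> p x) \<inter> box B)) / real (card (box B)))" for B
  proof -
    have "card (\<Union>\<tau>\<in>Th. Cl \<tau> B) = (\<Sum>\<tau>\<in>Th. card (Cl \<tau> B))"
    proof (rule card_UN_disjoint[OF fin])
      show "\<forall>\<tau>\<in>Th. finite (Cl \<tau> B)" unfolding Cl_def using finite_rbox by (auto intro!: finite_PiE)
      show "\<forall>\<tau>\<in>Th. \<forall>\<sigma>\<in>Th. \<tau> \<noteq> \<sigma> \<longrightarrow> Cl \<tau> B \<inter> Cl \<sigma> B = {}"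
      proof (intro ballI impI, rule ccontr)
        fix \<tau> \<sigma> assume h: "\<tau> \<in> Th" "\<sigma> \<in> Th" "\<tau> \<noteq> \<sigma>" "Cl \<tau> B \<inter> Cl \<sigma> B \<noteq> {}"
        then obtain a where a: "a \<in> Cl \<tau> B" "a \<in> Cl \<sigma> B" by blast
        have "\<tau> p = \<sigma> p" if p: "p \<in> S" for p
        proof (rule PiE_ext[where k = ?I])
          show "\<tau> p \<in> ?I \<rightarrow>\<^sub>E reps p" "\<sigma> p \<in> ?I \<rightarrow>\<^sub>E reps p"
            using PiE_mem[OF h(1)[unfolded Th_def] p] PiE_mem[OF h(2)[unfolded Th_def] p] by auto
          fix x assume x: "x \<in> ?I"
          have P: "nideal p" using prm_nideal[OF S(2)[OF p]] .
          have "a x - \<sigma> p x \<in> p" "a x - \<tau> p x \<in> p"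
            using PiE_mem[OF a(1)[unfolded Cl_def] x] PiE_mem[OF a(2)[unfolded Cl_def] x] p
            unfolding rclass_def by blast+
          from nideal_diff[OF P this] have "\<tau> p x - \<sigma> p x \<in> p" by simp
          then show "\<tau> p x = \<sigma> p x"
            using reps_unique[OF P ThR(1)[OF h(1) p x] ThR(1)[OF h(2) p x]] by simp
        qed
        then have "\<tau> = \<sigma>" using h(1,2) unfolding Th_def by (rule PiE_ext[rotated 2])
        then show False using h by simp
      qed
    qed
    then have "real (card {a \<in> ?I \<rightarrow>\<^sub>E box B. \<forall>p\<in>S. indep p m n a}) / real (card (box B)) ^ (n * m) =
      (\<Sum>\<tau>\<in>Th. real (card (Cl \<tau> B)) / real (card (box B)) ^ (n * m))"
      unfolding decomp by (simp add: sum_divide_distrib)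
    also have "\<dots> = (\<Sum>\<tau>\<in>Th. \<Prod>x\<in>?I. real (card (rclass S (\<lambda>p. \<tau> p x) \<inter> box B)) / real (card (box B)))"
      by (intro sum.cong refl) (simp add: Cl_def card_PiE prod_dividef)
    finally show ?thesis .
  qed
  define N where "N = (\<Prod>p\<in>S. real (idx p))"
  have "(\<lambda>B. \<Sum>\<tau>\<in>Th. \<Prod>x\<in>?I. real (card (rclass S (\<lambda>p. \<tau> p x) \<inter> box B)) / real (card (box B)))
      \<longlonglongrightarrow> (\<Sum>\<tau>\<in>Th. \<Prod>x\<in>?I. 1 / N)"
    unfolding N_def by (intro tendsto_sum tendsto_prod rclass_density S ThR(2))
  also have "(\<Sum>\<tau>\<in>Th. \<Prod>x\<in>?I. 1 / N) = real (card Th) / N ^ (n * m)"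
    by (simp add: power_divide)
  also have "card Th = (\<Prod>p\<in>S. \<Prod>i<n. idx p ^ m - idx p ^ i)"
    unfolding Th_def using S card_indep[OF _ nm] by (simp add: card_PiE)
  also have "real (\<Prod>p\<in>S. \<Prod>i<n. idx p ^ m - idx p ^ i) / N ^ (n * m) =
      (\<Prod>p\<in>S. \<Prod>i<n. 1 - 1 / real (idx p) ^ (m - i))"
  proof -
    have "real (\<Prod>p\<in>S. \<Prod>i<n. idx p ^ m - idx p ^ i) / N ^ (n * m) =
        (\<Prod>p\<in>S. (\<Prod>i<n. real (idx p ^ m - idx p ^ i)) / real (idx p) ^ (n * m))"
      unfolding N_def by (simp add: prod_power_distrib prod_dividef)
    also have "\<dots> = (\<Prod>p\<in>S. \<Prod>i<n. 1 - 1 / real (idx p) ^ (m - i))"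
    proof (rule prod.cong[OF refl])
      fix p assume "p \<in> S"
      then have q: "idx p \<ge> 2" using idx_ge_2 S(2) by blast
      have "(\<Prod>i<n. real (idx p ^ m - idx p ^ i)) / real (idx p) ^ (n * m) =
          (\<Prod>i<n. real (idx p ^ m - idx p ^ i) / real (idx p) ^ m)"
        by (simp add: prod_dividef power_mult[symmetric] mult.commute)
      also have "\<dots> = (\<Prod>i<n. 1 - 1 / real (idx p) ^ (m - i))"
      proof (rule prod.cong[OF refl])
        fix i assume i: "i \<in> {..<n}"
        have le: "idx p ^ i \<le> idx p ^ m" using q i nm by (intro power_increasing) auto
        have "real (idx p) ^ m = real (idx p) ^ (m - i) * real (idx p) ^ i"
          using i nm by (simp add: power_add[symmetric])
        then show "real (idx p ^ m - idx p ^ i) / real (idx p) ^ m = 1 - 1 / real (idx p) ^ (m - i)"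
          using le q by (simp add: of_nat_diff field_simps)
      qed
      finally show "(\<Prod>i<n. real (idx p ^ m - idx p ^ i)) / real (idx p) ^ (n * m) =
          (\<Prod>i<n. 1 - 1 / real (idx p) ^ (m - i))" .
    qed
    finally show ?thesis .
  qed
  finally show ?thesis unfolding card_eq .
qed

end

subsection \<open>Degenerate matrices\<close>

lemma crow_cong:
  "(\<And>i l. i \<le> j \<Longrightarrow> l < j \<Longrightarrow> a (i, \<sigma> l) = b (i, \<sigma> l)) \<Longrightarrow> crow j \<sigma> a i = crow j \<sigma> b i"
  unfolding crow_def
  by (intro arg_cong[where f = "\<lambda>x. _ * Determinant.det x"] eq_matI) auto

lemma minr_split:
  "minr (Suc j) (\<sigma>(j := c)) a = (\<Sum>i<j. a (i, c) * crow j \<sigma> a i) + a (j, c) * minr j \<sigma> a"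
  by (simp add: minr_expand crow_last)

text \<open>Expansion along the appended column is linear in its last entry, whose cofactor is the
  smaller minor. Since \<open>c\<close> is not among the columns of \<open>\<sigma>\<close>, that
  minor is unaffected by the change.\<close>

lemma minr_diff:
  assumes \<sigma>: "c \<notin> \<sigma> ` {..<j}"
    and ab: "\<And>i l. i \<le> j \<Longrightarrow> l \<in> insert c (\<sigma> ` {..<j}) \<Longrightarrow> (i, l) \<noteq> (j, c) \<Longrightarrow> a (i, l) = b (i, l)"
  shows "minr j \<sigma> a = minr j \<sigma> b"
    and "minr (Suc j) (\<sigma>(j := c)) a - minr (Suc j) (\<sigma>(j := c)) b = (a (j, c) - b (j, c)) * minr j \<sigma> b"
proof -
  have \<sigma>c: "a (i, \<sigma> l) = b (i, \<sigma> l)" if "i \<le> j" "l < j" for i l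
    using ab[of i "\<sigma> l"] that \<sigma> by auto
  show m: "minr j \<sigma> a = minr j \<sigma> b" by (rule minr_cong) (use \<sigma>c in auto)
  have "(\<Sum>i<j. a (i, c) * crow j \<sigma> a i) = (\<Sum>i<j. b (i, c) * crow j \<sigma> b i)"
    using ab[of _ c] crow_cong[where a = a and b = b and \<sigma> = \<sigma> and j = j] \<sigma>c by (intro sum.cong) auto
  then show "minr (Suc j) (\<sigma>(j := c)) a - minr (Suc j) (\<sigma>(j := c)) b = (a (j, c) - b (j, c)) * minr j \<sigma> b"
    unfolding minr_split m by (simp add: algebra_simps)
qed

text \<open>\<open>\<sigma>\<close> occupies at most \<open>j\<close> columns; the bound
  \<open>j + 2 \<le> m\<close> will come from \<open>j < n < m\<close>.\<close>

lemma free_columns: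
  fixes \<sigma> :: "nat \<Rightarrow> nat"
  assumes "j + 2 \<le> m"
  obtains c c' where "c < m" "c' < m" "c \<noteq> c'" "c \<notin> \<sigma> ` {..<j}" "c' \<notin> \<sigma> ` {..<j}"
proof -
  let ?F = "{..<m} - \<sigma> ` {..<j}"
  have "card (\<sigma> ` {..<j}) \<le> j" using card_image_le[of "{..<j}" \<sigma>] by simp
  then have "2 \<le> card ?F" using diff_card_le_card_Diff[of "\<sigma> ` {..<j}" "{..<m}"] assms by simp
  then obtain T where T: "T \<subseteq> ?F" "card T = 2" using obtain_subset_with_card_n by metis
  then obtain c c' where "T = {c, c'}" "c \<noteq> c'" unfolding card_2_iff by blast
  then show ?thesis using that T(1) by blast
qed

context integer_ring
begin

text \<open>Sorts the exceptional matrices by the place where the greedy enlargement modulo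
  \<open>p\<close> stops.\<close>

definition Stuck :: "nat \<Rightarrow> nat \<Rightarrow> 'a set \<Rightarrow> nat \<Rightarrow> (nat \<Rightarrow> nat) \<Rightarrow> nat \<Rightarrow> (nat \<times> nat \<Rightarrow> 'a) set" where
  "Stuck n m p j \<sigma> B = {a \<in> cells n m \<rightarrow>\<^sub>E box B. minr j \<sigma> a \<notin> p \<and>
     (\<forall>c<m. minr (Suc j) (\<sigma>(j := c)) a \<in> p)}"

text \<open>Both enlarged minors lie in \<open>p\<close>, and their difference is the difference of
  the two entries times a minor that is invertible modulo \<open>p\<close>.\<close>

lemma Stuck_entry:
  assumes p: "prm p" and jn: "j < n" and \<sigma>: "\<And>l. l < j \<Longrightarrow> \<sigma> l < m"
    and c: "c < m" "c \<notin> \<sigma> ` {..<j}" and a: "a \<in> Stuck n m p j \<sigma> B" and b: "b \<in> Stuck n m p j \<sigma> B"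
    and ab: "\<And>i l. i \<le> j \<Longrightarrow> l \<in> insert c (\<sigma> ` {..<j}) \<Longrightarrow> (i, l) \<noteq> (j, c) \<Longrightarrow> a (i, l) = b (i, l)"
  shows "a (j, c) - b (j, c) \<in> p"
proof -
  have aB: "a \<in> cells n m \<rightarrow>\<^sub>E box B" "b \<in> cells n m \<rightarrow>\<^sub>E box B" using a b by (auto simp: Stuck_def)
  have eq: "minr (Suc j) (\<sigma>(j := c)) a - minr (Suc j) (\<sigma>(j := c)) b = (a (j, c) - b (j, c)) * minr j \<sigma> b"
    by (rule minr_diff(2)[OF c(2)]) (rule ab)
  have "(a (j, c) - b (j, c)) * minr j \<sigma> b \<in> p"
    unfolding eq[symmetric]
    using a b c(1) by (intro nideal_diff[OF prm_nideal[OF p]]) (auto simp: Stuck_def)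
  moreover have "minr j \<sigma> b \<in> R"
    by (rule minr_in_R, rule box_entry_R[OF aB(2)]) (use jn \<sigma> in auto)
  moreover have "a (j, c) - b (j, c) \<in> R" using box_entry_R[OF aB(1) jn c(1)] box_entry_R[OF aB(2) jn c(1)] by auto
  moreover have "minr j \<sigma> b \<notin> p" using b by (simp add: Stuck_def)
  ultimately show ?thesis using prm_mult_iff[OF p] by blast
qed

text \<open>The entries of row \<open>j\<close> in two free columns each lie in one residue class
  once the others are fixed, and neither enters the condition on the other. This gains two factors
  \<open>1 / idx p\<close>, as convergence over all primes requires.\<close>

lemma card_Stuck_small:
  assumes p: "prm p" "pchar p \<le> 2 * B" and jn: "j < n" and nm: "n < m" and \<sigma>: "\<sigma> \<in> {..<j} \<rightarrow>\<^sub>E {..<m}"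
  shows "real (card (Stuck n m p j \<sigma> B)) \<le>
    (3 ^ card E * real (card (box B)) / real (idx p)) ^ 2 * real (card (box B)) ^ (n * m - 2)"
proof -
  have \<sigma>m: "\<sigma> l < m" if "l < j" for l using PiE_mem[OF \<sigma>, of l] that by simp
  obtain c c' where c: "c < m" "c' < m" "c \<noteq> c'" "c \<notin> \<sigma> ` {..<j}" "c' \<notin> \<sigma> ` {..<j}"
    using free_columns[of j m \<sigma>] jn nm by auto
  let ?J = "{(j, c), (j, c')}"
  have "real (card (Stuck n m p j \<sigma> B)) \<le> (3 ^ card E * real (card (box B)) / real (idx p)) ^ card ?J *
      real (card (box B)) ^ (card (cells n m) - card ?J)"
  proof (rule card_PiE_determined)
    show "?J \<subseteq> cells n m" using jn c by auto
    show "Stuck n m p j \<sigma> B \<subseteq> cells n m \<rightarrow>\<^sub>E box B" by (auto simp: Stuck_def)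
    fix f0 assume f0: "f0 \<in> Stuck n m p j \<sigma> B"
    then have f0B: "f0 \<in> cells n m \<rightarrow>\<^sub>E box B" by (simp add: Stuck_def)
    show "\<exists>Z. (\<forall>x\<in>?J. finite (Z x) \<and> real (card (Z x)) \<le> 3 ^ card E * real (card (box B)) / real (idx p)) \<and>
      (\<forall>f\<in>Stuck n m p j \<sigma> B. (\<forall>y\<in>cells n m - ?J. f y = f0 y) \<longrightarrow> (\<forall>x\<in>?J. f x \<in> Z x))"
    proof (intro exI[of _ "\<lambda>x. {y \<in> box B. y - f0 x \<in> p}"] conjI ballI impI)
      fix x assume x: "x \<in> ?J"
      show "finite {y \<in> box B. y - f0 x \<in> p}" using finite_rbox by simp
      have "f0 x \<in> R" using x box_entry_R[OF f0B jn] c by auto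
      then show "real (card {y \<in> box B. y - f0 x \<in> p}) \<le> 3 ^ card E * real (card (box B)) / real (idx p)"
        by (rule card_class_small[OF p(1) _ p(2)])
    next
      fix f x assume f: "f \<in> Stuck n m p j \<sigma> B" and ag: "\<forall>y\<in>cells n m - ?J. f y = f0 y" and x: "x \<in> ?J"
      have fB: "f \<in> cells n m \<rightarrow>\<^sub>E box B" using f by (simp add: Stuck_def)
      have ag': "f (i, l) = f0 (i, l)" if "i \<le> j" "l < m" "(i, l) \<notin> ?J" for i l
        using ag that jn by auto
      have "f (j, c) - f0 (j, c) \<in> p"
        by (rule Stuck_entry[OF p(1) jn \<sigma>m c(1,4) f f0], assumption, rule ag') (use c \<sigma>m in auto)
      moreover have "f (j, c') - f0 (j, c') \<in> p"
        by (rule Stuck_entry[OF p(1) jn \<sigma>m c(2,5) f f0], assumption, rule ag') (use c \<sigma>m in auto)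
      moreover have "f x \<in> box B" using PiE_mem[OF fB, of x] x jn c by auto
      ultimately show "f x \<in> {y \<in> box B. y - f0 x \<in> p}" using x by auto
    qed
  qed (use finite_rbox in auto)
  moreover have "card ?J = 2" using c by simp
  ultimately show ?thesis by simp
qed

section \<open>Large primes dividing a minor\<close>

lemma size_box: "x \<in> box B \<Longrightarrow> size x \<le> int (card E) * int B"
proof -
  assume x: "x \<in> box B"
  have "size x \<le> (\<Sum>e\<in>E. int B)" unfolding size_def
    using x by (intro sum_mono) (force simp: rbox_def)
  then show ?thesis by simp
qed

text \<open>The exponent \<open>d + 1\<close> leaves room for the empty product, whose size is that
  of 1.\<close>

lemma size_prod:
  assumes "\<And>i. i < d \<Longrightarrow> f i \<in> R" "\<And>i. i < d \<Longrightarrow> size (f i) \<le> s"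
  shows "size (\<Prod>i<d. f i) \<le> mconst ^ (d + 1) * s ^ d"
  using assms
proof (induction d)
  case 0
  then show ?case using size_1_le by simp
next
  case (Suc d)
  have s0: "0 \<le> s" using Suc.prems(2)[of d] size_nonneg[of "f d"] by simp
  have "size ((\<Prod>i<d. f i) * f d) \<le> mconst * size (\<Prod>i<d. f i) * size (f d)"
    using Suc.prems(1) by (intro size_mult R_prod) auto
  also have "\<dots> \<le> mconst * (mconst ^ (d + 1) * s ^ d) * s"
    using Suc mconst_ge_1 size_nonneg s0 by (intro mult_mono mult_left_mono) auto
  finally show ?case by (simp add: mult_ac)
qed

lemma size_minr:
  assumes e: "\<And>i l. i < d \<Longrightarrow> l < d \<Longrightarrow> a (i, \<tau> l) \<in> box B"
  shows "size (minr d \<tau> a) \<le> fact d * (mconst ^ (d + 1) * (int (card E) * int B) ^ d)"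
proof -
  let ?A = "Matrix.mat d d (\<lambda>(i,l). a (i, \<tau> l))"
  let ?P = "{p. p permutes {0..<d}}"
  have m: "minr d \<tau> a = (\<Sum>p\<in>?P. signof p * (\<Prod>i<d. a (i, \<tau> (p i))))"
    unfolding minr_def
    by (subst det_def'[of _ d], simp, intro sum.cong refl arg_cong[where f = "\<lambda>x. _ * x"])
       (auto simp: atLeast0LessThan intro!: prod.cong dest: permutes_in_image)
  have pd: "p i < d" if "p \<in> ?P" "i < d" for p i
    using that permutes_in_image[of p "{0..<d}" i] by auto
  have pR: "(\<Prod>i<d. a (i, \<tau> (p i))) \<in> R" if "p \<in> ?P" for p
    using e[OF _ pd[OF that]] box_R by (intro R_prod) auto
  have sg: "signof p = (1 :: 'a) \<or> signof p = (- 1 :: 'a)" for p :: "nat \<Rightarrow> nat" by (simp add: sign_def)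
  have "size (minr d \<tau> a) \<le> (\<Sum>p\<in>?P. size (signof p * (\<Prod>i<d. a (i, \<tau> (p i)))))"
    unfolding m
  proof (rule size_sum)
    fix p assume "p \<in> ?P"
    then show "signof p * (\<Prod>i<d. a (i, \<tau> (p i))) \<in> R"
      using pR[of p] R_uminus[OF pR[of p]] sg[of p] by (metis mult_1 mult_minus1)
  qed
  also have "\<dots> \<le> (\<Sum>p\<in>?P. mconst ^ (d + 1) * (int (card E) * int B) ^ d)"
  proof (rule sum_mono)
    fix p assume p: "p \<in> ?P"
    have "size (signof p * (\<Prod>i<d. a (i, \<tau> (p i)))) = size (\<Prod>i<d. a (i, \<tau> (p i)))"
      using sg[of p] size_uminus[OF pR[OF p]] by auto
    also have "\<dots> \<le> mconst ^ (d + 1) * (int (card E) * int B) ^ d"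
      using e[OF _ pd[OF p]] box_R size_box by (intro size_prod) auto
    finally show "size (signof p * (\<Prod>i<d. a (i, \<tau> (p i)))) \<le> mconst ^ (d + 1) * (int (card E) * int B) ^ d" .
  qed
  also have "\<dots> = fact d * (mconst ^ (d + 1) * (int (card E) * int B) ^ d)"
    by (simp add: card_permutations)
  finally show ?thesis .
qed

text \<open>A nonzero minor divides an integer that is polynomially bounded in \<open>B\<close>, so it has boundedly many prime
  divisors of characteristic above \<open>2 B\<close>.\<close>

lemma few_large_primes:
  obtains K :: nat where "\<And>B d \<tau> a. B > 0 \<Longrightarrow> d \<le> n \<Longrightarrow> (\<And>i l. i < d \<Longrightarrow> l < d \<Longrightarrow> a (i, \<tau> l) \<in> box B) \<Longrightarrow>
    minr d \<tau> a \<noteq> 0 \<Longrightarrow>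
    finite {p. prm p \<and> minr d \<tau> a \<in> p \<and> 2 * B < pchar p} \<and> card {p. prm p \<and> minr d \<tau> a \<in> p \<and> 2 * B < pchar p} \<le> K"
proof -
  let ?k = "card E"
  \<comment> \<open>The powers are collected so that a minor has size at most
    \<open>C1 * (2 * B) ^ n\<close> and divides an integer of absolute value at most
    \<open>C2 * (2 * B) ^ (n * ?k)\<close>. At most \<open>n * ?k + C2\<close> rational primes above
    \<open>2 * B\<close> divide that integer, and at most \<open>?k\<close> primes lie over
    each.\<close>
  define C1 :: int where "C1 = fact n * mconst ^ (n + 1) * int ?k ^ n"
  define C2 :: nat where "C2 = nat (fact ?k * (mconst ^ 2 * C1) ^ ?k)"
  define K where "K = ?k * (n * ?k + C2)"
  have C1: "C1 \<ge> 0" unfolding C1_def using mconst_ge_1 by simp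
  have "finite {p. prm p \<and> minr d \<tau> a \<in> p \<and> 2 * B < pchar p} \<and> card {p. prm p \<and> minr d \<tau> a \<in> p \<and> 2 * B < pchar p} \<le> K"
    if B: "B > 0" and d: "d \<le> n" and e: "\<And>i l. i < d \<Longrightarrow> l < d \<Longrightarrow> a (i, \<tau> l) \<in> box B"
      and nz: "minr d \<tau> a \<noteq> 0" for B d \<tau> and a :: "nat \<times> nat \<Rightarrow> 'a"
  proof -
    let ?D = "minr d \<tau> a"
    let ?PP = "{p. prm p \<and> ?D \<in> p \<and> 2 * B < pchar p}"
    have DR: "?D \<in> R" using e box_R by (intro minr_in_R) auto
    have "size ?D \<le> fact d * (mconst ^ (d + 1) * (int ?k * int B) ^ d)" by (rule size_minr) (rule e)
    also have "\<dots> \<le> fact n * (mconst ^ (n + 1) * (int ?k * int (2 * B)) ^ n)"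
    proof (intro mult_mono)
      show "(fact d :: int) \<le> fact n" using d by (rule fact_mono)
      show "mconst ^ (d + 1) \<le> mconst ^ (n + 1)" using d mconst_ge_1 by (intro power_increasing) auto
      have "1 * 1 \<le> int ?k * int (2 * B)" using card_E_pos B by (intro mult_mono) auto
      then have "(int ?k * int (2 * B)) ^ d \<le> (int ?k * int (2 * B)) ^ n" using d by (intro power_increasing) auto
      moreover have "(int ?k * int B) ^ d \<le> (int ?k * int (2 * B)) ^ d" by (intro power_mono mult_left_mono) auto
      ultimately show "(int ?k * int B) ^ d \<le> (int ?k * int (2 * B)) ^ n" by linarith
    qed (use mconst_ge_1 in auto)
    also have "\<dots> = C1 * int (2 * B) ^ n" unfolding C1_def by (simp only: power_mult_distrib mult_ac)
    finally have sD: "size ?D \<le> C1 * int (2 * B) ^ n" .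
    obtain N r where N: "N \<noteq> 0" "\<bar>N\<bar> \<le> fact ?k * (mconst ^ 2 * size ?D) ^ ?k" "r \<in> R" "of_int N = ?D * r"
      using divides_int[OF DR nz] by metis
    note N(2)
    also have "fact ?k * (mconst ^ 2 * size ?D) ^ ?k \<le> fact ?k * (mconst ^ 2 * (C1 * int (2 * B) ^ n)) ^ ?k"
      using sD size_nonneg mconst_ge_1 by (intro mult_left_mono power_mono) auto
    also have "\<dots> = fact ?k * (mconst ^ 2 * C1) ^ ?k * int (2 * B) ^ (n * ?k)"
      by (simp only: power_mult_distrib power_mult mult_ac)
    also have "\<dots> = int C2 * int (2 * B) ^ (n * ?k)" unfolding C2_def using C1 mconst_ge_1 by simp
    finally have NC: "\<bar>N\<bar> \<le> int (C2 * (2 * B) ^ (n * ?k))" by simp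
    have fin: "finite ?PP"
    proof (rule finite_subset[OF _ finite_prm_containing[OF nideal_principal[OF DR nz]]])
      show "?PP \<subseteq> {p. prm p \<and> {?D * r |r. r \<in> R} \<subseteq> p}"
        using nideal_mult'[OF prm_nideal] by blast
    qed
    let ?L = "pchar ` ?PP"
    have dvd: "l dvd nat \<bar>N\<bar>" if "l \<in> ?L" for l
    proof -
      obtain p where p: "prm p" "?D \<in> p" "l = pchar p" using \<open>l \<in> ?L\<close> by blast
      have "of_int N \<in> p" unfolding N(4) using nideal_mult'[OF prm_nideal[OF p(1)] N(3) p(2)] .
      then have "int l dvd N" using pchar_dvd_int[OF p(1)] p(3) by simp
      then show ?thesis by (metis abs_dvd_iff dvd_abs_iff int_dvd_int_iff nat_0_le abs_ge_zero)
    qed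
    have "\<Prod>F dvd nat \<bar>N\<bar>" if "finite F" "F \<subseteq> ?L" for F
      using that
    proof (induction F)
      case (insert l F)
      have pr: "prime q" if "q \<in> ?L" for q using that pchar_prime by blast
      have "coprime l (\<Prod>F)"
      proof (rule prod_coprime_right)
        fix q assume q: "q \<in> F"
        then have "l \<noteq> q" "q \<in> ?L" "l \<in> ?L" using insert.hyps(2) insert.prems by auto
        then show "coprime l q" by (intro primes_coprime pr)
      qed
      have sub: "l \<in> ?L" "F \<subseteq> ?L" using insert.prems by (simp_all only: insert_subset)
      from insert.IH[OF sub(2)] dvd[OF sub(1)] \<open>coprime l (\<Prod>F)\<close>
      have "l * \<Prod>F dvd nat \<bar>N\<bar>" by (intro divides_mult)
      moreover have "\<Prod>(insert l F) = l * \<Prod>F" using insert.hyps by (rule prod.insert)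
      ultimately show ?case by (simp only:)
    qed simp
    then have "\<Prod>?L dvd nat \<bar>N\<bar>" using fin by blast
    then have "\<Prod>?L \<le> nat \<bar>N\<bar>" using N(1) by (intro dvd_imp_le) auto
    moreover have "(2 * B) ^ card ?L \<le> \<Prod>?L"
    proof -
      have "(\<Prod>l\<in>?L. 2 * B) \<le> (\<Prod>l\<in>?L. l)" by (rule prod_mono) auto
      then show ?thesis by (simp only: prod_constant)
    qed
    ultimately have le: "(2 * B) ^ card ?L \<le> C2 * (2 * B) ^ (n * ?k)" using NC by linarith
    \<comment> \<open>The inequality \<open>C2 < 2 ^ C2 \<le> (2 * B) ^ C2\<close> takes the place
      of a logarithm and keeps the bound independent of \<open>B\<close>.\<close>
    have "card ?L \<le> n * ?k + C2"
    proof (rule ccontr)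
      assume "\<not> ?thesis"
      then have "(2 * B) ^ (n * ?k + C2) \<le> (2 * B) ^ card ?L" using B by (intro power_increasing) auto
      also note le
      finally have "(2 * B) ^ C2 * (2 * B) ^ (n * ?k) \<le> C2 * (2 * B) ^ (n * ?k)"
        by (simp only: power_add mult.commute)
      moreover have "(2 * B) ^ (n * ?k) > 0" using B by (intro zero_less_power) simp
      ultimately have "(2 * B) ^ C2 \<le> C2" by (simp only: mult_le_cancel2)
      moreover have "2 ^ C2 \<le> (2 * B) ^ C2" using B by (intro power_mono) auto
      moreover have "C2 < 2 ^ C2" by (rule less_exp)
      ultimately show False by linarith
    qed
    have "card ?PP \<le> (\<Sum>l\<in>?L. card {p. prm p \<and> pchar p = l})"
    proof -
      have "?PP \<subseteq> (\<Union>l\<in>?L. {p. prm p \<and> pchar p = l})" by auto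
      then have "card ?PP \<le> card (\<Union>l\<in>?L. {p. prm p \<and> pchar p = l})"
        using fin primes_over(1) by (intro card_mono) auto
      also have "\<dots> \<le> (\<Sum>l\<in>?L. card {p. prm p \<and> pchar p = l})" using fin by (intro card_UN_le) auto
      finally show ?thesis .
    qed
    also have "\<dots> \<le> (\<Sum>l\<in>?L. ?k)" using primes_over(2) by (intro sum_mono) auto
    also have "\<dots> = card ?L * ?k" by simp
    also have "\<dots> \<le> K" unfolding K_def using \<open>card ?L \<le> n * ?k + C2\<close> by (metis mult.commute mult_le_mono2)
    finally show ?thesis using fin by simp
  qed
  then show ?thesis using that by blast
qed

text \<open>The minor enlarged by a free column \<open>c\<close> decides. If it vanishes, the entry
  at \<open>(j, c)\<close> is determined. If not, it does not involve the second free column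
  \<open>c'\<close> and lies in few large primes, so few values remain for the entry at
  \<open>(j, c')\<close>. Either way a factor \<open>2 * B\<close> is saved.\<close>

lemma card_Stuck_large:
  assumes nm: "n < m"
  obtains K :: nat where "\<And>B j \<sigma>. B > 0 \<Longrightarrow> j < n \<Longrightarrow> \<sigma> \<in> {..<j} \<rightarrow>\<^sub>E {..<m} \<Longrightarrow>
    real (card (\<Union>p\<in>{p. prm p \<and> 2 * B < pchar p}. Stuck n m p j \<sigma> B)) \<le>
      real K * real (card (box B)) ^ (n * m) / real (2 * B)"
proof -
  obtain K where K: "\<And>B d \<tau> a. B > 0 \<Longrightarrow> d \<le> n \<Longrightarrow> (\<And>i l. i < d \<Longrightarrow> l < d \<Longrightarrow> a (i, \<tau> l) \<in> box B) \<Longrightarrow>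
    minr d \<tau> a \<noteq> 0 \<Longrightarrow>
    finite {p. prm p \<and> minr d \<tau> a \<in> p \<and> 2 * B < pchar p} \<and> card {p. prm p \<and> minr d \<tau> a \<in> p \<and> 2 * B < pchar p} \<le> K"
    by (rule few_large_primes[of n]) blast
  have "real (card (\<Union>p\<in>{p. prm p \<and> 2 * B < pchar p}. Stuck n m p j \<sigma> B)) \<le>
      real (K + 1) * real (card (box B)) ^ (n * m) / real (2 * B)"
    if B: "B > 0" and jn: "j < n" and \<sigma>: "\<sigma> \<in> {..<j} \<rightarrow>\<^sub>E {..<m}" for B j \<sigma>
  proof -
    let ?I = "cells n m" and ?X = "real (card (box B))" and ?k = "card E"
    have \<sigma>m: "\<sigma> l < m" if "l < j" for l using PiE_mem[OF \<sigma>, of l] that by simp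
    obtain c c' where c: "c < m" "c' < m" "c \<noteq> c'" "c \<notin> \<sigma> ` {..<j}" "c' \<notin> \<sigma> ` {..<j}"
      using free_columns[of j m \<sigma>] jn nm by auto
    let ?D = "minr (Suc j) (\<sigma>(j := c))"
    define A where "A = (\<Union>p\<in>{p. prm p \<and> 2 * B < pchar p}. Stuck n m p j \<sigma> B)"
    define A1 where "A1 = {a \<in> A. ?D a = 0}"
    define A2 where "A2 = {a \<in> A. ?D a \<noteq> 0}"
    have AB: "A \<subseteq> ?I \<rightarrow>\<^sub>E box B" by (auto simp: A_def Stuck_def)
    have finI: "finite ?I" by simp
    have finX: "finite (box B)" by (rule finite_rbox)
    have X: "?X = real (2 * B) ^ ?k" by (simp add: card_box)
    have nz: "minr j \<sigma> a \<noteq> 0" if "a \<in> A" for a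
    proof
      assume "minr j \<sigma> a = 0"
      then show False using that nideal_0[OF prm_nideal] by (auto simp: A_def Stuck_def)
    qed
    \<comment> \<open>For \<open>?D = 0\<close> the difference formula is an equation in the field
      and not just a congruence, and \<open>minr j \<sigma>\<close> is nonzero: one value
      remains.\<close>
    have A1: "real (card A1) \<le> 1 ^ card {(j, c)} * ?X ^ (card ?I - card {(j, c)})"
    proof (rule card_PiE_determined[OF finI finX])
      show "A1 \<subseteq> ?I \<rightarrow>\<^sub>E box B" using AB by (auto simp: A1_def)
      fix f0 assume f0: "f0 \<in> A1"
      show "\<exists>Z. (\<forall>x\<in>{(j, c)}. finite (Z x) \<and> real (card (Z x)) \<le> 1) \<and>
        (\<forall>f\<in>A1. (\<forall>y\<in>?I - {(j, c)}. f y = f0 y) \<longrightarrow> (\<forall>x\<in>{(j, c)}. f x \<in> Z x))"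
      proof (intro exI[of _ "\<lambda>x. {f0 x}"] conjI ballI impI)
        fix f x assume f: "f \<in> A1" and ag: "\<forall>y\<in>?I - {(j, c)}. f y = f0 y" and x: "x \<in> {(j, c)}"
        have "?D f - ?D f0 = (f (j, c) - f0 (j, c)) * minr j \<sigma> f0"
          by (rule minr_diff(2)[OF c(4)]) (use ag c \<sigma>m jn in auto)
        then have "(f (j, c) - f0 (j, c)) * minr j \<sigma> f0 = 0" using f f0 by (simp add: A1_def)
        then show "f x \<in> {f0 x}" using nz[of f0] f0 x by (auto simp: A1_def)
      qed auto
    qed (use c jn in auto)
    have A2: "real (card A2) \<le> (real K * real ((2 * B) ^ (?k - 1))) ^ card {(j, c')} * ?X ^ (card ?I - card {(j, c')})"
    proof (rule card_PiE_determined[OF finI finX])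
      show "A2 \<subseteq> ?I \<rightarrow>\<^sub>E box B" using AB by (auto simp: A2_def)
      fix f0 assume f0: "f0 \<in> A2"
      then have f0B: "f0 \<in> ?I \<rightarrow>\<^sub>E box B" and D0: "?D f0 \<noteq> 0" using AB by (auto simp: A2_def)
      define PP where "PP = {p. prm p \<and> ?D f0 \<in> p \<and> 2 * B < pchar p}"
      have "f0 (i, (\<sigma>(j := c)) l) \<in> box B" if "i < Suc j" "l < Suc j" for i l
        using PiE_mem[OF f0B, of "(i, (\<sigma>(j := c)) l)"] that \<sigma>m c jn by (auto simp: less_Suc_eq)
      then have PP: "finite PP" "card PP \<le> K" using K[OF B _ _ D0] jn unfolding PP_def by auto
      let ?F = "\<lambda>p. {f \<in> Stuck n m p j \<sigma> B. \<forall>y\<in>?I - {(j, c')}. f y = f0 y}"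
      \<comment> \<open>The residue class of the entry depends on the prime, and \<open>f0\<close>
        may be stuck at one prime of \<open>PP\<close> only. Hence each prime gets its own reference
        matrix \<open>h p\<close> in the fibre, if there is one.\<close>
      define h where "h p = (SOME f. f \<in> ?F p)" for p
      define V where "V p = (if ?F p = {} then {} else {y \<in> box B. y - h p (j, c') \<in> p})" for p
      have hF: "h p \<in> ?F p" if "?F p \<noteq> {}" for p
        unfolding h_def using that by (metis (mono_tags, lifting) someI_ex ex_in_conv)
      have V: "finite (V p)" "card (V p) \<le> (2 * B) ^ (?k - 1)" if p: "p \<in> PP" for p
      proof -
        show "finite (V p)" unfolding V_def using finX by simp
        show "card (V p) \<le> (2 * B) ^ (?k - 1)"
        proof (cases "?F p = {}")
          case False
          have "h p \<in> ?I \<rightarrow>\<^sub>E box B" using hF[OF False] by (simp add: Stuck_def)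
          then have "h p (j, c') \<in> R" using box_entry_R jn c(2) by blast
          then have "card {y \<in> box B. y - h p (j, c') \<in> p} \<le> (2 * B) ^ (?k - 1)"
            using p by (intro card_class_large) (auto simp: PP_def)
          then show ?thesis using False by (simp add: V_def)
        qed (simp add: V_def)
      qed
      show "\<exists>Z. (\<forall>x\<in>{(j, c')}. finite (Z x) \<and> real (card (Z x)) \<le> real K * real ((2 * B) ^ (?k - 1))) \<and>
        (\<forall>f\<in>A2. (\<forall>y\<in>?I - {(j, c')}. f y = f0 y) \<longrightarrow> (\<forall>x\<in>{(j, c')}. f x \<in> Z x))"
      proof (intro exI[of _ "\<lambda>x. \<Union>p\<in>PP. V p"] conjI ballI impI)
        show "finite (\<Union>p\<in>PP. V p)" using PP V by blast
        have "card (\<Union>p\<in>PP. V p) \<le> (\<Sum>p\<in>PP. card (V p))" by (rule card_UN_le[OF PP(1)])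
        also have "\<dots> \<le> (\<Sum>p\<in>PP. (2 * B) ^ (?k - 1))" by (intro sum_mono V)
        also have "\<dots> \<le> K * (2 * B) ^ (?k - 1)" using PP(2) by simp
        finally show "real (card (\<Union>p\<in>PP. V p)) \<le> real K * real ((2 * B) ^ (?k - 1))"
          by (simp only: of_nat_mult[symmetric] of_nat_le_iff)
      next
        fix f x assume f: "f \<in> A2" and ag: "\<forall>y\<in>?I - {(j, c')}. f y = f0 y" and x: "x \<in> {(j, c')}"
        obtain p where p: "prm p" "2 * B < pchar p" "f \<in> Stuck n m p j \<sigma> B"
          using f by (auto simp: A2_def A_def)
        have "?D f = ?D f0"
          by (rule minr_cong) (use ag c \<sigma>m jn in \<open>auto simp: less_Suc_eq\<close>)
        moreover have "?D f \<in> p" using p(3) c(1) unfolding Stuck_def by blast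
        ultimately have "?D f0 \<in> p" by simp
        then have pPP: "p \<in> PP" using p by (simp add: PP_def)
        have fF: "f \<in> ?F p" using p(3) ag by blast
        then have ne: "?F p \<noteq> {}" by blast
        have hS: "h p \<in> Stuck n m p j \<sigma> B" "\<forall>y\<in>?I - {(j, c')}. h p y = f0 y" using hF[OF ne] by auto
        have "f (j, c') - h p (j, c') \<in> p"
          by (rule Stuck_entry[OF p(1) jn \<sigma>m c(2,5) p(3) hS(1)], assumption) (use ag hS(2) c \<sigma>m jn in auto)
        moreover have "f (j, c') \<in> box B"
          using p(3) jn c(2) PiE_mem[of f ?I "\<lambda>_. box B" "(j, c')"] by (auto simp: Stuck_def)
        ultimately have "f (j, c') \<in> V p" using ne by (simp add: V_def)
        then show "f x \<in> (\<Union>p\<in>PP. V p)" using pPP x by blast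
      qed
    qed (use c jn in auto)
    have finA: "finite A" using AB finI finX by (meson finite_PiE finite_subset)
    have "A = A1 \<union> A2" by (auto simp: A1_def A2_def)
    then have "card A \<le> card A1 + card A2" by (simp add: card_Un_le)
    then have "real (card A) \<le> real (card A1) + real (card A2)" by linarith
    also have "\<dots> \<le> ?X ^ (n * m - 1) + real K * real ((2 * B) ^ (?k - 1)) * ?X ^ (n * m - 1)"
    proof (rule add_mono)
      show "real (card A1) \<le> ?X ^ (n * m - 1)" using A1 by simp
      show "real (card A2) \<le> real K * real ((2 * B) ^ (?k - 1)) * ?X ^ (n * m - 1)" using A2 by simp
    qed
    \<comment> \<open>The bound for \<open>A1\<close> is weakened to the shape of the one for
      \<open>A2\<close>, which turns \<open>K\<close> into \<open>K + 1\<close>.\<close>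
    also have "\<dots> \<le> real ((2 * B) ^ (?k - 1)) * ?X ^ (n * m - 1) + real K * real ((2 * B) ^ (?k - 1)) * ?X ^ (n * m - 1)"
    proof -
      have "1 \<le> (2 * B) ^ (?k - 1)" using B by (intro one_le_power) auto
      then have "1 \<le> real ((2 * B) ^ (?k - 1))" by linarith
      then have "1 * ?X ^ (n * m - 1) \<le> real ((2 * B) ^ (?k - 1)) * ?X ^ (n * m - 1)"
        by (intro mult_right_mono) auto
      then show ?thesis by simp
    qed
    also have "\<dots> = real (K + 1) * (real ((2 * B) ^ (?k - 1)) * ?X ^ (n * m - 1))"
      by (simp add: algebra_simps)
    also have "real ((2 * B) ^ (?k - 1)) * ?X ^ (n * m - 1) = ?X ^ (n * m) / real (2 * B)"
    proof -
      have "n * m > 0" using jn nm by simp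
      then have "?X ^ (n * m) = ?X * ?X ^ (n * m - 1)" by (metis power_minus_mult mult.commute)
      moreover have "?X = real (2 * B) ^ (?k - 1) * real (2 * B)"
        unfolding X using card_E_pos by (metis power_minus_mult)
      ultimately have "?X ^ (n * m) = real (2 * B) ^ (?k - 1) * real (2 * B) * ?X ^ (n * m - 1)"
        by simp
      then show ?thesis using B by (simp add: field_simps)
    qed
    finally show ?thesis unfolding A_def by simp
  qed
  then show ?thesis using that by blast
qed

end

subsection \<open>The density of rectangular unimodular matrices\<close>

context integer_ring
begin

section \<open>Transfer to the ideals, norms and boxes of the definitions\<close>

lemma ring_ring_of_integers: "ring (ring_of_integers :: 'a ring)"
proof (rule ringI)
  show "abelian_group (ring_of_integers :: 'a ring)"
  proof (rule abelian_groupI)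
    fix x assume "x \<in> carrier (ring_of_integers :: 'a ring)"
    then show "\<exists>y\<in>carrier ring_of_integers. y \<oplus>\<^bsub>ring_of_integers\<^esub> x = \<zero>\<^bsub>ring_of_integers\<^esub>"
      by (intro bexI[of _ "- x"]) (auto simp: ring_of_integers_def)
  qed (use R_add in \<open>auto simp: ring_of_integers_def alg_ints_def add_ac\<close>)
  show "Group.monoid (ring_of_integers :: 'a ring)"
    by (rule monoidI) (use R_mult R_1 in \<open>auto simp: ring_of_integers_def alg_ints_def mult_ac\<close>)
qed (auto simp: ring_of_integers_def algebra_simps)

lemma carrier_ring_of_integers: "carrier (ring_of_integers :: 'a ring) = R"
  by (simp add: ring_of_integers_def alg_ints_def)

lemma ideal_iff_nideal: "ideal I (ring_of_integers :: 'a ring) \<and> I \<noteq> {0} \<longleftrightarrow> nideal I"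
proof
  assume h: "ideal I (ring_of_integers :: 'a ring) \<and> I \<noteq> {0}"
  then interpret ideal I "ring_of_integers :: 'a ring" by simp
  have 0: "0 \<in> I"
    using additive_subgroup.zero_closed[OF is_additive_subgroup] by (simp add: ring_of_integers_def)
  then obtain x where x: "x \<in> I" "x \<noteq> 0" using h by blast
  show "nideal I"
  proof (rule nidealI[OF _ x])
    show "I \<subseteq> R" using a_subset by (simp add: carrier_ring_of_integers)
    show "x + y \<in> I" if "x \<in> I" "y \<in> I" for x y
      using additive_subgroup.a_closed[OF is_additive_subgroup that] by (simp add: ring_of_integers_def)
    show "r * x \<in> I" if "r \<in> R" "x \<in> I" for r x
      using I_l_closed[OF that(2), of r] that(1) by (simp add: ring_of_integers_def alg_ints_def)
  qed
next
  assume I: "nideal I"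
  have "ideal I (ring_of_integers :: 'a ring)"
  proof (rule idealI[OF ring_ring_of_integers])
    show "subgroup I (add_monoid (ring_of_integers :: 'a ring))"
    proof (rule group.subgroupI)
      show "Group.group (add_monoid (ring_of_integers :: 'a ring))"
        using ring_ring_of_integers by (intro abelian_group.a_group) (simp add: ring.is_abelian_group)
      show "I \<subseteq> carrier (add_monoid ring_of_integers)"
        using nideal_sub[OF I] by (auto simp: ring_of_integers_def alg_ints_def)
      show "I \<noteq> {}" using nideal_0[OF I] by blast
      show "inv\<^bsub>add_monoid ring_of_integers\<^esub> x \<in> I" if x: "x \<in> I" for x
      proof -
        have "\<ominus>\<^bsub>ring_of_integers\<^esub> x = - x"
        proof (rule abelian_group.minus_equality)
          show "abelian_group (ring_of_integers :: 'a ring)"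
            using ring_ring_of_integers by (simp add: ring.is_abelian_group)
        qed (use nideal_sub[OF I x] in \<open>auto simp: ring_of_integers_def alg_ints_def\<close>)
        then show ?thesis using nideal_uminus[OF I x] by (simp add: a_inv_def)
      qed
      show "x \<otimes>\<^bsub>add_monoid ring_of_integers\<^esub> y \<in> I" if "x \<in> I" "y \<in> I" for x y
        using nideal_add[OF I that] by (simp add: ring_of_integers_def)
    qed
    show "x \<otimes>\<^bsub>ring_of_integers\<^esub> a \<in> I" "a \<otimes>\<^bsub>ring_of_integers\<^esub> x \<in> I"
      if "a \<in> I" "x \<in> carrier ring_of_integers" for a x
      using nideal_mult[OF I, of x a] nideal_mult'[OF I, of x a] that
      by (auto simp: ring_of_integers_def alg_ints_def)
  qed
  then show "ideal I (ring_of_integers :: 'a ring) \<and> I \<noteq> {0}" using nideal_nonzero[OF I] by blast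
qed

lemma ideal_norm_eq_idx:
  assumes I: "nideal I"
  shows "ideal_norm I = idx I"
proof -
  have cos: "(\<Union>h\<in>I. {h + x}) = cls I x" if x: "x \<in> R" for x
  proof (intro equalityI subsetI)
    fix y assume "y \<in> (\<Union>h\<in>I. {h + x})"
    then show "y \<in> cls I x" using nideal_sub[OF I] x by (auto simp: cls_def)
  next
    fix y assume "y \<in> cls I x"
    then show "y \<in> (\<Union>h\<in>I. {h + x})" by (auto simp: cls_def intro!: bexI[of _ "y - x"])
  qed
  have "carrier (ring_of_integers Quot I) = (\<Union>x\<in>R. {\<Union>h\<in>I. {h + x}})"
    unfolding FactRing_def partial_object.simps A_RCOSETS_def' a_r_coset_def' carrier_ring_of_integers
    by (simp add: ring_of_integers_def)
  also have "\<dots> = cls I ` R" using cos by auto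
  finally show ?thesis by (simp add: ideal_norm_def idx_def)
qed

lemma dedekind_zeta_eq:
  assumes s: "s \<ge> 2"
  shows "dedekind_zeta TYPE('a) (of_nat s) = complex_of_real (zeta s)"
proof -
  have "((\<lambda>I. 1 / real (idx I) ^ s) has_sum zeta s) {I. nideal I}"
    unfolding zeta_def using zeta_summable[OF s] by simp
  then have "((\<lambda>I. complex_of_real (1 / real (idx I) ^ s)) has_sum complex_of_real (zeta s)) {I. nideal I}"
    by (rule has_sum_of_real)
  then have "infsum (\<lambda>I. complex_of_real (1 / real (idx I) ^ s)) {I. nideal I} = complex_of_real (zeta s)"
    by (rule infsumI)
  moreover have "dedekind_zeta TYPE('a) (of_nat s) = infsum (\<lambda>I. complex_of_real (1 / real (idx I) ^ s)) {I. nideal I}"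
    unfolding dedekind_zeta_def ideal_iff_nideal
  proof (rule infsum_cong)
    fix I assume I: "I \<in> {I. nideal I}"
    then have "idx I \<noteq> 0" using idx_pos[of I] by simp
    then show "1 / of_nat (ideal_norm I) powr of_nat s = complex_of_real (1 / real (idx I) ^ s)"
      using I s by (simp add: ideal_norm_eq_idx powr_nat')
  qed
  ultimately show ?thesis by simp
qed

lemma integer_box_eq: "integer_box E B = box B"
proof (intro equalityI subsetI)
  fix x assume "x \<in> integer_box E B"
  then obtain a where "x = comb a" "a \<in> E \<rightarrow> {- int B..<int B}"
    by (auto simp: integer_box_def comb_def)
  then show "x \<in> box B" by (auto simp: rbox_def co_comb Pi_iff)
next
  fix x assume x: "x \<in> box B"
  then have "x = comb (co x)" using comb_co[OF box_R[OF x]] by simp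
  moreover have "co x \<in> E \<rightarrow> {- int B..<int B}" using x by (auto simp: rbox_def)
  ultimately show "x \<in> integer_box E B" unfolding integer_box_def comb_def by blast
qed

abbreviation unimodular_count :: "nat \<Rightarrow> nat \<Rightarrow> nat \<Rightarrow> nat" where
  "unimodular_count n m B \<equiv> card {a \<in> cells n m \<rightarrow>\<^sub>E box B. \<forall>p. prm p \<longrightarrow> indep p m n a}"

text \<open>Functions on the cells correspond to flattened matrices, with the entry at
  \<open>(i, c)\<close> in position \<open>i * m + c\<close>; \<open>card_E\<close> matches the
  normalising powers.\<close>

lemma box_ratio_unimodular:
  assumes nm: "n < m"
  shows "box_ratio (n * m) E (flatten_mat ` {M. rectangular_unimodular (carrier ring_of_integers) n m M}) B =
    real (unimodular_count n m B) / real (card (box B)) ^ (n * m)"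
proof -
  let ?A = "{a \<in> cells n m \<rightarrow>\<^sub>E box B. \<forall>p. prm p \<longrightarrow> indep p m n a}"
  let ?V = "{v \<in> carrier_vec (n * m). set\<^sub>v v \<subseteq> integer_box E B} \<inter>
    flatten_mat ` {M. rectangular_unimodular (carrier ring_of_integers) n m M}"
  define mt :: "(nat \<times> nat \<Rightarrow> 'a) \<Rightarrow> 'a Matrix.mat" where "mt a = Matrix.mat n m a" for a
  have mt: "mt a \<in> carrier_mat n m" "\<And>i c. i < n \<Longrightarrow> c < m \<Longrightarrow> mt a $$ (i,c) = a (i,c)" for a
    by (auto simp: mt_def)
  have kdiv: "k div m < n" "k mod m < m" if "k < n * m" for k
    using that nm by (auto simp: less_mult_imp_div_less)
  have flat: "flatten_mat M $ (i * m + c) = M $$ (i,c)" if "M \<in> carrier_mat n m" "i < n" "c < m" for M :: "'a Matrix.mat" and i c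
  proof -
    have "i * m + c < Suc i * m" using that by simp
    also have "\<dots> \<le> n * m" using that by (intro mult_le_mono1) simp
    finally show ?thesis using that by (auto simp: flatten_mat_def)
  qed
  have ind: "indep p m n (($$) (mt a)) \<longleftrightarrow> indep p m n a" if "prm p" for p a
    by (rule indep_cong[OF that]) (simp add: mt nideal_0[OF prm_nideal[OF that]])
  have ru: "rectangular_unimodular (carrier ring_of_integers) n m (mt a) \<longleftrightarrow>
      (\<forall>i<n. \<forall>c<m. a (i,c) \<in> R) \<and> (\<forall>p. prm p \<longrightarrow> indep p m n a)" for a
    unfolding carrier_ring_of_integers rectangular_unimodular_iff[OF nm] using mt ind by auto
  have "bij_betw (\<lambda>a. flatten_mat (mt a)) ?A ?V"
    unfolding bij_betw_def
  proof
    show "inj_on (\<lambda>a. flatten_mat (mt a)) ?A"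
    proof (rule inj_onI)
      fix a b assume ab: "a \<in> ?A" "b \<in> ?A" "flatten_mat (mt a) = flatten_mat (mt b)"
      have "a \<in> cells n m \<rightarrow>\<^sub>E box B" "b \<in> cells n m \<rightarrow>\<^sub>E box B" using ab by auto
      then show "a = b"
      proof (rule PiE_ext)
        fix x assume "x \<in> cells n m"
        then obtain i c where x: "x = (i,c)" "i < n" "c < m" by auto
        then show "a x = b x" using flat[OF mt(1), of i c a] flat[OF mt(1), of i c b] ab(3) mt(2) by simp
      qed
    qed
    show "(\<lambda>a. flatten_mat (mt a)) ` ?A = ?V"
    proof (intro equalityI subsetI)
      fix v assume "v \<in> (\<lambda>a. flatten_mat (mt a)) ` ?A"
      then obtain a where a: "a \<in> cells n m \<rightarrow>\<^sub>E box B" "\<forall>p. prm p \<longrightarrow> indep p m n a" "v = flatten_mat (mt a)"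
        by blast
      have ab: "a (i,c) \<in> box B" if "i < n" "c < m" for i c using PiE_mem[OF a(1), of "(i,c)"] that by simp
      have "rectangular_unimodular (carrier ring_of_integers) n m (mt a)"
        unfolding ru using a(2) ab box_R by blast
      moreover have "v \<in> carrier_vec (n * m)" using a(3) mt(1)[of a] by (simp add: flatten_mat_def)
      moreover have "set\<^sub>v v \<subseteq> box B"
      proof
        fix y assume "y \<in> set\<^sub>v v"
        then obtain k where k: "k < n * m" "y = v $ k"
          using a(3) mt(1)[of a] by (auto simp: vec_set_def flatten_mat_def)
        then have "y = a (k div m, k mod m)"
          using a(3) mt(1)[of a] mt(2)[OF kdiv[OF k(1)], of a] by (simp add: flatten_mat_def)
        then show "y \<in> box B" using ab kdiv[OF k(1)] by simp
      qed
      ultimately show "v \<in> ?V" using a(3) unfolding integer_box_eq by blast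
    next
      fix v assume v: "v \<in> ?V"
      then obtain M where M: "rectangular_unimodular (carrier ring_of_integers) n m M" "v = flatten_mat M" by blast
      have Mc: "M \<in> carrier_mat n m" using M(1) by (simp add: rectangular_unimodular_def)
      define a where "a = (\<lambda>x\<in>cells n m. M $$ x)"
      have mM: "mt a = M" using Mc by (intro eq_matI) (auto simp: mt_def a_def)
      have "M $$ (i,c) \<in> box B" if ic: "i < n" "c < m" for i c
      proof -
        have "i * m + c < Suc i * m" using ic by simp
        also have "\<dots> \<le> n * m" using ic by (intro mult_le_mono1) simp
        finally have "v $ (i * m + c) \<in> set\<^sub>v v" using v by (auto simp: vec_set_def)
        then show ?thesis using flat[OF Mc ic] M(2) v integer_box_eq by auto
      qed
      then have "a \<in> cells n m \<rightarrow>\<^sub>E box B" by (auto simp: a_def)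
      moreover have "\<forall>p. prm p \<longrightarrow> indep p m n a" using M(1) ru[of a] mM by simp
      ultimately show "v \<in> (\<lambda>a. flatten_mat (mt a)) ` ?A" using mM M(2) by blast
    qed
  qed
  then have "card ?V = unimodular_count n m B" by (simp add: bij_betw_same_card)
  then show ?thesis
    unfolding box_ratio_def card_E[symmetric] card_box by (simp add: power_mult mult.commute)
qed

text \<open>The primes outside \<open>S\<close> contribute at most the tail of \<open>\<Sum> (idx p) ^ -2\<close> for characteristic at most
  \<open>2 B\<close>, and \<open>O(1 / B)\<close> beyond.\<close>

lemma unimodular_count_bounds:
  assumes nm: "n < m"
  obtains C :: real where "C \<ge> 0" and "\<And>B S. B > 0 \<Longrightarrow> finite S \<Longrightarrow> S \<subseteq> {p. prm p} \<Longrightarrow>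
    \<exists>F. finite F \<and> F \<subseteq> {p. prm p} - S \<and>
    real (card {a \<in> cells n m \<rightarrow>\<^sub>E box B. \<forall>p\<in>S. indep p m n a}) / real (card (box B)) ^ (n * m)
      - C * (\<Sum>p\<in>F. 1 / real (idx p) ^ 2) - C / real B
      \<le> real (unimodular_count n m B) / real (card (box B)) ^ (n * m)"
proof -
  \<comment> \<open>All places where the greedy enlargement can stop, a finite set that depends on
    \<open>n\<close> and \<open>m\<close> only.\<close>
  define Sg where "Sg = (SIGMA j:{..<n}. {..<j} \<rightarrow>\<^sub>E {..<m})"
  have finSg: "finite Sg" unfolding Sg_def by (intro finite_SigmaI finite_PiE) auto
  obtain K where K: "\<And>B j \<sigma>. B > 0 \<Longrightarrow> j < n \<Longrightarrow> \<sigma> \<in> {..<j} \<rightarrow>\<^sub>E {..<m} \<Longrightarrow>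
    real (card (\<Union>p\<in>{p. prm p \<and> 2 * B < pchar p}. Stuck n m p j \<sigma> B)) \<le>
      real K * real (card (box B)) ^ (n * m) / real (2 * B)"
    by (rule card_Stuck_large[OF nm]) blast
  \<comment> \<open>One term for the small primes, with 9 the square of the 3 in
    \<open>card_class_small\<close> because two entries are determined, and one for the large
    primes, both multiplied by the number of stopping places.\<close>
  define C where "C = real (card Sg) * (9 ^ card E + real K)"
  have C0: "C \<ge> 0" by (simp add: C_def)
  have "\<exists>F. finite F \<and> F \<subseteq> {p. prm p} - S \<and>
    real (card {a \<in> cells n m \<rightarrow>\<^sub>E box B. \<forall>p\<in>S. indep p m n a}) / real (card (box B)) ^ (n * m)
      - C * (\<Sum>p\<in>F. 1 / real (idx p) ^ 2) - C / real B
      \<le> real (unimodular_count n m B) / real (card (box B)) ^ (n * m)"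
    if B: "B > 0" and S: "finite S" "S \<subseteq> {p. prm p}" for B S
  proof -
    let ?X = "real (card (box B))"
    let ?AS = "{a \<in> cells n m \<rightarrow>\<^sub>E box B. \<forall>p\<in>S. indep p m n a}"
    let ?A = "{a \<in> cells n m \<rightarrow>\<^sub>E box B. \<forall>p. prm p \<longrightarrow> indep p m n a}"
    \<comment> \<open>\<open>F\<close> grows with \<open>B\<close>, but every sum over it is part of
      the tail outside \<open>S\<close> of a convergent series; this makes the estimate
      uniform.\<close>
    define F where "F = {p. prm p \<and> pchar p \<le> 2 * B} - S"
    define Sm where "Sm = (\<Union>p\<in>F. \<Union>(j,\<sigma>)\<in>Sg. Stuck n m p j \<sigma> B)"
    define La where "La = (\<Union>(j,\<sigma>)\<in>Sg. \<Union>p\<in>{p. prm p \<and> 2 * B < pchar p}. Stuck n m p j \<sigma> B)"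
    have "{p. prm p \<and> pchar p \<le> 2 * B} = (\<Union>l\<in>{..2 * B}. {p. prm p \<and> pchar p = l})" by auto
    then have finF: "finite F" unfolding F_def using primes_over(1) by simp
    have finAll: "finite (cells n m \<rightarrow>\<^sub>E box B)" using finite_rbox by (intro finite_PiE) auto
    have finStuck: "finite (Stuck n m p j \<sigma> B)" for p j \<sigma>
      by (rule finite_subset[OF _ finAll]) (auto simp: Stuck_def)
    have finSm: "finite Sm" unfolding Sm_def using finF finSg finStuck by auto
    have finLa: "finite La"
      by (rule finite_subset[OF _ finAll]) (auto simp: La_def Stuck_def)
    have X0: "?X > 0" using B by (simp add: card_box)
    have "?AS \<subseteq> ?A \<union> (Sm \<union> La)"
    proof
      fix a assume a: "a \<in> ?AS"
      then have aB: "a \<in> cells n m \<rightarrow>\<^sub>E box B" by simp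
      show "a \<in> ?A \<union> (Sm \<union> La)"
      proof (cases "\<forall>p. prm p \<longrightarrow> indep p m n a")
        case True
        then show ?thesis using aB by blast
      next
        case False
        then obtain p where p: "prm p" "\<not> indep p m n a" by blast
        then have pS: "p \<notin> S" using a by blast
        obtain j \<sigma> where j: "j < n" "\<sigma> \<in> {..<j} \<rightarrow>\<^sub>E {..<m}" "minr j \<sigma> a \<notin> p"
            "\<And>c. c < m \<Longrightarrow> minr (Suc j) (\<sigma>(j := c)) a \<in> p"
          using not_indep_stuck[where n = n and m = m and a = a, OF p(1) _ p(2)] box_entry_R[OF aB] by metis
        have js: "(j, \<sigma>) \<in> Sg" using j(1,2) by (simp add: Sg_def)
        have st: "a \<in> Stuck n m p j \<sigma> B" using aB j(3,4) by (simp add: Stuck_def)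
        show ?thesis
        proof (cases "pchar p \<le> 2 * B")
          case True
          then have "a \<in> Sm" unfolding Sm_def F_def using p(1) pS js st by blast
          then show ?thesis by blast
        next
          case False
          then have "a \<in> La" unfolding La_def using p(1) st by (intro UN_I[OF js]) auto
          then show ?thesis by blast
        qed
      qed
    qed
    then have "card ?AS \<le> card (?A \<union> (Sm \<union> La))"
      using finAll finSm finLa by (intro card_mono) auto
    also have "\<dots> \<le> card ?A + (card Sm + card La)"
      by (meson add_left_mono card_Un_le order_trans)
    finally have 1: "real (card ?AS) \<le> real (card ?A) + (real (card Sm) + real (card La))" by linarith
    have "card Sm \<le> (\<Sum>p\<in>F. card (\<Union>(j,\<sigma>)\<in>Sg. Stuck n m p j \<sigma> B))"
      unfolding Sm_def by (rule card_UN_le[OF finF])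
    also have "\<dots> \<le> (\<Sum>p\<in>F. \<Sum>(j,\<sigma>)\<in>Sg. card (Stuck n m p j \<sigma> B))"
      by (intro sum_mono order_trans[OF card_UN_le[OF finSg]]) (simp add: case_prod_unfold)
    finally have "real (card Sm) \<le> real (\<Sum>p\<in>F. \<Sum>(j,\<sigma>)\<in>Sg. card (Stuck n m p j \<sigma> B))"
      by (simp only: of_nat_le_iff)
    also have "\<dots> = (\<Sum>p\<in>F. \<Sum>(j,\<sigma>)\<in>Sg. real (card (Stuck n m p j \<sigma> B)))" by (simp add: case_prod_unfold)
    also have "\<dots> \<le> (\<Sum>p\<in>F. \<Sum>z\<in>Sg. 9 ^ card E * ?X ^ (n * m) * (1 / real (idx p) ^ 2))"
    proof (intro sum_mono)
      fix p z assume p: "p \<in> F" and z: "z \<in> Sg"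
      obtain j \<sigma> where js: "z = (j, \<sigma>)" by (cases z)
      have j: "j < n" "\<sigma> \<in> {..<j} \<rightarrow>\<^sub>E {..<m}" using z js by (auto simp: Sg_def)
      have nm2: "n * m \<ge> 2"
      proof -
        have "1 * 2 \<le> n * m" using j(1) nm by (intro mult_le_mono) auto
        then show ?thesis by simp
      qed
      have "real (card (Stuck n m p j \<sigma> B)) \<le>
          (3 ^ card E * ?X / real (idx p)) ^ 2 * ?X ^ (n * m - 2)"
        by (rule card_Stuck_small[OF _ _ j(1) nm j(2)]) (use p in \<open>auto simp: F_def\<close>)
      also have "\<dots> = (3 ^ card E) ^ 2 * (?X ^ 2 * ?X ^ (n * m - 2)) * (1 / real (idx p) ^ 2)"
        by (simp add: power_divide power_mult_distrib)
      also have "?X ^ 2 * ?X ^ (n * m - 2) = ?X ^ (n * m)"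
        using power_add[of ?X 2 "n * m - 2"] nm2 by (simp only: le_add_diff_inverse)
      also have "((3::real) ^ card E) ^ 2 = 9 ^ card E"
        by (simp add: power2_eq_square power_mult_distrib[symmetric])
      finally show "(case z of (j,\<sigma>) \<Rightarrow> real (card (Stuck n m p j \<sigma> B))) \<le>
          9 ^ card E * ?X ^ (n * m) * (1 / real (idx p) ^ 2)" using js by simp
    qed
    also have "\<dots> = real (card Sg) * 9 ^ card E * (\<Sum>p\<in>F. 1 / real (idx p) ^ 2) * ?X ^ (n * m)"
      by (simp add: sum_distrib_left sum_distrib_right mult_ac)
    finally have 2: "real (card Sm) \<le> real (card Sg) * 9 ^ card E * (\<Sum>p\<in>F. 1 / real (idx p) ^ 2) * ?X ^ (n * m)" .
    have "card La \<le> (\<Sum>z\<in>Sg. card (case z of (j,\<sigma>) \<Rightarrow> \<Union>p\<in>{p. prm p \<and> 2 * B < pchar p}. Stuck n m p j \<sigma> B))"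
      unfolding La_def by (rule card_UN_le[OF finSg])
    then have "real (card La) \<le> (\<Sum>z\<in>Sg. real (card (case z of (j,\<sigma>) \<Rightarrow> \<Union>p\<in>{p. prm p \<and> 2 * B < pchar p}. Stuck n m p j \<sigma> B)))"
      by (simp only: of_nat_sum[symmetric] of_nat_le_iff)
    also have "\<dots> \<le> (\<Sum>z\<in>Sg. real K * ?X ^ (n * m) / real (2 * B))"
    proof (rule sum_mono)
      fix z assume z: "z \<in> Sg"
      obtain j \<sigma> where js: "z = (j, \<sigma>)" by (cases z)
      have j: "j < n" "\<sigma> \<in> {..<j} \<rightarrow>\<^sub>E {..<m}" using z js by (auto simp: Sg_def)
      show "real (card (case z of (j,\<sigma>) \<Rightarrow> \<Union>p\<in>{p. prm p \<and> 2 * B < pchar p}. Stuck n m p j \<sigma> B)) \<le>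
          real K * ?X ^ (n * m) / real (2 * B)"
        using K[OF B j] js by simp
    qed
    also have "\<dots> = real (card Sg) * real K / real (2 * B) * ?X ^ (n * m)" by simp
    also have "\<dots> \<le> C / real B * ?X ^ (n * m)"
    proof (intro mult_right_mono frac_le)
      have "real (card Sg) * real K \<le> real (card Sg) * (9 ^ card E + real K)" by (intro mult_left_mono) auto
      then show "real (card Sg) * real K \<le> C" by (simp add: C_def)
    qed (use B C0 in auto)
    finally have 3: "real (card La) \<le> C / real B * ?X ^ (n * m)" .
    have "real (card Sg) * 9 ^ card E * (\<Sum>p\<in>F. 1 / real (idx p) ^ 2) \<le> C * (\<Sum>p\<in>F. 1 / real (idx p) ^ 2)"
    proof (rule mult_right_mono)
      have "real (card Sg) * 9 ^ card E \<le> real (card Sg) * (9 ^ card E + real K)" by (intro mult_left_mono) auto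
      then show "real (card Sg) * 9 ^ card E \<le> C" by (simp add: C_def)
    qed (simp add: sum_nonneg)
    then have "real (card Sg) * 9 ^ card E * (\<Sum>p\<in>F. 1 / real (idx p) ^ 2) * ?X ^ (n * m) \<le>
        C * (\<Sum>p\<in>F. 1 / real (idx p) ^ 2) * ?X ^ (n * m)"
      by (rule mult_right_mono) simp
    then have "real (card ?AS) \<le> real (card ?A) +
        (C * (\<Sum>p\<in>F. 1 / real (idx p) ^ 2) * ?X ^ (n * m) + C / real B * ?X ^ (n * m))"
      using 1 2 3 by linarith
    then have "real (card ?AS) / ?X ^ (n * m) \<le> (real (card ?A) +
        (C * (\<Sum>p\<in>F. 1 / real (idx p) ^ 2) * ?X ^ (n * m) + C / real B * ?X ^ (n * m))) / ?X ^ (n * m)"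
      by (rule divide_right_mono) simp
    also have "\<dots> = real (card ?A) / ?X ^ (n * m) + (C * (\<Sum>p\<in>F. 1 / real (idx p) ^ 2) + C / real B)"
      using X0 by (simp add: add_divide_distrib)
    finally have "real (card ?AS) / ?X ^ (n * m) - C * (\<Sum>p\<in>F. 1 / real (idx p) ^ 2) - C / real B
      \<le> real (card ?A) / ?X ^ (n * m)" by linarith
    moreover have "F \<subseteq> {p. prm p} - S" by (auto simp: F_def)
    ultimately show ?thesis using finF by blast
  qed
  then show ?thesis using that C0 by blast
qed

text \<open>The product over \<open>i\<close> is finite, so the Euler products may be inverted and
  passed to the limit one by one; \<open>zeta_ge_1\<close> keeps the limits away from 0.\<close>

lemma finite_primes_limit:
  assumes nm: "n < m"
  shows "((\<lambda>S. \<Prod>p\<in>S. \<Prod>i<n. 1 - 1 / real (idx p) ^ (m - i)) \<longlongrightarrow> (\<Prod>i<n. 1 / zeta (m - i)))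
    (finite_subsets_at_top {p. prm p})"
proof -
  have "((\<lambda>S. \<Prod>i<n. inverse (\<Prod>p\<in>S. 1 / (1 - 1 / real (idx p) ^ (m - i)))) \<longlongrightarrow>
      (\<Prod>i<n. inverse (zeta (m - i)))) (finite_subsets_at_top {p. prm p})"
  proof (intro tendsto_prod tendsto_inverse euler_product)
    fix i assume "i \<in> {..<n}"
    then show s: "2 \<le> m - i" using nm by auto
    show "zeta (m - i) \<noteq> 0" using zeta_ge_1[OF s] by linarith
  qed
  moreover have "(\<Prod>i<n. inverse (\<Prod>p\<in>S. 1 / (1 - 1 / real (idx p) ^ (m - i)))) =
      (\<Prod>p\<in>S. \<Prod>i<n. 1 - 1 / real (idx p) ^ (m - i))" for S
    by (subst prod.swap) (simp add: prod_inversef[symmetric] divide_inverse)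
  ultimately show ?thesis by (simp add: divide_inverse)
qed

text \<open>\<open>S\<close> is chosen before \<open>B\<close>: it makes the tail of the series and
  the distance of the finite product from the limit small, and only then \<open>B\<close> grows. For
  the upper bound \<open>S\<close> alone suffices, as independence at all primes implies it at those
  of \<open>S\<close>.\<close>

lemma unimodular_density:
  assumes nm: "n < m"
  shows "(\<lambda>B. real (unimodular_count n m B) / real (card (box B)) ^ (n * m)) \<longlonglongrightarrow> (\<Prod>i<n. 1 / zeta (m - i))"
proof (rule LIMSEQ_I)
  fix e :: real assume e: "e > 0"
  let ?d = "\<Prod>i<n. 1 / zeta (m - i)" and ?f = "\<lambda>p. 1 / real (idx p) ^ 2"
  let ?r = "\<lambda>B. real (unimodular_count n m B) / real (card (box B)) ^ (n * m)"
  let ?rS = "\<lambda>S B. real (card {a \<in> cells n m \<rightarrow>\<^sub>E box B. \<forall>p\<in>S. indep p m n a}) / real (card (box B)) ^ (n * m)"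
  let ?dS = "\<lambda>S. \<Prod>p\<in>S. \<Prod>i<n. 1 - 1 / real (idx p) ^ (m - i)"
  obtain C where C: "C \<ge> 0" "\<And>B S. B > 0 \<Longrightarrow> finite S \<Longrightarrow> S \<subseteq> {p. prm p} \<Longrightarrow>
    \<exists>F. finite F \<and> F \<subseteq> {p. prm p} - S \<and> ?rS S B - C * sum ?f F - C / real B \<le> ?r B"
    by (rule unimodular_count_bounds[OF nm]) blast
  \<comment> \<open>The error is split into four quarters of \<open>e\<close>. The denominator has
    \<open>C + 1\<close> since \<open>C\<close> may be 0.\<close>
  define e' where "e' = e / (4 * (C + 1))"
  have e': "e' > 0" "C * e' < e / 4" using e C(1) by (auto simp: e'_def field_simps)
  have sm: "?f summable_on {p. prm p}" by (rule summable_primes) simp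
  then have "(sum ?f \<longlongrightarrow> infsum ?f {p. prm p}) (finite_subsets_at_top {p. prm p})"
    by (rule infsum_tendsto)
  then have "\<forall>\<^sub>F S in finite_subsets_at_top {p. prm p}. dist (sum ?f S) (infsum ?f {p. prm p}) < e'"
    using e'(1) by (rule tendstoD)
  moreover have "\<forall>\<^sub>F S in finite_subsets_at_top {p. prm p}. dist (?dS S) ?d < e / 4"
    using finite_primes_limit[OF nm] e by (intro tendstoD) auto
  moreover have "\<forall>\<^sub>F S in finite_subsets_at_top {p. prm p}. finite S \<and> S \<subseteq> {p. prm p}"
    by (rule eventually_finite_subsets_at_top_weakI) simp
  ultimately have "\<forall>\<^sub>F S in finite_subsets_at_top {p. prm p}. dist (sum ?f S) (infsum ?f {p. prm p}) < e' \<and>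
      dist (?dS S) ?d < e / 4 \<and> finite S \<and> S \<subseteq> {p. prm p}"
    by eventually_elim auto
  then obtain S where S: "dist (sum ?f S) (infsum ?f {p. prm p}) < e'" "dist (?dS S) ?d < e / 4"
      "finite S" "S \<subseteq> {p. prm p}"
    using eventually_happens'[OF finite_subsets_at_top_neq_bot] by blast
  have tail: "sum ?f F < e'" if F: "finite F" "F \<subseteq> {p. prm p} - S" for F
  proof -
    have "sum ?f S + sum ?f F = sum ?f (S \<union> F)"
      using S(3) F by (subst sum.union_disjoint) auto
    also have "\<dots> \<le> infsum ?f {p. prm p}"
      using S(3,4) F sm by (intro finite_sum_le_infsum) auto
    finally show ?thesis using S(1) by (simp add: dist_real_def abs_if split: if_splits)
  qed
  have "?rS S \<longlonglongrightarrow> ?dS S" by (rule indep_density) (use S nm in auto)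
  then have "\<forall>\<^sub>F B in sequentially. dist (?rS S B) (?dS S) < e / 4"
    using e by (intro tendstoD) auto
  moreover have "(\<lambda>B. C / real B) \<longlonglongrightarrow> 0" using tendsto_mult[OF tendsto_const[of C] lim_1_over_n] by simp
  then have "\<forall>\<^sub>F B in sequentially. dist (C / real B) 0 < e / 4"
    using e by (intro tendstoD) auto
  moreover have "\<forall>\<^sub>F B in sequentially. B > (0::nat)" by (rule eventually_gt_at_top)
  ultimately have "\<forall>\<^sub>F B in sequentially. norm (?r B - ?d) < e"
  proof eventually_elim
    case (elim B)
    obtain F where F: "finite F" "F \<subseteq> {p. prm p} - S" "?rS S B - C * sum ?f F - C / real B \<le> ?r B"
      using C(2)[OF elim(3) S(3,4)] by blast
    have "C * sum ?f F \<le> C * e'" using tail[OF F(1,2)] C(1) by (intro mult_left_mono) auto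
    moreover have "C / real B < e / 4"
      using elim(2) abs_ge_self[of "C / real B"] unfolding dist_real_def diff_0_right by linarith
    ultimately have lo: "?rS S B - e / 4 - e / 4 < ?r B" using F(3) e'(2) by linarith
    have "{a \<in> cells n m \<rightarrow>\<^sub>E box B. \<forall>p. prm p \<longrightarrow> indep p m n a} \<subseteq>
        {a \<in> cells n m \<rightarrow>\<^sub>E box B. \<forall>p\<in>S. indep p m n a}" using S(4) by blast
    moreover have "finite {a \<in> cells n m \<rightarrow>\<^sub>E box B. \<forall>p\<in>S. indep p m n a}"
      using finite_rbox by (simp add: finite_PiE)
    ultimately have "unimodular_count n m B \<le> card {a \<in> cells n m \<rightarrow>\<^sub>E box B. \<forall>p\<in>S. indep p m n a}"
      by (rule card_mono[rotated])
    then have hi: "?r B \<le> ?rS S B" by (intro divide_right_mono) auto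
    have "\<bar>?rS S B - ?dS S\<bar> < e / 4" "\<bar>?dS S - ?d\<bar> < e / 4"
      using elim(1) S(2) by (simp_all add: dist_real_def)
    then show ?case using lo hi by (simp only: real_norm_def abs_less_iff) linarith
  qed
  then show "\<exists>N. \<forall>B\<ge>N. norm (?r B - ?d) < e" by (simp add: eventually_sequentially)
qed

lemma unimodular_limits:
  assumes nm: "n < m"
  shows "upper_density (n * m) E (flatten_mat ` {M. rectangular_unimodular (carrier ring_of_integers) n m M}) =
      ereal (\<Prod>i<n. 1 / zeta (m - i))"
    and "lower_density (n * m) E (flatten_mat ` {M. rectangular_unimodular (carrier ring_of_integers) n m M}) =
      ereal (\<Prod>i<n. 1 / zeta (m - i))"
proof -
  have "(\<lambda>B. ereal (box_ratio (n * m) E (flatten_mat ` {M. rectangular_unimodular (carrier ring_of_integers) n m M}) B))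
      \<longlonglongrightarrow> ereal (\<Prod>i<n. 1 / zeta (m - i))"
    unfolding box_ratio_unimodular[OF nm] lim_ereal by (rule unimodular_density[OF nm])
  then show "upper_density (n * m) E (flatten_mat ` {M. rectangular_unimodular (carrier ring_of_integers) n m M}) =
      ereal (\<Prod>i<n. 1 / zeta (m - i))"
    "lower_density (n * m) E (flatten_mat ` {M. rectangular_unimodular (carrier ring_of_integers) n m M}) =
      ereal (\<Prod>i<n. 1 / zeta (m - i))"
    unfolding upper_density_def lower_density_def by (auto intro: lim_imp_Limsup lim_imp_Liminf)
qed

lemma zeta_product:
  assumes nm: "n < m"
  shows "complex_of_real (\<Prod>i<n. 1 / zeta (m - i)) = (\<Prod>i<n. 1 / dedekind_zeta TYPE('a) (of_nat (m - i)))"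
proof -
  have "complex_of_real (1 / zeta (m - i)) = 1 / dedekind_zeta TYPE('a) (of_nat (m - i))" if "i < n" for i
    using dedekind_zeta_eq[of "m - i"] that nm by simp
  then show ?thesis unfolding of_real_prod by (intro prod.cong) auto
qed

end

text \<open>Without an integral basis the density statement is vacuous, but a real \<open>d\<close> still has to be exhibited;
  it does not matter whether the series converges, because \<open>infsum\<close> is \<open>0\<close> otherwise.\<close>

lemma infsum_Reals:
  fixes f :: "'b \<Rightarrow> complex"
  assumes "\<And>x. x \<in> A \<Longrightarrow> f x \<in> \<real>"
  shows "infsum f A \<in> \<real>"
proof (cases "f summable_on A")
  case True
  have "Im (infsum f A) = infsum (\<lambda>x. Im (f x)) A" by (rule infsum_Im[OF True, symmetric])
  also have "\<dots> = infsum (\<lambda>_. 0) A" using assms by (intro infsum_cong) (simp add: complex_is_Real_iff)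
  finally show ?thesis by (simp add: complex_is_Real_iff)
qed (simp add: infsum_not_exists)

lemma dedekind_zeta_Reals:
  assumes "s > 0"
  shows "dedekind_zeta TYPE('a::field_char_0) (of_nat s) \<in> \<real>"
  unfolding dedekind_zeta_def using assms by (intro infsum_Reals) (auto simp: powr_nat')

theorem theorem13:
  fixes n m :: nat
  assumes "number_field TYPE('a::field_char_0)"
    and "0 < n" and "n < m"
  shows "\<exists>d. has_density (n * m)
             (flatten_mat ` {M :: 'a Matrix.mat.
                rectangular_unimodular (carrier ring_of_integers) n m M}) d \<and>
           complex_of_real d = (\<Prod>i<n. 1 / dedekind_zeta TYPE('a) (of_nat (m - i)))"
proof -
  let ?z = "\<Prod>i<n. 1 / dedekind_zeta TYPE('a) (of_nat (m - i))"
  have "?z \<in> \<real>"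
    by (intro prod_in_Reals Reals_divide Reals_1 dedekind_zeta_Reals) (use assms(3) in auto)
  \<comment> \<open>\<open>d\<close> is extracted from the product of zeta values before a basis is
    chosen, so it is the same for all bases.\<close>
  then obtain d where d: "complex_of_real d = ?z" by (auto elim: Reals_cases)
  have "upper_density (n * m) E (flatten_mat ` {M :: 'a Matrix.mat. rectangular_unimodular (carrier ring_of_integers) n m M}) = ereal d \<and>
      lower_density (n * m) E (flatten_mat ` {M :: 'a Matrix.mat. rectangular_unimodular (carrier ring_of_integers) n m M}) = ereal d"
    if E: "integral_basis E" for E :: "'a set"
  proof -
    interpret integer_ring E using assms(1) E by unfold_locales
    have "complex_of_real (\<Prod>i<n. 1 / zeta (m - i)) = complex_of_real d"
      using zeta_product[OF assms(3)] d by simp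
    then have "(\<Prod>i<n. 1 / zeta (m - i)) = d" by (simp only: of_real_eq_iff)
    then show ?thesis using unimodular_limits[OF assms(3)] by simp
  qed
  then show ?thesis using d unfolding has_density_def by blast
qed

end
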